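(* Let $n\ge 4$ and let $q$ be a prime power. If $C$ is an EKR-set of flags of cotype $J$ in the oriflamme complex of the hyperbolic quadric of rank $n$ over $\mathbb{F}_q$, where $J^{w_0}=J$, then $$|C|\le\frac{v}{1+q^{n-1}},$$ where $v=[G:P_J]$ is the total number of flags of cotype $J$.
   Context: The hyperbolic quadric of rank $n$ is the polar space of nonzero totally singular subspaces of a nondegenerate hyperbolic quadratic form on $\mathbb{F}_q^{2n}$. Its $n$-dimensional subspaces (generators) fall into two classes, $N_1,N_2$ being in the same class iff $\dim(N_1\cap N_2)\equiv n\pmod2$. The oriflamme complex has as elements the totally singular subspaces of dimension $i$ (type $i$) for $1\le i\le n-2$, and the generators of the two classes (types $n$ and $n'$). Incidence is inclusion, except that generators of types $n$ and $n'$ are incident if they meet in an $(n-1)$-dimensional subspace. A flag is a set of pairwise incident elements; its type is the set of types of its members, its cotype $J$ is the complement of the type in $\{1,\dots,n-2,n,n'\}$. Maximal flags have cotype $\emptyset$. Two points are collinear if they span a totally singular subspace; a polar frame is a set of $2n$ points $\{e_{-n},\dots,e_{-1},e_1,\dots,e_n\}$ with each $e_i$ collinear with all points of the set except $e_{-i}$. Fix a polar frame and the maximal flag $F=\{\langle e_1\rangle,\dots,\langle e_1,\dots,e_{n-2}\rangle,\langle e_1,\dots,e_{n-1},e_n\rangle,\langle e_1,\dots,e_{n-1},e_{-n}\rangle\}$. Let $G=\mathrm{PGO}^+(2n,q)$ acting on the oriflamme complex type-preservingly (preserving both classes of generators), and $B$ the stabilizer of $F$; $G$ is transitive on maximal flags.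 The Weyl group $W$ of type $D_n$ is the group of permutations of $\{\pm1,\dots,\pm n\}$ generated by $S=\{s_1,\dots,s_{n-1},u\}$, $s_i=(i,i+1)(-i,-i-1)$, $u=ts_{n-1}t$ with $t=(-n,n)$; it acts on the frame by permuting indices (induced by elements of $G$). Its longest element is $w_0=(1,-1)\cdots(n,-n)$ if $n$ is even and $w_0=(1,-1)\cdots(n-1,-(n-1))$ if $n$ is odd. Types correspond to generators in $S$: $i\leftrightarrow s_i$ for $i\le n-2$, the class of $\langle e_1,\dots,e_{n-1},e_{-n}\rangle$ corresponds to $s_{n-1}$ and that of $\langle e_1,\dots,e_n\rangle$ to $u$ (the unique element of $F$ moved by the given generator). $J^{w_0}$ is the conjugate of $J$ by $w_0$ under this identification: for $n$ even $J^{w_0}=J$ always; for $n$ odd $w_0$ swaps $n$ and $n'$ and fixes all other types. $P_J=BW_JB$, where $W_J$ is the subgroup of $W$ generated by the elements of $S$ corresponding to $J$; it is the stabilizer of the flag of cotype $J$ contained in $F$. Two maximal flags $gF,hF$ are opposite if $Bh^{-1}gB=Bw_0B$. Two flags of cotypes $J$ and $K$ are opposite if $J^{w_0}=K$ and they can be extended to two opposite maximal flags. An EKR-set of flags of cotype $J=J^{w_0}$ is a set of such flags no two of which are opposite. *)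

theory Defs
  imports
    "HOL-Analysis.Cartesian_Space"
    "HOL-Algebra.Coset"
    "HOL-Algebra.Group_Action"
    "HOL-Combinatorics.Transposition"
begin

section \<open>Hyperbolic quadratic forms\<close>

definition polar_form :: "('a::field ^ 'm \<Rightarrow> 'a) \<Rightarrow> 'a ^ 'm \<Rightarrow> 'a ^ 'm \<Rightarrow> 'a" where
  "polar_form Q x y = Q (x + y) - Q x - Q y"

definition quadratic_form :: "('a::field ^ 'm \<Rightarrow> 'a) \<Rightarrow> bool" where
  "quadratic_form Q \<longleftrightarrow>
     (\<forall>c x. Q (c *s x) = c ^ 2 * Q x) \<and>
     (\<forall>x y z. polar_form Q (x + y) z = polar_form Q x z + polar_form Q y z) \<and>
     (\<forall>c x y. polar_form Q (c *s x) y = c * polar_form Q x y)"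

definition nondegenerate :: "('a::field ^ 'm \<Rightarrow> 'a) \<Rightarrow> bool" where
  "nondegenerate Q \<longleftrightarrow> (\<forall>x. Q x = 0 \<and> (\<forall>y. polar_form Q x y = 0) \<longrightarrow> x = 0)"

definition totally_singular :: "('a::field ^ 'm \<Rightarrow> 'a) \<Rightarrow> ('a ^ 'm) set \<Rightarrow> bool" where
  "totally_singular Q U \<longleftrightarrow> vec.subspace U \<and> (\<forall>x\<in>U. Q x = 0)"

text \<open>Hyperbolic means that the Witt index is \<open>n\<close>, the largest value a nondegenerate
  form in dimension \<open>2 * n\<close> can have.\<close>

definition hyperbolic_quadratic_form :: "nat \<Rightarrow> ('a::field ^ 'm \<Rightarrow> 'a) \<Rightarrow> bool" where
  "hyperbolic_quadratic_form n Q \<longleftrightarrow>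
     CARD('m) = 2 * n \<and> quadratic_form Q \<and> nondegenerate Q \<and>
     (\<exists>U. totally_singular Q U \<and> vec.dim U = n)"


section \<open>The oriflamme complex\<close>

definition generators :: "nat \<Rightarrow> ('a::field ^ 'm \<Rightarrow> 'a) \<Rightarrow> ('a ^ 'm) set set" where
  "generators n Q = {U. totally_singular Q U \<and> vec.dim U = n}"

definition elements :: "nat \<Rightarrow> ('a::field ^ 'm \<Rightarrow> 'a) \<Rightarrow> ('a ^ 'm) set set" where
  "elements n Q = {U. totally_singular Q U \<and> vec.dim U \<in> {1..n - 2}} \<union> generators n Q"

definition same_class :: "nat \<Rightarrow> ('a::field ^ 'm) set \<Rightarrow> ('a ^ 'm) set \<Rightarrow> bool" where
  "same_class n N N' \<longleftrightarrow> vec.dim (N \<inter> N') mod 2 = n mod 2"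

definition incident ::
    "nat \<Rightarrow> ('a::field ^ 'm \<Rightarrow> 'a) \<Rightarrow> ('a ^ 'm) set \<Rightarrow> ('a ^ 'm) set \<Rightarrow> bool" where
  "incident n Q U U' \<longleftrightarrow> U \<subseteq> U' \<or> U' \<subseteq> U \<or>
     (U \<in> generators n Q \<and> U' \<in> generators n Q \<and> \<not> same_class n U U' \<and>
      vec.dim (U \<inter> U') = n - 1)"

definition flags :: "nat \<Rightarrow> ('a::field ^ 'm \<Rightarrow> 'a) \<Rightarrow> ('a ^ 'm) set set set" where
  "flags n Q = {x. x \<subseteq> elements n Q \<and> (\<forall>U\<in>x. \<forall>U'\<in>x. incident n Q U U')}"


section \<open>Polar frames and types\<close>

definition points :: "('a::field ^ 'm \<Rightarrow> 'a) \<Rightarrow> ('a ^ 'm) set set" where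
  "points Q = {p. totally_singular Q p \<and> vec.dim p = 1}"

definition collinear_points ::
    "('a::field ^ 'm \<Rightarrow> 'a) \<Rightarrow> ('a ^ 'm) set \<Rightarrow> ('a ^ 'm) set \<Rightarrow> bool" where
  "collinear_points Q p p' \<longleftrightarrow> totally_singular Q (vec.span (p \<union> p'))"

definition frame_indices :: "nat \<Rightarrow> int set" where
  "frame_indices n = {- int n..int n} - {0}"

definition polar_frame ::
    "nat \<Rightarrow> ('a::field ^ 'm \<Rightarrow> 'a) \<Rightarrow> (int \<Rightarrow> ('a ^ 'm) set) \<Rightarrow> bool" where
  "polar_frame n Q e \<longleftrightarrow>
     inj_on e (frame_indices n) \<and> e ` frame_indices n \<subseteq> points Q \<and>
     (\<forall>i\<in>frame_indices n. \<forall>j\<in>frame_indices n. collinear_points Q (e i) (e j) \<longleftrightarrow> j \<noteq> - i)"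

definition frame_span :: "(int \<Rightarrow> ('a::field ^ 'm) set) \<Rightarrow> int set \<Rightarrow> ('a ^ 'm) set" where
  "frame_span e A = vec.span (\<Union>i\<in>A. e i)"

definition standard_flag :: "nat \<Rightarrow> (int \<Rightarrow> ('a::field ^ 'm) set) \<Rightarrow> ('a ^ 'm) set set" where
  "standard_flag n e =
     (\<lambda>i. frame_span e {1..int i}) ` {1..n - 2} \<union>
     {frame_span e {1..int n}, frame_span e (insert (- int n) {1..int n - 1})}"

text \<open>\<open>Gen\<close> and \<open>Gen'\<close> are the types \<open>n\<close> and \<open>n'\<close>: the class of
  \<open>\<langle>e\<^sub>1, \<dots>, e\<^sub>n\<rangle>\<close> and the class of \<open>\<langle>e\<^sub>1, \<dots>, e\<^sub>n\<^sub>-\<^sub>1, e\<^sub>-\<^sub>n\<rangle>\<close>.\<close>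

datatype elt_type = Dim nat | Gen | Gen'

definition elt_types :: "nat \<Rightarrow> elt_type set" where
  "elt_types n = Dim ` {1..n - 2} \<union> {Gen, Gen'}"

definition type_of ::
    "nat \<Rightarrow> (int \<Rightarrow> ('a::field ^ 'm) set) \<Rightarrow> ('a ^ 'm) set \<Rightarrow> elt_type" where
  "type_of n e U =
     (if vec.dim U \<noteq> n then Dim (vec.dim U)
      else if same_class n U (frame_span e {1..int n}) then Gen else Gen')"

definition cotype ::
    "nat \<Rightarrow> (int \<Rightarrow> ('a::field ^ 'm) set) \<Rightarrow> ('a ^ 'm) set set \<Rightarrow> elt_type set" where
  "cotype n e x = elt_types n - type_of n e ` x"

definition flags_of_cotype ::
    "nat \<Rightarrow> ('a::field ^ 'm \<Rightarrow> 'a) \<Rightarrow> (int \<Rightarrow> ('a ^ 'm) set) \<Rightarrow> elt_type set \<Rightarrow>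
     ('a ^ 'm) set set set" where
  "flags_of_cotype n Q e J = {x \<in> flags n Q. cotype n e x = J}"


section \<open>The Weyl group\<close>

text \<open>Permutations of \<open>{\<plusminus>1, \<dots>, \<plusminus>n}\<close> are functions on \<open>int\<close> that fix everything else.\<close>

definition refl_s :: "nat \<Rightarrow> int \<Rightarrow> int" where
  "refl_s i = Transposition.transpose (int i) (int i + 1) \<circ>
              Transposition.transpose (- int i) (- int i - 1)"

definition refl_u :: "nat \<Rightarrow> int \<Rightarrow> int" where
  "refl_u n = (let t = Transposition.transpose (- int n) (int n) in t \<circ> refl_s (n - 1) \<circ> t)"

definition w0 :: "nat \<Rightarrow> int \<Rightarrow> int" where
  "w0 n i = (if \<bar>i\<bar> \<le> (if even n then int n else int n - 1) then - i else i)"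

text \<open>A type corresponds to the generator that moves the element of this type in the standard
  flag.\<close>

fun refl_of_type :: "nat \<Rightarrow> elt_type \<Rightarrow> int \<Rightarrow> int" where
  "refl_of_type n (Dim i) = refl_s i"
| "refl_of_type n Gen = refl_u n"
| "refl_of_type n Gen' = refl_s (n - 1)"

definition conj_w0 :: "nat \<Rightarrow> elt_type set \<Rightarrow> elt_type set" where
  "conj_w0 n J = {\<tau> \<in> elt_types n. \<exists>\<sigma>\<in>J.
     refl_of_type n \<tau> = inv_into UNIV (w0 n) \<circ> refl_of_type n \<sigma> \<circ> w0 n}"


section \<open>The group and opposition\<close>

text \<open>The similarities of \<open>Q\<close> that preserve both classes of generators.\<close>

definition similarities :: "nat \<Rightarrow> ('a::field ^ 'm \<Rightarrow> 'a) \<Rightarrow> ('a ^ 'm \<Rightarrow> 'a ^ 'm) set" where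
  "similarities n Q = {f. Vector_Spaces.linear (*s) (*s) f \<and> bij f \<and>
     (\<exists>c. c \<noteq> 0 \<and> (\<forall>x. Q (f x) = c * Q x)) \<and>
     (\<forall>N\<in>generators n Q. same_class n N (f ` N))}"

text \<open>Their permutation group on the elements of the complex. Passing to the induced
  permutations is what factors out the scalars.\<close>

definition PGO :: "nat \<Rightarrow> ('a::field ^ 'm \<Rightarrow> 'a) \<Rightarrow> (('a ^ 'm) set \<Rightarrow> ('a ^ 'm) set) monoid" where
  "PGO n Q = BijGroup (elements n Q)
     \<lparr>carrier := (\<lambda>f. \<lambda>U\<in>elements n Q. f ` U) ` similarities n Q\<rparr>"

definition Borel ::
    "nat \<Rightarrow> ('a::field ^ 'm \<Rightarrow> 'a) \<Rightarrow> (int \<Rightarrow> ('a ^ 'm) set) \<Rightarrow>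
     (('a ^ 'm) set \<Rightarrow> ('a ^ 'm) set) set" where
  "Borel n Q e = stabilizer (PGO n Q) (\<lambda>g x. g ` x) (standard_flag n e)"

definition double_coset ::
    "nat \<Rightarrow> ('a::field ^ 'm \<Rightarrow> 'a) \<Rightarrow> (int \<Rightarrow> ('a ^ 'm) set) \<Rightarrow>
     (('a ^ 'm) set \<Rightarrow> ('a ^ 'm) set) \<Rightarrow> (('a ^ 'm) set \<Rightarrow> ('a ^ 'm) set) set" where
  "double_coset n Q e g = Borel n Q e <#>\<^bsub>PGO n Q\<^esub> {g} <#>\<^bsub>PGO n Q\<^esub> Borel n Q e"

definition induces ::
    "nat \<Rightarrow> (int \<Rightarrow> ('a::field ^ 'm) set) \<Rightarrow> (('a ^ 'm) set \<Rightarrow> ('a ^ 'm) set) \<Rightarrow>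
     (int \<Rightarrow> int) \<Rightarrow> bool" where
  "induces n e g \<pi> \<longleftrightarrow> (\<forall>i\<in>frame_indices n. g (e i) = e (\<pi> i))"

text \<open>\<open>B w\<^sub>0 B\<close> is the double coset of any group element inducing \<open>w\<^sub>0\<close> on the frame: two such
  elements differ by an element fixing all points of the frame, which lies in \<open>B\<close>.\<close>

definition opposite_maximal ::
    "nat \<Rightarrow> ('a::field ^ 'm \<Rightarrow> 'a) \<Rightarrow> (int \<Rightarrow> ('a ^ 'm) set) \<Rightarrow>
     ('a ^ 'm) set set \<Rightarrow> ('a ^ 'm) set set \<Rightarrow> bool" where
  "opposite_maximal n Q e M M' \<longleftrightarrow>
     (\<exists>g\<in>carrier (PGO n Q). \<exists>h\<in>carrier (PGO n Q). \<exists>w\<in>carrier (PGO n Q).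
        M = g ` standard_flag n e \<and> M' = h ` standard_flag n e \<and> induces n e w (w0 n) \<and>
        double_coset n Q e (inv\<^bsub>PGO n Q\<^esub> h \<otimes>\<^bsub>PGO n Q\<^esub> g) = double_coset n Q e w)"

definition opposite ::
    "nat \<Rightarrow> ('a::field ^ 'm \<Rightarrow> 'a) \<Rightarrow> (int \<Rightarrow> ('a ^ 'm) set) \<Rightarrow>
     ('a ^ 'm) set set \<Rightarrow> ('a ^ 'm) set set \<Rightarrow> bool" where
  "opposite n Q e x y \<longleftrightarrow>
     conj_w0 n (cotype n e x) = cotype n e y \<and>
     (\<exists>M M'. x \<subseteq> M \<and> y \<subseteq> M' \<and> opposite_maximal n Q e M M')"

text \<open>The members \<open>x\<close> and \<open>y\<close> below may coincide. By \<open>not_opposite_self\<close> this only matters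
  for the empty flag, whose cotype is the set of all types: it is opposite to itself, so that
  \<open>{{}}\<close> is not an EKR-set.\<close>

definition EKR_set ::
    "nat \<Rightarrow> ('a::field ^ 'm \<Rightarrow> 'a) \<Rightarrow> (int \<Rightarrow> ('a ^ 'm) set) \<Rightarrow> elt_type set \<Rightarrow>
     ('a ^ 'm) set set set \<Rightarrow> bool" where
  "EKR_set n Q e J C \<longleftrightarrow>
     C \<subseteq> flags_of_cotype n Q e J \<and> (\<forall>x\<in>C. \<forall>y\<in>C. \<not> opposite n Q e x y)"

section \<open>No nonempty flag is opposite to itself\<close>

context
  fixes n :: nat and Q :: "'a::{field,finite} ^ 'm \<Rightarrow> 'a"
  assumes qf: "quadratic_form Q"
begin

lemma polar_comm: "polar_form Q x y = polar_form Q y x"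
  by (simp add: polar_form_def add.commute)

lemma polar_add: "polar_form Q (x + y) z = polar_form Q x z + polar_form Q y z"
  and polar_scale: "polar_form Q (c *s x) z = c * polar_form Q x z"
  and Q_scale: "Q (c *s x) = c ^ 2 * Q x"
  using qf unfolding quadratic_form_def by blast+

lemma polar_zero: "polar_form Q 0 z = 0"
  using polar_scale[of 0 0 z] by simp

lemma Q_zero: "Q 0 = 0"
  using Q_scale[of 0 0] by simp

lemma Q_add: "Q (x + y) = Q x + Q y + polar_form Q x y"
  by (simp add: polar_form_def)

lemma polar_span:
  assumes "\<And>s. s \<in> S \<Longrightarrow> polar_form Q s z = 0" and "x \<in> vec.span S"
  shows "polar_form Q x z = 0"
proof -
  have "vec.subspace {x. polar_form Q x z = 0}"
    by (rule vec.subspaceI) (auto simp: polar_zero polar_add polar_scale)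
  then have "vec.span S \<subseteq> {x. polar_form Q x z = 0}"
    using assms(1) by (intro vec.span_minimal) auto
  then show ?thesis using assms(2) by auto
qed

lemma span_totally_singular:
  assumes "\<And>s. s \<in> S \<Longrightarrow> Q s = 0"
    and "\<And>s t. s \<in> S \<Longrightarrow> t \<in> S \<Longrightarrow> polar_form Q s t = 0"
  shows "totally_singular Q (vec.span S)"
proof -
  have 1: "polar_form Q x t = 0" if "x \<in> vec.span S" "t \<in> S" for x t
    using polar_span[of S t x] assms(2) that by blast
  have 2: "polar_form Q x y = 0" if "x \<in> vec.span S" "y \<in> vec.span S" for x y
    using polar_span[of S x y] 1[OF that(1)] that(2) by (simp add: polar_comm)
  have "vec.subspace {x \<in> vec.span S. Q x = 0}"
    by (rule vec.subspaceI)
      (auto simp: vec.span_zero vec.span_add vec.span_scale Q_zero Q_add Q_scale 2)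
  then have "vec.span S \<subseteq> {x \<in> vec.span S. Q x = 0}"
    using assms(1) by (intro vec.span_minimal) (auto intro: vec.span_base)
  then show ?thesis unfolding totally_singular_def by (auto simp: vec.subspace_span)
qed

lemma totally_singular_polar:
  assumes "totally_singular Q U" "x \<in> U" "y \<in> U"
  shows "polar_form Q x y = 0"
  using assms unfolding totally_singular_def polar_form_def
  by (simp add: vec.subspace_add)

lemma point_span:
  assumes "p \<in> points Q"
  shows "\<exists>v. p = vec.span {v} \<and> Q v = 0"
proof -
  have s: "vec.subspace p" and d: "vec.dim p = 1" and z: "\<forall>x\<in>p. Q x = 0"
    using assms unfolding points_def totally_singular_def by auto
  obtain B where B: "B \<subseteq> p" "vec.independent B" "p \<subseteq> vec.span B" "card B = vec.dim p"
    using vec.basis_exists[of p] by blast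
  then obtain v where v: "B = {v}" using d by (auto simp: card_1_singleton_iff)
  have "vec.span B = p" using B s by (simp add: vec.span_minimal subset_antisym)
  then show ?thesis using v B(1) z by (intro exI[of _ v]) auto
qed

lemma frame_vectors:
  assumes fr: "polar_frame n Q e"
  shows "\<exists>v. (\<forall>i\<in>frame_indices n. e i = vec.span {v i} \<and> Q (v i) = 0) \<and>
    (\<forall>i\<in>frame_indices n. \<forall>j\<in>frame_indices n. polar_form Q (v i) (v j) = 0 \<longleftrightarrow> j \<noteq> - i)"
proof -
  have "\<forall>i\<in>frame_indices n. \<exists>v. e i = vec.span {v} \<and> Q v = 0"
    using fr unfolding polar_frame_def by (auto intro!: point_span)
  from bchoice[OF this] obtain v
    where v0: "\<forall>i\<in>frame_indices n. e i = vec.span {v i} \<and> Q (v i) = 0" ..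
  note v = v0[rule_format]
  have "polar_form Q (v i) (v j) = 0 \<longleftrightarrow> j \<noteq> - i"
    if i: "i \<in> frame_indices n" and j: "j \<in> frame_indices n" for i j
  proof -
    have sp: "vec.span (e i \<union> e j) = vec.span {v i, v j}"
      unfolding vec.span_eq using v[OF i] v[OF j] vec.span_mono[of "{v i}" "{v i, v j}"]
        vec.span_mono[of "{v j}" "{v i, v j}"] by (auto intro: vec.span_base)
    have 0: "polar_form Q (v k) (v k) = 0" if "k \<in> frame_indices n" for k
    proof (rule totally_singular_polar)
      show "totally_singular Q (e k)"
        using fr that unfolding polar_frame_def points_def by blast
      show "v k \<in> e k" "v k \<in> e k" using v[OF that] by (auto simp: vec.span_base)
    qed
    have "totally_singular Q (vec.span {v i, v j}) \<longleftrightarrow> polar_form Q (v i) (v j) = 0"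
    proof
      assume "totally_singular Q (vec.span {v i, v j})"
      then show "polar_form Q (v i) (v j) = 0"
        by (rule totally_singular_polar) (auto intro: vec.span_base)
    next
      assume "polar_form Q (v i) (v j) = 0"
      then show "totally_singular Q (vec.span {v i, v j})"
        using v[OF i] v[OF j] 0[OF i] 0[OF j] polar_comm[of "v j" "v i"]
        by (intro span_totally_singular) auto
    qed
    moreover have "collinear_points Q (e i) (e j) \<longleftrightarrow> j \<noteq> - i"
      using fr i j unfolding polar_frame_def by simp
    ultimately show ?thesis by (simp add: collinear_points_def sp)
  qed
  with v0 show ?thesis by (intro exI[of _ v] conjI ballI) simp_all
qed

lemma frame_span_dim:
  assumes fr: "polar_frame n Q e" and A: "A \<subseteq> frame_indices n" "\<And>i. i \<in> A \<Longrightarrow> - i \<notin> A"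
  shows "totally_singular Q (frame_span e A)" "vec.dim (frame_span e A) = card A"
proof -
  obtain v where v0: "\<forall>i\<in>frame_indices n. e i = vec.span {v i} \<and> Q (v i) = 0"
    and p0: "\<forall>i\<in>frame_indices n. \<forall>j\<in>frame_indices n.
        polar_form Q (v i) (v j) = 0 \<longleftrightarrow> j \<noteq> - i"
    using frame_vectors[OF fr] by (elim exE conjE) (rule that)
  note v = v0[rule_format] and p = p0[rule_format]
  have eA: "e i = vec.span {v i}" if "i \<in> A" for i
    using v A(1) that by blast
  have "(\<Union>i\<in>A. e i) \<subseteq> vec.span (v ` A)"
  proof (rule UN_least)
    fix i assume "i \<in> A"
    then have "{v i} \<subseteq> v ` A" by blast
    then show "e i \<subseteq> vec.span (v ` A)" unfolding eA[OF \<open>i \<in> A\<close>] by (rule vec.span_mono)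
  qed
  moreover have "v ` A \<subseteq> vec.span (\<Union>i\<in>A. e i)"
  proof (rule image_subsetI)
    fix i assume "i \<in> A"
    then have "v i \<in> e i" by (simp add: eA vec.span_base)
    then show "v i \<in> vec.span (\<Union>i\<in>A. e i)" using \<open>i \<in> A\<close> by (intro vec.span_base) blast
  qed
  ultimately have sp: "frame_span e A = vec.span (v ` A)"
    unfolding frame_span_def vec.span_eq by (rule conjI)
  show "totally_singular Q (frame_span e A)"
    unfolding sp
  proof (rule span_totally_singular)
    fix s assume "s \<in> v ` A"
    then show "Q s = 0" using v A(1) by blast
  next
    fix s t assume "s \<in> v ` A" "t \<in> v ` A"
    then obtain i j where ij: "i \<in> A" "j \<in> A" "s = v i" "t = v j" by blast
    have "j \<noteq> - i" using A(2)[OF ij(1)] ij(2) by blast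
    then show "polar_form Q s t = 0" using p ij A(1) by blast
  qed
  have inj: "inj_on v A"
  proof (rule inj_onI)
    fix i j assume "i \<in> A" "j \<in> A" "v i = v j"
    then have "e i = e j" by (simp add: eA)
    moreover have "inj_on e A" using fr A(1) unfolding polar_frame_def by (blast intro: inj_on_subset)
    ultimately show "i = j" using \<open>i \<in> A\<close> \<open>j \<in> A\<close> by (simp add: inj_on_eq_iff)
  qed
  have "vec.independent (v ` A)"
  proof
    assume "vec.dependent (v ` A)"
    then obtain i where i: "i \<in> A" "v i \<in> vec.span (v ` A - {v i})"
      unfolding vec.dependent_def by blast
    have mi: "- i \<in> frame_indices n" and ii: "i \<in> frame_indices n"
      using i(1) A(1) by (auto simp: frame_indices_def)
    have "polar_form Q (v i) (v (- i)) = 0"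
    proof (rule polar_span[OF _ i(2)])
      fix s assume "s \<in> v ` A - {v i}"
      then obtain j where "j \<in> A" "s = v j" "j \<noteq> i" by blast
      then show "polar_form Q s (v (- i)) = 0" using p[of j "- i"] mi A(1) by auto
    qed
    then show False using p[OF ii mi] by simp
  qed
  then show "vec.dim (frame_span e A) = card A"
    unfolding sp by (simp add: vec.dim_span vec.dim_eq_card_independent card_image inj)
qed

lemma standard_flag_elements:
  assumes fr: "polar_frame n Q e" and n: "n \<ge> 2" and U: "U \<in> standard_flag n e"
  shows "U \<in> elements n Q" "e 1 \<subseteq> U"
proof -
  obtain A where A: "U = frame_span e A" "A \<subseteq> frame_indices n" "\<And>i. i \<in> A \<Longrightarrow> - i \<notin> A"
    "1 \<in> A" "card A \<in> {1..n - 2} \<or> card A = n"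
  proof -
    consider (a) i where "i \<in> {1..n - 2}" "U = frame_span e {1..int i}"
      | (b) "U = frame_span e {1..int n}"
      | (c) "U = frame_span e (insert (- int n) {1..int n - 1})"
      using U unfolding standard_flag_def by blast
    then show ?thesis
    proof cases
      case a
      then show ?thesis using n by (intro that[of "{1..int i}"]) (auto simp: frame_indices_def)
    next
      case b
      then show ?thesis using n by (intro that[of "{1..int n}"]) (auto simp: frame_indices_def)
    next
      case c
      then show ?thesis using n
        by (intro that[of "insert (- int n) {1..int n - 1}"])
          (auto simp: frame_indices_def card_insert_if)
    qed
  qed
  show "U \<in> elements n Q"
    using frame_span_dim[OF fr A(2,3)] A(1,5) unfolding elements_def generators_def by auto
  show "e 1 \<subseteq> U" using A(1,4) unfolding frame_span_def by (auto intro: vec.span_base)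
qed

end

lemma similarity_elements:
  fixes Q :: "'a::{field,finite} ^ 'm \<Rightarrow> 'a"
  assumes f: "f \<in> similarities n Q"
  shows "totally_singular Q U \<Longrightarrow> totally_singular Q (f ` U)" "vec.dim (f ` U) = vec.dim U"
    "(\<lambda>U\<in>elements n Q. f ` U) \<in> Bij (elements n Q)"
proof -
  have lin: "Vector_Spaces.linear (*s) (*s) f" and inj: "inj f"
    using f unfolding similarities_def by (auto dest: bij_is_inj)
  show 1: "totally_singular Q U \<Longrightarrow> totally_singular Q (f ` U)" for U
    using f lin unfolding totally_singular_def similarities_def
    by (auto simp: vec.linear_subspace_image)
  show 2: "vec.dim (f ` U) = vec.dim U" for U
    using lin inj by (intro vec.dim_image_eq) (auto intro: inj_on_subset)
  have "inj_on (\<lambda>U\<in>elements n Q. f ` U) (elements n Q)"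
    using inj by (auto simp: inj_on_def inj_image_eq_iff)
  moreover have "(\<lambda>U\<in>elements n Q. f ` U) ` elements n Q \<subseteq> elements n Q"
    using 1 2 unfolding elements_def generators_def by auto
  ultimately show "(\<lambda>U\<in>elements n Q. f ` U) \<in> Bij (elements n Q)"
    unfolding Bij_def bij_betw_def by (simp add: endo_inj_surj)
qed

lemma similarity_inverse:
  fixes Q :: "'a::{field,finite} ^ 'm \<Rightarrow> 'a"
  assumes f: "f \<in> similarities n Q"
  shows "inv_into UNIV f \<in> similarities n Q"
proof -
  let ?g = "inv_into UNIV f"
  have lin: "Vector_Spaces.linear (*s) (*s) f" and bij: "bij f"
    using f unfolding similarities_def by auto
  have fg: "f (?g x) = x" and gf: "?g (f x) = x" for x
    using bij by (simp_all add: bij_is_surj surj_f_inv_f bij_is_inj inv_f_f)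
  obtain c where c: "c \<noteq> 0" "\<And>x. Q (f x) = c * Q x"
    using f unfolding similarities_def by blast
  have lg: "Vector_Spaces.linear (*s) (*s) ?g"
    by (metis bij bij_is_inj bij_is_surj lin surj_iff inj_iff vec.inj_linear_imp_inv_linear)
  have Qg: "Q (?g x) = inverse c * Q x" for x
    using c(2)[of "?g x"] c(1) by (simp add: fg field_simps)
  have "same_class n N (?g ` N)" if N: "N \<in> generators n Q" for N
  proof -
    have "vec.dim (?g ` N) = vec.dim N"
      using lg bij by (intro vec.dim_image_eq) (auto intro: inj_on_subset bij_imp_bij_inv bij_is_inj)
    then have "?g ` N \<in> generators n Q"
      using N lg Qg unfolding generators_def totally_singular_def
      by (auto simp: vec.linear_subspace_image)
    then have "same_class n (?g ` N) (f ` ?g ` N)"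
      using f unfolding similarities_def by blast
    moreover have "f ` ?g ` N = N" by (simp add: image_image fg)
    ultimately show ?thesis by (simp add: same_class_def Int_commute)
  qed
  then show ?thesis
    unfolding similarities_def
  proof (intro CollectI conjI)
    show "\<exists>c. c \<noteq> 0 \<and> (\<forall>x. Q (?g x) = c * Q x)"
      using c(1) Qg by (intro exI[of _ "inverse c"]) simp
  qed (simp_all add: lg bij bij_imp_bij_inv)
qed

lemma PGO_Bij: "g \<in> carrier (PGO n Q) \<Longrightarrow> g \<in> Bij (elements n Q)"
  for Q :: "'a::{field,finite} ^ 'm \<Rightarrow> 'a"
  unfolding PGO_def using similarity_elements(3) by auto

lemma PGO_mult: "g \<in> Bij (elements n Q) \<Longrightarrow> h \<in> Bij (elements n Q) \<Longrightarrow>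
    g \<otimes>\<^bsub>PGO n Q\<^esub> h = compose (elements n Q) g h"
  by (simp add: PGO_def BijGroup_def)

lemma PGO_inv:
  fixes Q :: "'a::{field,finite} ^ 'm \<Rightarrow> 'a"
  assumes h: "h \<in> carrier (PGO n Q)"
  shows "inv\<^bsub>PGO n Q\<^esub> h \<in> carrier (PGO n Q)" "h \<otimes>\<^bsub>PGO n Q\<^esub> inv\<^bsub>PGO n Q\<^esub> h = \<one>\<^bsub>PGO n Q\<^esub>"
proof -
  let ?E = "elements n Q"
  interpret B: group "BijGroup ?E" by (rule group_BijGroup)
  have mult: "mult (PGO n Q) = mult (BijGroup ?E)" and one: "\<one>\<^bsub>PGO n Q\<^esub> = \<one>\<^bsub>BijGroup ?E\<^esub>"
    by (simp_all add: PGO_def)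
  have hB: "h \<in> carrier (BijGroup ?E)" using PGO_Bij[OF h] by (simp add: BijGroup_def)
  obtain f where f: "f \<in> similarities n Q" "h = (\<lambda>U\<in>?E. f ` U)"
    using h unfolding PGO_def by auto
  define k where "k = (\<lambda>U\<in>?E. inv_into UNIV f ` U)"
  have kG: "k \<in> carrier (PGO n Q)"
    using similarity_inverse[OF f(1)] by (auto simp: PGO_def k_def)
  have kB: "k \<in> Bij ?E" by (rule PGO_Bij[OF kG])
  have bij: "bij f" using f(1) by (simp add: similarities_def)
  have "k \<otimes>\<^bsub>BijGroup ?E\<^esub> h = \<one>\<^bsub>BijGroup ?E\<^esub>"
  proof -
    have "compose ?E k h = (\<lambda>U\<in>?E. U)"
    proof
      fix U show "compose ?E k h U = (\<lambda>U\<in>?E. U) U"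
      proof (cases "U \<in> ?E")
        case True
        then have "h U \<in> ?E" using PGO_Bij[OF h] Bij_imp_funcset by blast
        then have "f ` U \<in> ?E" using True f(2) by simp
        then show ?thesis using True bij
          by (simp add: compose_def k_def f(2) image_image bij_is_inj inv_f_f)
      qed (simp add: compose_def)
    qed
    then show ?thesis using kB PGO_Bij[OF h] by (simp add: BijGroup_def)
  qed
  then have kinv: "k = inv\<^bsub>BijGroup ?E\<^esub> h"
    using hB kB B.inv_equality[of k h] by (simp add: BijGroup_def)
  have kc: "k \<in> carrier (BijGroup ?E)" using kB by (simp add: BijGroup_def)
  have "inv\<^bsub>PGO n Q\<^esub> h = k"
    unfolding m_inv_def mult one
  proof (rule the_equality)
    show "k \<in> carrier (PGO n Q) \<and> h \<otimes>\<^bsub>BijGroup ?E\<^esub> k = \<one>\<^bsub>BijGroup ?E\<^esub> \<and>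
        k \<otimes>\<^bsub>BijGroup ?E\<^esub> h = \<one>\<^bsub>BijGroup ?E\<^esub>"
      using kG hB by (simp add: kinv)
    fix y assume "y \<in> carrier (PGO n Q) \<and> h \<otimes>\<^bsub>BijGroup ?E\<^esub> y = \<one>\<^bsub>BijGroup ?E\<^esub> \<and>
        y \<otimes>\<^bsub>BijGroup ?E\<^esub> h = \<one>\<^bsub>BijGroup ?E\<^esub>"
    moreover from this have "y \<in> carrier (BijGroup ?E)"
      using PGO_Bij[of y n Q] by (simp add: BijGroup_def)
    ultimately show "y = k" using hB B.inv_equality[of y h] by (simp add: kinv)
  qed
  then show "inv\<^bsub>PGO n Q\<^esub> h \<in> carrier (PGO n Q)"
    "h \<otimes>\<^bsub>PGO n Q\<^esub> inv\<^bsub>PGO n Q\<^esub> h = \<one>\<^bsub>PGO n Q\<^esub>"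
    using kG hB by (simp_all add: mult one kinv)
qed

lemma one_in_Borel:
  fixes Q :: "'a::{field,finite} ^ 'm \<Rightarrow> 'a"
  assumes "standard_flag n e \<subseteq> elements n Q"
  shows "\<one>\<^bsub>PGO n Q\<^esub> \<in> Borel n Q e"
proof -
  have "id \<in> similarities n Q"
    by (auto simp: similarities_def vec.linear_id same_class_def generators_def
        intro!: exI[of _ 1])
  then have "\<one>\<^bsub>PGO n Q\<^esub> \<in> carrier (PGO n Q)"
    by (auto simp: PGO_def BijGroup_def intro!: image_eqI[of _ _ id] restrict_ext)
  moreover have "\<one>\<^bsub>PGO n Q\<^esub> ` standard_flag n e = standard_flag n e"
    using image_cong[of "standard_flag n e" _ "\<lambda>U\<in>elements n Q. U" id] assms
    by (simp add: PGO_def BijGroup_def subset_iff)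
  ultimately show ?thesis by (simp add: Borel_def stabilizer_def)
qed

lemma not_opposite_self:
  fixes Q :: "'a::{field,finite} ^ 'm \<Rightarrow> 'a"
  assumes n: "n \<ge> 3" and qf: "quadratic_form Q" and fr: "polar_frame n Q e" and x: "x \<noteq> {}"
  shows "\<not> opposite n Q e x x"
proof
  let ?E = "elements n Q" and ?G = "PGO n Q" and ?F = "standard_flag n e"
  have n2: "n \<ge> 2" using n by simp
  note Fl = standard_flag_elements[OF qf fr n2]
  interpret B: group "BijGroup ?E" by (rule group_BijGroup)
  have mult: "mult ?G = mult (BijGroup ?E)" and one: "\<one>\<^bsub>?G\<^esub> = \<one>\<^bsub>BijGroup ?E\<^esub>"
    by (simp_all add: PGO_def)
  have cB: "g \<in> carrier (BijGroup ?E)" if "g \<in> carrier ?G" for g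
    using PGO_Bij[OF that] by (simp add: BijGroup_def)
  have app: "(g \<otimes>\<^bsub>?G\<^esub> k) U = g (k U)"
    if "g \<in> carrier (BijGroup ?E)" "k \<in> carrier (BijGroup ?E)" "U \<in> ?E" for g k U
    using that by (simp add: mult BijGroup_def compose_def)
  have mem: "g U \<in> ?E" if "g \<in> carrier (BijGroup ?E)" "U \<in> ?E" for g U
    using that Bij_imp_funcset[of g ?E] by (auto simp: BijGroup_def)
  have inj: "U = U'" if "g \<in> carrier (BijGroup ?E)" "g U = g U'" "U \<in> ?E" "U' \<in> ?E" for g U U'
    using that by (auto simp: BijGroup_def Bij_def bij_betw_def inj_on_def)
  assume "opposite n Q e x x"
  then obtain g h w where g: "g \<in> carrier ?G" and h: "h \<in> carrier ?G" and w: "w \<in> carrier ?G"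
    and xg: "x \<subseteq> g ` ?F" and xh: "x \<subseteq> h ` ?F" and ind: "induces n e w (w0 n)"
    and dc: "double_coset n Q e (inv\<^bsub>?G\<^esub> h \<otimes>\<^bsub>?G\<^esub> g) = double_coset n Q e w"
    unfolding opposite_def opposite_maximal_def by (elim conjE exE bexE) simp
  define k where "k = inv\<^bsub>?G\<^esub> h \<otimes>\<^bsub>?G\<^esub> g"
  note gB = cB[OF g] and hB = cB[OF h] and wB = cB[OF w] and iB = cB[OF PGO_inv(1)[OF h]]
  have kB: "k \<in> carrier (BijGroup ?E)" using gB iB by (simp add: k_def mult)
  have hk: "h \<otimes>\<^bsub>?G\<^esub> k = g"
    using PGO_inv(2)[OF h] gB hB iB by (simp add: k_def mult one B.m_assoc[symmetric])
  have o: "\<one>\<^bsub>?G\<^esub> \<in> Borel n Q e" using Fl(1) by (intro one_in_Borel) blast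
  have "k = \<one>\<^bsub>?G\<^esub> \<otimes>\<^bsub>?G\<^esub> k \<otimes>\<^bsub>?G\<^esub> \<one>\<^bsub>?G\<^esub>" using kB by (simp add: mult one)
  moreover have "\<one>\<^bsub>?G\<^esub> \<otimes>\<^bsub>?G\<^esub> k \<otimes>\<^bsub>?G\<^esub> \<one>\<^bsub>?G\<^esub> \<in> double_coset n Q e k"
    unfolding double_coset_def set_mult_def using o by (intro UN_I) simp_all
  ultimately have "k \<in> double_coset n Q e k" by simp
  then have "k \<in> double_coset n Q e w" using dc by (simp add: k_def)
  then obtain b b' where b: "b \<in> Borel n Q e" "b' \<in> Borel n Q e"
    and kb: "k = b \<otimes>\<^bsub>?G\<^esub> w \<otimes>\<^bsub>?G\<^esub> b'"
    unfolding double_coset_def set_mult_def by auto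
  have bB: "b \<in> carrier (BijGroup ?E)" "b' \<in> carrier (BijGroup ?E)"
    and bF: "b ` ?F = ?F" "b' ` ?F = ?F"
    using b cB unfolding Borel_def stabilizer_def by auto
  obtain U where "U \<in> x" using x by blast
  then obtain U1 U2 where U: "U1 \<in> ?F" "U2 \<in> ?F" "g U1 = h U2" using xg xh by blast
  obtain U4 where U4: "U4 \<in> ?F" "U2 = b U4" using U(2) bF(1) by blast
  have U3: "b' U1 \<in> ?F" using U(1) bF(2) by blast
  have bw: "b \<otimes>\<^bsub>?G\<^esub> w \<in> carrier (BijGroup ?E)" using bB wB by (simp add: mult)
  have "g U1 = h (k U1)" using app[OF hB kB Fl(1)[OF U(1)]] by (simp add: hk)
  also have "k U1 = b (w (b' U1))"
    using app[OF bw bB(2) Fl(1)[OF U(1)]] app[OF bB(1) wB Fl(1)[OF U3]] by (simp add: kb)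
  finally have "g U1 = h (b (w (b' U1)))" .
  then have "h (b (w (b' U1))) = h (b U4)" using U(3) U4(2) by simp
  then have "b (w (b' U1)) = b U4"
    by (rule inj[OF hB _ mem[OF bB(1) mem[OF wB Fl(1)[OF U3]]] mem[OF bB(1) Fl(1)[OF U4(1)]]])
  then have wU: "w (b' U1) = U4"
    by (rule inj[OF bB(1) _ mem[OF wB Fl(1)[OF U3]] Fl(1)[OF U4(1)]])
  obtain f where f: "w = (\<lambda>U\<in>?E. f ` U)" using w unfolding PGO_def by auto
  have idx: "1 \<in> frame_indices n" "- 1 \<in> frame_indices n" using n by (auto simp: frame_indices_def)
  have wE: "w V \<subseteq> w V'" if "V \<in> ?E" "V' \<in> ?E" "V \<subseteq> V'" for V V'
    using that by (auto simp: f)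
  have w1: "w (e 1) = e (- 1)" using ind idx(1) n by (auto simp: induces_def w0_def)
  have "e 1 \<in> ?E"
    using fr idx(1) n unfolding polar_frame_def points_def elements_def by auto
  then have e1: "e (- 1) \<subseteq> U4"
    using wE[OF _ Fl(1)[OF U3] Fl(2)[OF U3]] w1 wU by simp
  have ts: "totally_singular Q U4"
    using Fl(1)[OF U4(1)] unfolding elements_def generators_def by auto
  have sub: "vec.span (e 1 \<union> e (- 1)) \<subseteq> U4"
    using e1 Fl(2)[OF U4(1)] ts unfolding totally_singular_def by (intro vec.span_minimal) auto
  have "totally_singular Q (vec.span (e 1 \<union> e (- 1)))"
    using ts sub unfolding totally_singular_def by (auto simp: vec.subspace_span)
  then have "collinear_points Q (e 1) (e (- 1))" by (simp add: collinear_points_def)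
  then show False using fr idx unfolding polar_frame_def by auto
qed

end

theory Submission
  imports Defs "HOL-Analysis.Analysis"
begin

text \<open>Both sides of the inequality get multiplied by the same factor if every flag of cotype \<open>J\<close> is
  replaced by the maximal flags containing it, and the result is an EKR-set of maximal flags again.
  So \<open>J\<close> may be assumed to be empty.

  For maximal flags, let \<open>A\<^sub>s\<close> be the adjacency operator of the \<open>s\<close>-panels (\<open>s \<in> S\<close>) and \<open>T\<close> the
  adjacency operator of opposition. \<open>T\<close> is a product of \<open>N = n (n - 1)\<close> of the \<open>A\<^sub>s\<close>, its square
  commutes with all \<open>A\<^sub>s\<close>, and \<open>A\<^sub>s\<close> has the eigenvalues \<open>q\<close> and \<open>-1\<close>. Let \<open>K\<close> be the common
  \<open>q\<close>-eigenspace of all \<open>A\<^sub>s\<close>, let \<open>E\<close> be an eigenspace of \<open>T\<^sup>2\<close> in the orthogonal complement of \<open>K\<close>, say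
  with eigenvalue \<open>\<mu>\<close> and dimension \<open>d\<close>, and let \<open>a\<close> be the dimension of the \<open>q\<close>-eigenspace of \<open>A\<^sub>s\<close>
  on \<open>E\<close>. By the braid relations the \<open>A\<^sub>s\<close> are conjugate on \<open>E\<close>, so \<open>a\<close> does not depend on \<open>s\<close>. These
  \<open>n\<close> subspaces of \<open>E\<close> have trivial intersection, so \<open>d \<le> n (d - a)\<close>, and taking determinants of
  \<open>T\<^sup>2\<close> on \<open>E\<close> gives \<open>\<bar>\<mu>\<bar>\<^sup>d = q\<close> to the power \<open>2 N a\<close>. Hence \<open>T\<close> has norm at most \<open>q\<close> to the power
  \<open>N - (n - 1)\<close> on the complement of \<open>K\<close>, while it is multiplication by \<open>q\<close> to the power \<open>N\<close> on \<open>K\<close>,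
  and the ratio bound follows. Working with \<open>K\<close> instead of the constant functions makes it
  unnecessary to know that the chamber graph is connected.\<close>

section \<open>Linear algebra over the reals\<close>

text \<open>The square of T is used because for odd n conjugation by \<open>w0\<close> swaps two
  generators: T intertwines the A_s only up to this swap, while its square commutes with all of
  them. The facts about the building are derived from hyperbolic bases. A relative position
  \<open>w\<close> is witnessed by one basis \<open>v\<close> whose reordering
  \<open>v \<circ> w\<close> gives the second flag. The single rule A_w A_s = A_ws for ascents s of
  w then yields the factorization of T, its commutation rule and the braid relations. The rule rests
  on an explicit elation of the basis (existence of the right basis) and on dimensions of
  intersections (no pair is counted twice). Bases are reordered by signed permutations, a group
  twice as large as the Weyl group of type D; the class of the span of \<open>v 1, ..., v n\<close>
  tells which of them belong to it, and so the parity of intersections of generators has to be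
  settled first. The exponent n - 1 of the bound is N divided by the number n of generators: off K
  the operator T loses at least an n-th part of the exponent N that it has on K.\<close>

lemma det_matrix_eigenbasis:
  fixes g :: "real^'c \<Rightarrow> real^'c" and eig :: "real^'c \<Rightarrow> real"
  assumes g: "linear g" and B: "independent B" "card B = CARD('c)"
    and eig: "\<And>b. b \<in> B \<Longrightarrow> g b = eig b *\<^sub>R b"
  shows "det (matrix g) = (\<Prod>b\<in>B. eig b)"
proof -
  have finB: "finite B" using B(1) by (simp add: independent_imp_finite)
  then obtain h :: "'c \<Rightarrow> real^'c" where h: "bij_betw h UNIV B"
    using B(2) finite_same_card_bij[of "UNIV :: 'c set" B] by auto
  have hB: "h j \<in> B" for j using h by (auto simp: bij_betw_def)
  define R :: "real^'c^'c" where "R = (\<chi> i j. h j $ i)"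
  define D :: "real^'c^'c" where "D = (\<chi> i j. if i = j then eig (h j) else 0)"
  have col: "column j R = h j" for j by (simp add: column_def R_def vec_eq_iff)
  have "span (columns R) = UNIV"
  proof -
    have "columns R = B" using h col by (auto simp: columns_def bij_betw_def)
    moreover have "dim B = dim (UNIV :: (real^'c) set)" using B by (simp add: dim_eq_card_independent)
    ultimately show ?thesis using B(1) by (metis card_eq_dim subset_UNIV finB top.extremum_uniqueI dim_eq_card_independent)
  qed
  then have "det R \<noteq> 0"
    using matrix_right_invertible_span_columns[of R] invertible_right_inverse[of R] invertible_det_nz[of R]
    by (simp add: span_vec_eq)
  have "matrix g ** R = R ** D"
  proof -
    have "(matrix g ** R) $ i $ j = (R ** D) $ i $ j" for i j
    proof -
      have "(matrix g ** R) $ i $ j = (matrix g *v column j R) $ i"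
        by (simp add: matrix_matrix_mult_def matrix_vector_mult_def column_def)
      also have "\<dots> = g (h j) $ i" by (simp add: col matrix_works g)
      also have "\<dots> = eig (h j) * h j $ i" by (simp add: eig hB)
      also have "\<dots> = (R ** D) $ i $ j"
        by (simp add: matrix_matrix_mult_def R_def D_def if_distrib[of "\<lambda>x. _ * x"] sum.delta' cong: if_cong)
      finally show ?thesis .
    qed
    then show ?thesis by (simp add: vec_eq_iff)
  qed
  then have "det (matrix g) * det R = det R * det D" by (metis det_mul)
  then have "det (matrix g) = det D" using \<open>det R \<noteq> 0\<close> by simp
  also have "\<dots> = (\<Prod>j\<in>UNIV. eig (h j))"
    by (subst det_diagonal) (auto simp: D_def)
  also have "\<dots> = (\<Prod>b\<in>B. eig b)" using h by (rule prod.reindex_bij_betw)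
  finally show ?thesis .
qed

text \<open>If the linear term did not vanish, moving from \<open>f\<close> slightly along
  \<open>g\<close> would make the form negative. Applied to \<open>\<mu> - S\<close>, this turns a
  maximiser of the Rayleigh quotient into an eigenvector.\<close>

lemma psd_form_zero:
  fixes S :: "'v::real_inner \<Rightarrow> 'v"
  assumes S: "linear S" "\<And>x y. S x \<bullet> y = x \<bullet> S y" and V: "subspace V"
    and pos: "\<And>x. x \<in> V \<Longrightarrow> S x \<bullet> x \<ge> 0" and f: "f \<in> V" "S f \<bullet> f = 0" and g: "g \<in> V"
  shows "S f \<bullet> g = 0"
proof (rule ccontr)
  assume ne: "S f \<bullet> g \<noteq> 0"
  let ?b = "S f \<bullet> g" and ?c = "S g \<bullet> g"
  have c: "?c \<ge> 0" using pos[OF g] .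
  \<comment> \<open>Close to the minimiser \<open>- ?b / ?c\<close> of the quadratic polynomial
    below; the added 1 keeps the denominator positive when \<open>?c = 0\<close>.\<close>
  define t where "t = - ?b / (?c + 1)"
  have "f + t *\<^sub>R g \<in> V" using V f g by (simp add: subspace_add subspace_scale)
  from pos[OF this] have "0 \<le> S (f + t *\<^sub>R g) \<bullet> (f + t *\<^sub>R g)" .
  also have "\<dots> = 2 * t * ?b + t^2 * ?c"
    using f(2) S(2)[of g f]
    by (simp add: linear_add[OF S(1)] linear_scale[OF S(1)] inner_add_left inner_add_right
        inner_commute[of g] power2_eq_square algebra_simps)
  also have "\<dots> = (?b^2 / (?c+1)^2) * (?c - 2 * (?c + 1))"
  proof -
    have "2 * (- b / (c + 1)) * b + (- b / (c + 1))^2 * c = (b^2 / (c+1)^2) * (c - 2 * (c + 1))"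
      if "c \<ge> 0" for b c :: real
    proof -
      have "c + 1 \<noteq> 0" using that by simp
      then show ?thesis by (simp add: power2_eq_square divide_simps) (simp add: algebra_simps)
    qed
    then show ?thesis unfolding t_def using c by blast
  qed
  also have "\<dots> < 0" using ne c by (intro mult_pos_neg) auto
  finally show False by simp
qed

text \<open>The maximum over the compact unit sphere of \<open>V\<close> is attained. Applied to the
  square of T, it yields an eigenvalue that controls the norm of T.\<close>

lemma rayleigh_maximum:
  fixes S :: "'v::euclidean_space \<Rightarrow> 'v"
  assumes S: "linear S" "\<And>x y. S x \<bullet> y = x \<bullet> S y" and V: "subspace V" "\<And>x. x \<in> V \<Longrightarrow> S x \<in> V"
    and ne: "V \<noteq> {0}"
  obtains \<mu> f where "f \<in> V" "f \<noteq> 0" "S f = \<mu> *\<^sub>R f" "\<And>x. x \<in> V \<Longrightarrow> S x \<bullet> x \<le> \<mu> * (x \<bullet> x)"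
proof -
  let ?K = "V \<inter> sphere 0 1"
  obtain v where v: "v \<in> V" "v \<noteq> 0" using ne V(1) subspace_0 by blast
  have "compact ?K" using V(1) by (intro closed_Int_compact closed_subspace compact_sphere)
  moreover have "v /\<^sub>R norm v \<in> ?K" using v V(1) by (simp add: subspace_scale)
  moreover have "continuous_on ?K (\<lambda>x. S x \<bullet> x)"
    using S(1) by (intro continuous_intros linear_continuous_on) (simp add: linear_conv_bounded_linear)
  ultimately obtain f where f: "f \<in> ?K" and mx: "\<And>x. x \<in> ?K \<Longrightarrow> S x \<bullet> x \<le> S f \<bullet> f"
    using continuous_attains_sup[of ?K "\<lambda>x. S x \<bullet> x"] by blast
  define \<mu> where "\<mu> = S f \<bullet> f"
  have ff: "f \<bullet> f = 1" using f by (simp add: norm_eq_1)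
  have le: "S x \<bullet> x \<le> \<mu> * (x \<bullet> x)" if "x \<in> V" for x
  proof (cases "x = 0")
    case False
    have "x /\<^sub>R norm x \<in> ?K" using that False V(1) by (simp add: subspace_scale)
    from mx[OF this] have "S x \<bullet> x / (norm x)^2 \<le> \<mu>"
      by (simp add: linear_scale[OF S(1)] \<mu>_def power2_eq_square field_simps)
    then show ?thesis using False by (simp add: field_simps power2_norm_eq_inner)
  qed (simp add: linear_0[OF S(1)])
  let ?D = "\<lambda>x. \<mu> *\<^sub>R x - S x"
  have D: "linear ?D" using S(1) by (intro linear_compose_sub linear_compose_scale_right) (auto simp: linear_id[unfolded id_def])
  have fV: "f \<in> V" using f by simp
  have DV: "?D f \<in> V" using V fV by (simp add: subspace_diff subspace_scale)
  \<comment> \<open>The form of \<open>?D\<close> is nonnegative on \<open>V\<close> and vanishes at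
    \<open>f\<close>, so \<open>?D f\<close> is orthogonal to all of \<open>V\<close>, in particular
    to itself.\<close>
  have "?D f \<bullet> ?D f = 0"
    by (rule psd_form_zero[OF D _ V(1) _ fV _ DV])
      (use le in \<open>auto simp: inner_diff_left inner_diff_right S(2) ff \<mu>_def\<close>)
  then have "S f = \<mu> *\<^sub>R f" by simp
  moreover have "f \<noteq> 0" using ff by auto
  ultimately show ?thesis using that fV le by blast
qed

text \<open>By the dimension formula for sums, each further subspace costs at most its codimension
  in \<open>E\<close>. It will be applied to eigenspaces whose common intersection is zero.\<close>

lemma dim_Inter_codim:
  fixes E :: "'v::euclidean_space set" and W :: "'i \<Rightarrow> 'v set"
  assumes E: "subspace E" and W: "\<And>i. i \<in> I \<Longrightarrow> subspace (W i) \<and> W i \<subseteq> E" and I: "finite I"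
  shows "dim E \<le> dim (E \<inter> (\<Inter>i\<in>I. W i)) + (\<Sum>i\<in>I. dim E - dim (W i))"
  using I W
proof (induction I rule: finite_induct)
  case (insert k I)
  let ?U = "E \<inter> (\<Inter>i\<in>I. W i)"
  have U: "subspace ?U" using E insert.prems by (intro subspace_inter subspace_Inter) auto
  have Wk: "subspace (W k)" "W k \<subseteq> E" using insert.prems by auto
  have "dim {x + y |x y. x \<in> ?U \<and> y \<in> W k} + dim (?U \<inter> W k) = dim ?U + dim (W k)"
    by (rule dim_sums_Int[OF U Wk(1)])
  moreover have "dim {x + y |x y. x \<in> ?U \<and> y \<in> W k} \<le> dim E"
    using Wk(2) E by (intro dim_subset) (auto intro: subspace_add)
  moreover have "dim E \<le> dim ?U + (\<Sum>i\<in>I. dim E - dim (W i))" using insert by auto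
  moreover have "dim (W k) \<le> dim E" using Wk(2) by (rule dim_subset)
  moreover have "E \<inter> (\<Inter>i\<in>insert k I. W i) = ?U \<inter> W k" by auto
  ultimately show ?case using insert.hyps by simp
qed simp

section \<open>A Hoffman bound for Hecke algebra modules\<close>

text \<open>For a projection \<open>p\<close> onto \<open>E\<close> this extends the restriction of \<open>g\<close> to \<open>E\<close> by the identity on the
  kernel of \<open>p\<close>. The determinant of \<open>g\<close> on \<open>E\<close> becomes that of a square matrix of fixed size.\<close>

definition block_ext :: "('v::real_vector \<Rightarrow> 'v) \<Rightarrow> ('v \<Rightarrow> 'v) \<Rightarrow> 'v \<Rightarrow> 'v" where
  "block_ext p g x = g (p x) + (x - p x)"

text \<open>The relations that the bound consumes. \<open>braid\<close> joins any two generators by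
  a chain of braid relations of length three (a connected diagram), \<open>ks\<close> is a word for
  \<open>T\<close>, and in \<open>comm\<close> the index \<open>l\<close> may differ from
  \<open>k\<close> because conjugation by the longest element can permute the generators.
  \<open>V\<close> is a subspace because the functions on chambers live among vectors over a larger
  index type.\<close>

locale hecke_module =
  fixes V :: "(real^'c) set" and S :: "'i set" and q :: real and A :: "'i \<Rightarrow> real^'c \<Rightarrow> real^'c"
    and T :: "real^'c \<Rightarrow> real^'c" and ks :: "'i list"
  assumes V: "subspace V" and finS: "finite S" "S \<noteq> {}" and q: "q > 1"
    and linA: "\<And>k. k \<in> S \<Longrightarrow> linear (A k)"
    and selfA: "\<And>k x y. k \<in> S \<Longrightarrow> A k x \<bullet> y = x \<bullet> A k y"
    and AV: "\<And>k x. k \<in> S \<Longrightarrow> x \<in> V \<Longrightarrow> A k x \<in> V"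
    and sqA: "\<And>k x. k \<in> S \<Longrightarrow> x \<in> V \<Longrightarrow> A k (A k x) = (q - 1) *\<^sub>R A k x + q *\<^sub>R x"
    and braid: "\<And>k l. k \<in> S \<Longrightarrow> l \<in> S \<Longrightarrow>
      (k, l) \<in> {(k, l). k \<in> S \<and> l \<in> S \<and> (\<forall>x\<in>V. A k (A l (A k x)) = A l (A k (A l x)))}\<^sup>*"
    and selfT: "\<And>x y. T x \<bullet> y = x \<bullet> T y" and linT: "linear T"
    and T: "\<And>x. x \<in> V \<Longrightarrow> T x = foldr A ks x" and ks: "set ks \<subseteq> S"
    and comm: "\<And>k. k \<in> S \<Longrightarrow> \<exists>l\<in>S. \<forall>x\<in>V. A k (T x) = T (A l x) \<and> A l (T x) = T (A k x)"
begin

lemma foldr_V: "set js \<subseteq> S \<Longrightarrow> x \<in> V \<Longrightarrow> foldr A js x \<in> V"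
  by (induction js) (auto intro: AV)

lemma TV: "x \<in> V \<Longrightarrow> T x \<in> V"
  using T ks foldr_V by simp

text \<open>Passing \<open>T\<close> turns \<open>A k\<close> into some \<open>A l\<close>, and
  passing it once more turns \<open>A l\<close> back into \<open>A k\<close>.\<close>

lemma TT_comm: "k \<in> S \<Longrightarrow> x \<in> V \<Longrightarrow> A k (T (T x)) = T (T (A k x))"
  using comm[of k] TV AV by metis

context
  fixes E :: "(real^'c) set"
  assumes E: "subspace E" "E \<subseteq> V" and AE: "\<And>k x. k \<in> S \<Longrightarrow> x \<in> E \<Longrightarrow> A k x \<in> E"
begin

definition Epos :: "'i \<Rightarrow> (real^'c) set" where "Epos k = {x \<in> E. A k x = q *\<^sub>R x}"
definition Eneg :: "'i \<Rightarrow> (real^'c) set" where "Eneg k = {x \<in> E. A k x = - x}"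

lemma exists_projection:
  obtains p :: "real^'c \<Rightarrow> real^'c" where "linear p" "\<And>x. p x \<in> E" "\<And>x. x \<in> E \<Longrightarrow> p x = x"
    "\<And>x y. y \<in> E \<Longrightarrow> (x - p x) \<bullet> y = 0"
proof -
  obtain B where B: "B \<subseteq> E" "pairwise orthogonal B" "\<And>x. x \<in> B \<Longrightarrow> norm x = 1"
    "independent B" "card B = dim E" "span B = E"
    using orthonormal_basis_subspace[OF E(1)] by metis
  define p where "p x = (\<Sum>b\<in>B. (x \<bullet> b) *\<^sub>R b)" for x
  have fB: "finite B" using B(4) independent_imp_finite by blast
  have 1: "linear p" unfolding p_def
    by (auto simp: linear_iff inner_add_left scaleR_left_distrib sum.distrib scaleR_sum_right)
  have 2: "p x \<in> E" for x unfolding p_def using B(1) E(1) by (intro subspace_sum subspace_scale) auto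
  have orth: "(x - p x) \<bullet> b = 0" if "b \<in> B" for x b
  proof -
    have "p x \<bullet> b = (\<Sum>c\<in>B. (x \<bullet> c) * (c \<bullet> b))" by (simp add: p_def inner_sum_left)
    also have "\<dots> = (\<Sum>c\<in>B. if c = b then x \<bullet> b else 0)"
    proof (rule sum.cong)
      fix c assume "c \<in> B"
      then show "(x \<bullet> c) * (c \<bullet> b) = (if c = b then x \<bullet> b else 0)"
        using that B(2,3) by (auto simp: pairwise_def orthogonal_def norm_eq_1)
    qed simp
    finally show ?thesis using that fB by (simp add: inner_diff_left)
  qed
  have 3: "(x - p x) \<bullet> y = 0" if "y \<in> E" for x y
  proof -
    have "span B \<subseteq> {y. (x - p x) \<bullet> y = 0}"
      by (rule span_minimal) (auto simp: orth subspace_hyperplane)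
    then show ?thesis using that B(6) by auto
  qed
  have 4: "p x = x" if "x \<in> E" for x
  proof -
    have "x - p x \<in> E" using that 2 E(1) by (simp add: subspace_diff)
    from 3[OF this, of x] have "x - p x = 0" by (simp only: inner_eq_zero_iff)
    then show ?thesis by simp
  qed
  show ?thesis using that[of p] 1 2 3 4 by blast
qed

lemma sub_pos: "k \<in> S \<Longrightarrow> subspace (Epos k)" and sub_neg: "k \<in> S \<Longrightarrow> subspace (Eneg k)"
  using E(1) unfolding Epos_def Eneg_def
  by (auto simp: subspace_def linear_0 linA linear_add linear_scale scaleR_right_distrib)

text \<open>Orthonormal bases of \<open>U\<close>, of \<open>W\<close> and of the kernel of
  \<open>p\<close> together form an eigenbasis of the whole space; the kernel contributes only the
  eigenvalue 1.\<close>

lemma det_block_ext: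
  fixes \<mu> \<nu> :: real
  assumes p: "linear p" "\<And>x. p x \<in> E" "\<And>x. x \<in> E \<Longrightarrow> p x = x" "\<And>x y. y \<in> E \<Longrightarrow> (x - p x) \<bullet> y = 0"
    and g: "linear g" and U: "subspace U" "U \<subseteq> E" "\<And>x. x \<in> U \<Longrightarrow> g x = \<mu> *\<^sub>R x"
    and W: "subspace W" "W \<subseteq> E" "\<And>x. x \<in> W \<Longrightarrow> g x = \<nu> *\<^sub>R x"
    and orth: "\<And>x y. x \<in> U \<Longrightarrow> y \<in> W \<Longrightarrow> x \<bullet> y = 0"
    and dec: "\<And>x. x \<in> E \<Longrightarrow> \<exists>u\<in>U. \<exists>w\<in>W. x = u + w"
  shows "det (matrix (block_ext p g)) = \<mu> ^ dim U * \<nu> ^ dim W" "dim U + dim W = dim E"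
proof -
  let ?Z = "{x. p x = 0}"
  have Z: "subspace ?Z" using p(1) by (auto simp: subspace_def linear_0 linear_add linear_scale)
  obtain B where B: "B \<subseteq> U" "pairwise orthogonal B" "\<And>x. x \<in> B \<Longrightarrow> norm x = 1"
    "independent B" "card B = dim U" "span B = U"
    using orthonormal_basis_subspace[OF U(1)] by metis
  obtain C where C: "C \<subseteq> W" "pairwise orthogonal C" "\<And>x. x \<in> C \<Longrightarrow> norm x = 1"
    "independent C" "card C = dim W" "span C = W"
    using orthonormal_basis_subspace[OF W(1)] by metis
  obtain D where D: "D \<subseteq> ?Z" "pairwise orthogonal D" "\<And>x. x \<in> D \<Longrightarrow> norm x = 1"
    "independent D" "card D = dim ?Z" "span D = ?Z"
    using orthonormal_basis_subspace[OF Z] by metis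
  have fin: "finite B" "finite C" "finite D" using B C D independent_imp_finite by blast+
  have oE: "x \<bullet> y = 0" if "x \<in> ?Z" "y \<in> E" for x y using p(4)[OF that(2), of x] that(1) by simp
  have un: "pairwise orthogonal (X \<union> Y)" if "pairwise orthogonal X" "pairwise orthogonal Y"
    "\<And>x y. x \<in> X \<Longrightarrow> y \<in> Y \<Longrightarrow> x \<bullet> y = 0" for X Y :: "(real^'c) set"
    using that unfolding pairwise_def orthogonal_def by (metis Un_iff inner_commute)
  have pw1: "pairwise orthogonal (B \<union> C)"
    using B(1,2) C(1,2) orth by (intro un) auto
  have pw2: "pairwise orthogonal (B \<union> C \<union> D)"
    using pw1 D(2)
  proof (rule un)
    show "x \<bullet> y = 0" if "x \<in> B \<union> C" "y \<in> D" for x y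
    proof -
      have "x \<in> E" "y \<in> ?Z" using that B(1) C(1) D(1) U(2) W(2) by blast+
      then show ?thesis using oE[of y x] by (simp add: inner_commute)
    qed
  qed
  note pw = pw1 pw2
  have nz: "0 \<notin> B \<union> C \<union> D" using B(3) C(3) D(3) by force
  have ind: "independent (B \<union> C)" "independent (B \<union> C \<union> D)"
    using pw nz by (intro pairwise_orthogonal_independent; simp)+
  have disj: "B \<inter> C = {}" "(B \<union> C) \<inter> D = {}"
  proof -
    have "x \<noteq> y" if "x \<bullet> y = 0" "norm x = 1" for x y :: "real^'c" using that by (auto simp: norm_eq_1)
    then show "B \<inter> C = {}" "(B \<union> C) \<inter> D = {}"
      using orth oE B(1,3) C(1,3) D(1,3) U(2) W(2) by blast+
  qed
  have spBC: "span (B \<union> C) = E"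
  proof
    show "span (B \<union> C) \<subseteq> E" using B(1) C(1) U(2) W(2) E(1) by (intro span_minimal) auto
    show "E \<subseteq> span (B \<union> C)"
    proof
      fix x assume "x \<in> E"
      then obtain u w where "u \<in> span B" "w \<in> span C" "x = u + w" using dec B(6) C(6) by blast
      then show "x \<in> span (B \<union> C)"
        using span_mono[of B "B \<union> C"] span_mono[of C "B \<union> C"] by (auto intro: span_add)
    qed
  qed
  have sp: "span (B \<union> C \<union> D) = UNIV"
  proof -
    have "x \<in> span (B \<union> C \<union> D)" for x
    proof -
      have "p (x - p x) = 0" using p by (simp add: linear_diff)
      then have "x - p x \<in> span (B \<union> C \<union> D)" using D(6) span_mono[of D "B \<union> C \<union> D"] by blast
      moreover have "p x \<in> span (B \<union> C \<union> D)" using spBC p(2) span_mono[of "B \<union> C" "B \<union> C \<union> D"] by blast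
      ultimately have "(x - p x) + p x \<in> span (B \<union> C \<union> D)" by (rule span_add)
      then show ?thesis by simp
    qed
    then show ?thesis by blast
  qed
  have "card (B \<union> C \<union> D) = CARD('c)"
    using ind(2) sp by (metis dim_eq_card dim_UNIV DIM_cart DIM_real mult.right_neutral span_UNIV)
  moreover define eig where "eig b = (if b \<in> B then \<mu> else if b \<in> C then \<nu> else 1)" for b
  have "linear (block_ext p g)"
    using p(1) g unfolding linear_iff block_ext_def
    by (auto simp: linear_add linear_scale algebra_simps)
  moreover have "block_ext p g b = eig b *\<^sub>R b" if bb: "b \<in> B \<union> C \<union> D" for b
  proof -
    consider "b \<in> B" | "b \<in> C" "b \<notin> B" | "b \<in> D" "b \<notin> B" "b \<notin> C" using bb by auto
    then show ?thesis
    proof cases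
      case 1 then have "p b = b" "g b = \<mu> *\<^sub>R b" using B(1) U p(3) by auto
      then show ?thesis using 1 by (simp add: block_ext_def eig_def)
    next
      case 2 then have "p b = b" "g b = \<nu> *\<^sub>R b" using C(1) W p(3) by auto
      then show ?thesis using 2 by (simp add: block_ext_def eig_def)
    next
      case 3 then have "p b = 0" using D(1) by auto
      then show ?thesis using 3 by (simp add: block_ext_def eig_def linear_0[OF g])
    qed
  qed
  ultimately have "det (matrix (block_ext p g)) = (\<Prod>b\<in>B \<union> C \<union> D. eig b)"
    using ind(2) det_matrix_eigenbasis by blast
  also have "\<dots> = (\<Prod>b\<in>B. eig b) * (\<Prod>b\<in>C. eig b) * (\<Prod>b\<in>D. eig b)"
    using fin disj by (simp add: prod.union_disjoint)
  also have "(\<Prod>b\<in>B. eig b) = \<mu> ^ dim U" by (simp add: eig_def B(5))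
  also have "(\<Prod>b\<in>C. eig b) = (\<Prod>b\<in>C. \<nu>)"
    using disj by (intro prod.cong) (auto simp: eig_def)
  also have "(\<Prod>b\<in>D. eig b) = (\<Prod>b\<in>D. 1)"
    using disj by (intro prod.cong) (auto simp: eig_def)
  finally show "det (matrix (block_ext p g)) = \<mu> ^ dim U * \<nu> ^ dim W" by (simp add: C(5))
  have "card (B \<union> C) = dim E" using ind(1) spBC by (metis dim_eq_card E(1) span_eq_iff)
  then show "dim U + dim W = dim E" using fin disj B(5) C(5) by (simp add: card_Un_disjoint)
qed

lemma Epos_Eneg_decomp:
  assumes k: "k \<in> S" and x: "x \<in> E"
  shows "\<exists>u\<in>Epos k. \<exists>w\<in>Eneg k. x = u + w"
proof -
  \<comment> \<open>The quadratic relation says that \<open>A k - q\<close> and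
    \<open>A k + 1\<close> multiply to zero on \<open>V\<close>, so these are the two spectral
    projections of \<open>x\<close>.\<close>
  let ?u = "(1 / (q + 1)) *\<^sub>R (A k x + x)" and ?w = "(1 / (q + 1)) *\<^sub>R (q *\<^sub>R x - A k x)"
  have xV: "x \<in> V" using x E(2) by auto
  note L = linear_add[OF linA[OF k]] linear_scale[OF linA[OF k]] linear_diff[OF linA[OF k]]
  have u: "?u \<in> Epos k"
    using E(1) AE[OF k x] x unfolding Epos_def
    by (auto simp: L sqA[OF k xV] subspace_scale subspace_add algebra_simps)
  have w: "?w \<in> Eneg k"
    using E(1) AE[OF k x] x unfolding Eneg_def
    by (auto simp: L sqA[OF k xV] subspace_scale subspace_diff algebra_simps)
  have "?u + ?w = (1 / (q + 1)) *\<^sub>R ((q + 1) *\<^sub>R x)" by (simp add: algebra_simps)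
  also have "\<dots> = x" using q by simp
  finally show ?thesis using u w by metis
qed

lemma Epos_Eneg_orth:
  assumes k: "k \<in> S" and "x \<in> Epos k" "y \<in> Eneg k"
  shows "x \<bullet> y = 0"
proof -
  have "q * (x \<bullet> y) = - (x \<bullet> y)"
    using assms selfA[OF k, of x y] unfolding Epos_def Eneg_def by simp
  then have "(q + 1) * (x \<bullet> y) = 0" by (simp add: algebra_simps)
  then show ?thesis using q by simp
qed

lemma eigenvalue_le:
  assumes \<mu>: "\<And>x. x \<in> E \<Longrightarrow> T (T x) = \<mu> *\<^sub>R x" and ne: "E \<noteq> {0}"
    and fix0: "\<And>x. x \<in> E \<Longrightarrow> (\<And>k. k \<in> S \<Longrightarrow> A k x = q *\<^sub>R x) \<Longrightarrow> x = 0"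
  shows "\<bar>\<mu>\<bar> ^ card S \<le> q ^ (2 * length ks * (card S - 1))"
proof -
  obtain p where p: "linear p" "\<And>x. p x \<in> E" "\<And>x. x \<in> E \<Longrightarrow> p x = x"
    "\<And>x y. y \<in> E \<Longrightarrow> (x - p x) \<bullet> y = 0" using exists_projection by metis
  \<comment> \<open>The determinant on \<open>E\<close>. It is multiplicative on a composition whose
    inner map leaves \<open>E\<close> invariant.\<close>
  define \<delta> where "\<delta> g = det (matrix (block_ext p g))" for g
  have linext: "linear (block_ext p g)" if "linear g" for g
    using p(1) that unfolding linear_iff block_ext_def
    by (auto simp: linear_add linear_scale algebra_simps)
  have mul: "\<delta> (f \<circ> g) = \<delta> f * \<delta> g" if f: "linear f" and g: "linear g" and gE: "\<And>x. x \<in> E \<Longrightarrow> g x \<in> E" for f g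
  proof -
    have "block_ext p (f \<circ> g) = block_ext p f \<circ> block_ext p g"
    proof
      fix x
      have "p (block_ext p g x) = g (p x)"
        unfolding block_ext_def using p gE by (simp add: linear_add linear_diff)
      then show "block_ext p (f \<circ> g) x = (block_ext p f \<circ> block_ext p g) x"
        by (simp add: block_ext_def)
    qed
    then show ?thesis using f g by (simp add: \<delta>_def matrix_compose linext det_mul)
  qed
  have cong: "\<delta> f = \<delta> g" if "\<And>x. x \<in> E \<Longrightarrow> f x = g x" for f g
  proof -
    have "block_ext p f = block_ext p g" using that p(2) by (auto simp: block_ext_def)
    then show ?thesis by (simp add: \<delta>_def)
  qed
  have dk: "\<delta> (A k) = q ^ dim (Epos k) * (-1) ^ dim (Eneg k)" "dim (Epos k) + dim (Eneg k) = dim E" if k: "k \<in> S" for k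
  proof -
    have 1: "\<And>x. x \<in> Eneg k \<Longrightarrow> A k x = (-1) *\<^sub>R x" by (simp add: Eneg_def)
    have 2: "\<And>x. x \<in> Epos k \<Longrightarrow> A k x = q *\<^sub>R x" by (simp add: Epos_def)
    have 3: "Epos k \<subseteq> E" "Eneg k \<subseteq> E" by (auto simp: Epos_def Eneg_def)
    note * = det_block_ext[OF p linA[OF k] sub_pos[OF k] 3(1) 2 sub_neg[OF k] 3(2) 1
      Epos_Eneg_orth[OF k] Epos_Eneg_decomp[OF k]]
    show "\<delta> (A k) = q ^ dim (Epos k) * (-1) ^ dim (Eneg k)" "dim (Epos k) + dim (Eneg k) = dim E"
      using * by (simp_all add: \<delta>_def)
  qed
  have nz: "\<delta> (A k) \<noteq> 0" if "k \<in> S" for k using dk(1)[OF that] q by simp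
  \<comment> \<open>Taking determinants in the braid relation and cancelling nonzero factors
    replaces the construction of a conjugating map.\<close>
  have step': "\<delta> (A k) = \<delta> (A l)" if "k \<in> S" "l \<in> S" "\<forall>x\<in>V. A k (A l (A k x)) = A l (A k (A l x))" for k l
  proof -
    have "\<delta> (A k \<circ> (A l \<circ> A k)) = \<delta> (A l \<circ> (A k \<circ> A l))"
      using that(3) E(2) by (intro cong) auto
    moreover have "\<delta> (A k \<circ> (A l \<circ> A k)) = \<delta> (A k) * (\<delta> (A l) * \<delta> (A k))"
      if "k \<in> S" "l \<in> S" for k l using that linA AE by (simp add: mul linear_compose)
    ultimately show ?thesis using nz that by simp
  qed
  obtain k0 where k0: "k0 \<in> S" using finS by blast
  have all: "\<delta> (A k) = \<delta> (A k0)" if "k \<in> S" for k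
    using braid[OF k0 that]
  proof (induction rule: rtrancl_induct)
    case (step l m)
    then show ?case using step'[of l m] by simp
  qed simp
  define a where "a = dim (Epos k0)"
  define d where "d = dim E"
  have dims: "dim (Epos k) = a" if "k \<in> S" for k
  proof -
    \<comment> \<open>Absolute values remove the sign coming from \<open>Eneg k\<close>, and
      \<open>q > 1\<close> allows the exponents to be compared.\<close>
    have "q ^ dim (Epos k) = \<bar>\<delta> (A k)\<bar>" using dk(1)[OF that] q by (simp add: abs_mult power_abs)
    also have "\<dots> = q ^ a" using all[OF that] dk(1)[OF k0] q by (simp add: abs_mult power_abs a_def)
    finally show ?thesis using q power_inject_exp by blast
  qed
  have abs: "\<bar>\<delta> (A k)\<bar> = q ^ a" if "k \<in> S" for k
    using dk(1)[OF that] dims[OF that] q by (simp add: abs_mult power_abs)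
  have fold: "linear (foldr A js) \<and> (\<forall>x\<in>E. foldr A js x \<in> E) \<and> \<bar>\<delta> (foldr A js)\<bar> = q ^ (length js * a)"
    if "set js \<subseteq> S" for js using that
  proof (induction js)
    case Nil
    have "block_ext p (\<lambda>x. x) = (\<lambda>x. x)" by (auto simp: block_ext_def)
    then have "\<delta> (\<lambda>x. x) = 1" by (simp add: \<delta>_def matrix_id[unfolded id_def])
    then show ?case by (simp add: id_def linear_id[unfolded id_def])
  next
    case (Cons j js)
    then have "\<delta> (foldr A (j # js)) = \<delta> (A j) * \<delta> (foldr A js)" 
      by (simp add: mul linA)
    then show ?case using Cons abs[of j] AE linA
      by (auto simp: abs_mult power_add comp_def intro: linear_compose[unfolded comp_def])
  qed
  have "\<delta> (\<lambda>x. T (T x)) = \<delta> (foldr A (ks @ ks))"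
    using T E(2) ks foldr_V by (intro cong) (auto simp: subset_iff)
  then have 1: "\<bar>\<delta> (\<lambda>x. T (T x))\<bar> = q ^ (2 * length ks * a)" using fold[of "ks @ ks"] ks by (simp add: mult_2)
  \<comment> \<open>The square of \<open>T\<close> is a scalar on \<open>E\<close>; the zero space
    serves as the second eigenspace.\<close>
  have "\<delta> (\<lambda>x. T (T x)) = \<mu> ^ dim E * 1 ^ dim {0::real^'c}"
    unfolding \<delta>_def
  proof (rule det_block_ext(1)[OF p])
    show "linear (\<lambda>x. T (T x))" using linT linear_compose[of T T] by (simp add: comp_def)
    show "T (T x) = 1 *\<^sub>R x" if "x \<in> {0}" for x using that linT by (simp add: linear_0)
  qed (use E \<mu> in \<open>auto simp: subspace_0\<close>)
  then have 2: "\<bar>\<mu>\<bar> ^ d = q ^ (2 * length ks * a)" using 1 by (simp add: power_abs d_def)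
  have d0: "d > 0" using ne E(1) unfolding d_def by (metis dim_eq_0 subspace_0 gr0I subset_singletonD empty_iff)
  have "dim E \<le> dim (E \<inter> (\<Inter>k\<in>S. Epos k)) + (\<Sum>k\<in>S. dim E - dim (Epos k))"
    using E(1) finS(1) sub_pos by (intro dim_Inter_codim) (auto simp: Epos_def)
  moreover have "E \<inter> (\<Inter>k\<in>S. Epos k) \<subseteq> {0}" using fix0 by (auto simp: Epos_def)
  then have "dim (E \<inter> (\<Inter>k\<in>S. Epos k)) = 0" by simp
  ultimately have "d \<le> card S * (d - a)" using dims by (simp add: d_def)
  moreover have "a \<le> d" using dk(2)[OF k0] by (simp add: a_def d_def)
  ultimately obtain r where "d = a + r" "a + r \<le> card S * r" by (metis le_add_diff_inverse)
  then have "card S * a + d \<le> card S * d" by (simp add: distrib_left)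
  then have 3: "card S * a \<le> (card S - 1) * d" by (simp add: diff_mult_distrib)
  \<comment> \<open>Comparing \<open>d\<close>-th powers keeps the fractional exponent
    \<open>a / d\<close> out of the computation.\<close>
  have "(\<bar>\<mu>\<bar> ^ card S) ^ d = (\<bar>\<mu>\<bar> ^ d) ^ card S" by (simp add: power_mult[symmetric] mult.commute)
  also have "\<dots> = q ^ (2 * length ks * (card S * a))" by (simp add: 2 power_mult[symmetric] mult_ac)
  also have "\<dots> \<le> q ^ (2 * length ks * ((card S - 1) * d))"
    using mult_le_mono2[OF 3, of "2 * length ks"] q by (intro power_increasing) auto
  also have "\<dots> = (q ^ (2 * length ks * (card S - 1))) ^ d" by (simp add: power_mult[symmetric] mult_ac)
  finally show ?thesis using d0 q by (simp add: power_mono_iff)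
qed

end

text \<open>With \<open>length ks = N * card S\<close>, the factor \<open>card S - 1\<close> in
  \<open>eigenvalue_le\<close> makes \<open>q ^ N\<close> the quotient of the eigenvalue of
  \<open>T\<close> on \<open>K\<close> by the norm bound \<open>lam\<close> off \<open>K\<close>.
  With \<open>x\<close> the indicator of an EKR-set and \<open>y\<close> that of all chambers the
  conclusion is the ratio bound.\<close>

theorem hoffman_bound:
  assumes N: "length ks = N * card S"
    and x: "x \<in> V" "x \<bullet> T x = 0" and y: "y \<in> V" "\<And>k. k \<in> S \<Longrightarrow> A k y = q *\<^sub>R y"
  shows "(x \<bullet> y)\<^sup>2 * (1 + q ^ N) \<le> (x \<bullet> x) * (y \<bullet> y)"
proof -
  let ?m = "card S"
  have m: "?m \<ge> 1" using finS by (simp add: Suc_leI card_gt_0_iff)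
  define K where "K = {f \<in> V. \<forall>k\<in>S. A k f = q *\<^sub>R f}"
  define K' where "K' = {f \<in> V. \<forall>g\<in>K. f \<bullet> g = 0}"
  define lam where "lam = q ^ (N * (?m - 1))"
  have K: "subspace K" using V unfolding K_def
    by (auto simp: subspace_def linear_0 linA linear_add linear_scale scaleR_right_distrib)
  have K': "subspace K'" using V unfolding K'_def by (auto simp: subspace_def inner_add_left)
  have AK': "A k f \<in> K'" if "k \<in> S" "f \<in> K'" for k f
    using that AV selfA unfolding K'_def K_def by auto
  have foldK: "foldr A js g = q ^ length js *\<^sub>R g" if "g \<in> K" "set js \<subseteq> S" for g js
    using that(2) by (induction js) (use that(1) in \<open>auto simp: K_def linA linear_scale\<close>)
  have TK: "T g = q ^ (N * ?m) *\<^sub>R g" if "g \<in> K" for g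
    using foldK[OF that ks] T[of g] that by (simp add: K_def N)
  have TK': "T f \<in> K'" if "f \<in> K'" for f
    using that TV TK selfT unfolding K'_def by auto
  have normT: "T f \<bullet> T f \<le> lam\<^sup>2 * (f \<bullet> f)" if f: "f \<in> K'" for f
  proof (cases "K' = {0}")
    case True
    then show ?thesis using f linT by (simp add: linear_0)
  next
    case False
    have lTT: "linear (\<lambda>x. T (T x))" using linT linear_compose[of T T] by (simp add: comp_def)
    obtain \<mu> f0 where f0: "f0 \<in> K'" "f0 \<noteq> 0" "T (T f0) = \<mu> *\<^sub>R f0"
      and mx: "\<And>x. x \<in> K' \<Longrightarrow> T (T x) \<bullet> x \<le> \<mu> * (x \<bullet> x)"
      using rayleigh_maximum[OF lTT _ K' _ False] selfT TK' by metis
    \<comment> \<open>The whole eigenspace rather than the line of \<open>f0\<close>: it is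
      invariant under every \<open>A k\<close>, since these commute with the square of
      \<open>T\<close>.\<close>
    define E where "E = {x \<in> K'. T (T x) = \<mu> *\<^sub>R x}"
    have "\<bar>\<mu>\<bar> ^ card S \<le> q ^ (2 * length ks * (card S - 1))"
    proof (rule eigenvalue_le[of E])
      show "subspace E" using K' lTT unfolding E_def
        by (auto simp: subspace_def linear_0[OF lTT] linear_add[OF lTT] linear_scale[OF lTT] scaleR_right_distrib)
      show "E \<subseteq> V" by (auto simp: E_def K'_def)
      show "A k x \<in> E" if "k \<in> S" "x \<in> E" for k x
        using that AK' TT_comm[of k x] linA[of k] by (auto simp: E_def K'_def linear_scale)
      show "T (T x) = \<mu> *\<^sub>R x" if "x \<in> E" for x using that by (simp add: E_def)
      show "E \<noteq> {0}" using f0 by (auto simp: E_def)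
      show "x = 0" if "x \<in> E" "\<And>k. k \<in> S \<Longrightarrow> A k x = q *\<^sub>R x" for x
      proof -
        have "x \<in> K" "x \<in> K'" using that by (auto simp: E_def K_def K'_def)
        then have "x \<bullet> x = 0" by (auto simp: K'_def)
        then show ?thesis by simp
      qed
    qed
    also have "\<dots> = (lam\<^sup>2) ^ card S" by (simp add: N lam_def power_mult[symmetric] mult_ac)
    finally have "\<bar>\<mu>\<bar> \<le> lam\<^sup>2" using m q by (subst (asm) power_mono_iff) (auto simp: lam_def)
    then have "\<mu> \<le> lam\<^sup>2" by simp
    \<comment> \<open>Self-adjointness turns the squared norm of \<open>T f\<close> into a value of
      the form bounded by \<open>mx\<close>.\<close>
    have "T f \<bullet> T f = T (T f) \<bullet> f" using selfT[of "T f" f] by (simp add: inner_commute)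
    also have "\<dots> \<le> \<mu> * (f \<bullet> f)" using mx[OF f] .
    also have "\<dots> \<le> lam\<^sup>2 * (f \<bullet> f)" using \<open>\<mu> \<le> lam\<^sup>2\<close> by (simp add: mult_right_mono)
    finally show ?thesis .
  qed
  obtain x1 x2 where x12: "x1 \<in> K" "\<And>w. w \<in> K \<Longrightarrow> orthogonal x2 w" "x = x1 + x2"
    using orthogonal_subspace_decomp_exists[of K x] span_eq_iff K by metis
  have x2: "x2 \<in> K'"
  proof -
    have "x2 = x - x1" using x12(3) by simp
    then have "x2 \<in> V" using x(1) x12(1) V by (simp add: subspace_diff K_def)
    then show ?thesis using x12(2) by (auto simp: K'_def orthogonal_def)
  qed
  have o: "x2 \<bullet> w = 0" if "w \<in> K" for w using x12(2) that by (simp add: orthogonal_def)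
  let ?D = "q ^ (N * ?m)"
  have xx: "x \<bullet> x = x1 \<bullet> x1 + x2 \<bullet> x2"
    using o[OF x12(1)] by (simp add: x12(3) inner_add_left inner_add_right inner_commute)
  have "T x = ?D *\<^sub>R x1 + T x2" by (simp add: x12(3) linear_add[OF linT] TK[OF x12(1)])
  then have xTx: "x \<bullet> T x = ?D * (x1 \<bullet> x1) + x2 \<bullet> T x2"
    using o[OF x12(1)] TK'[OF x2] x12(1)
    by (simp add: x12(3) inner_add_left inner_add_right inner_commute K'_def)
  have "\<bar>x2 \<bullet> T x2\<bar> \<le> norm x2 * norm (T x2)" by (rule Cauchy_Schwarz_ineq2)
  also have "norm (T x2) \<le> lam * norm x2"
  proof (rule power2_le_imp_le)
    show "(norm (T x2))\<^sup>2 \<le> (lam * norm x2)\<^sup>2"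
      using normT[OF x2] by (simp add: power_mult_distrib power2_norm_eq_inner)
    show "0 \<le> lam * norm x2" using q by (simp add: lam_def)
  qed
  then have "norm x2 * norm (T x2) \<le> norm x2 * (lam * norm x2)" by (rule mult_left_mono) simp
  also have "\<dots> = lam * (x2 \<bullet> x2)" by (simp add: power2_norm_eq_inner[symmetric] power2_eq_square)
  \<comment> \<open>Since \<open>x \<bullet> T x = 0\<close>, the positive contribution of
    \<open>x1\<close> must be cancelled by \<open>x2\<close>, where \<open>T\<close> is
    small.\<close>
  finally have "?D * (x1 \<bullet> x1) \<le> lam * (x2 \<bullet> x2)" using xTx x(2) by simp
  moreover have D: "?D = lam * q ^ N"
  proof -
    obtain r where "card S = Suc r" using m by (cases "card S") auto
    then show ?thesis by (simp add: lam_def power_add)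
  qed
  ultimately have "lam * (q ^ N * (x1 \<bullet> x1)) \<le> lam * (x2 \<bullet> x2)" by (simp add: mult.assoc)
  then have "q ^ N * (x1 \<bullet> x1) \<le> x2 \<bullet> x2" using q by (simp add: lam_def)
  then have 1: "(1 + q ^ N) * (x1 \<bullet> x1) \<le> x \<bullet> x" using xx by (simp add: algebra_simps)
  have "y \<in> K" using y by (simp add: K_def)
  \<comment> \<open>As \<open>y\<close> lies in \<open>K\<close>, only the component
    \<open>x1\<close> counts, and its length has just been bounded.\<close>
  then have "x \<bullet> y = x1 \<bullet> y" using o by (simp add: x12(3) inner_add_left)
  then have "(x \<bullet> y)\<^sup>2 \<le> (x1 \<bullet> x1) * (y \<bullet> y)" by (simp add: Cauchy_Schwarz_ineq)
  then have "(x \<bullet> y)\<^sup>2 * (1 + q ^ N) \<le> (x1 \<bullet> x1) * (y \<bullet> y) * (1 + q ^ N)"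
    using q by (intro mult_right_mono) auto
  also have "\<dots> = (1 + q ^ N) * (x1 \<bullet> x1) * (y \<bullet> y)" by (simp add: mult_ac)
  also have "\<dots> \<le> (x \<bullet> x) * (y \<bullet> y)" using 1 by (rule mult_right_mono) simp
  finally show ?thesis .
qed

end

section \<open>Hyperbolic bases\<close>

locale quadric =
  fixes n :: nat and Q :: "'a::{field,finite} ^ 'm \<Rightarrow> 'a"
  assumes qf: "quadratic_form Q" and dim2n: "CARD('m) = 2 * n"
begin

abbreviation I :: "int set" where "I \<equiv> frame_indices n"
abbreviation B :: "'a ^ 'm \<Rightarrow> 'a ^ 'm \<Rightarrow> 'a" where "B \<equiv> polar_form Q"

text \<open>The pairing is normalised to 1, so that \<open>B x (v (- i))\<close> is the coordinate
  of \<open>x\<close> at \<open>v i\<close>.\<close>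

definition hyperbolic_basis :: "(int \<Rightarrow> 'a ^ 'm) \<Rightarrow> bool" where
  "hyperbolic_basis v \<longleftrightarrow> (\<forall>i\<in>I. Q (v i) = 0) \<and>
     (\<forall>i\<in>I. \<forall>j\<in>I. B (v i) (v j) = (if j = - i then 1 else 0))"

definition bspan :: "(int \<Rightarrow> 'a ^ 'm) \<Rightarrow> int set \<Rightarrow> ('a ^ 'm) set" where
  "bspan v A = vec.span (v ` A)"

lemma I_iff: "i \<in> I \<longleftrightarrow> i \<noteq> 0 \<and> \<bar>i\<bar> \<le> int n"
  by (auto simp: frame_indices_def)

lemma finite_I [simp]: "finite I" by (simp add: frame_indices_def)

lemma uminus_I [simp]: "- i \<in> I \<longleftrightarrow> i \<in> I" by (auto simp: I_iff)

lemma zero_I [simp]: "0 \<notin> I" by (simp add: I_iff)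

lemma card_I: "card I = 2 * n"
proof -
  have "card ({- int n..int n} - {0}) = card {- int n..int n} - 1" by (subst card_Diff_subset) auto
  then show ?thesis by (simp add: frame_indices_def)
qed

lemmas B_comm = polar_comm[OF qf] and Q_add' = Q_add[OF qf]
  and Q_zero' [simp] = Q_zero[OF qf] and Q_scale' = Q_scale[OF qf]

lemma B_add_left: "B (x + y) z = B x z + B y z" and B_scale_left: "B (c *s x) z = c * B x z"
  and B_zero_left [simp]: "B 0 z = 0"
  using polar_add[OF qf] polar_scale[OF qf] polar_zero[OF qf] by blast+

lemma B_add_right: "B z (x + y) = B z x + B z y" and B_scale_right: "B z (c *s x) = c * B z x"
  and B_zero_right [simp]: "B z 0 = 0"
  using B_add_left B_scale_left B_zero_left by (simp_all add: B_comm[of z])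

lemma B_minus_left: "B (- x) z = - B x z"
  using B_add_left[of x "- x" z] by (simp add: add_eq_0_iff)

lemma B_minus_right: "B z (- x) = - B z x"
  by (simp add: B_comm[of z] B_minus_left)

lemma B_diff_left: "B (x - y) z = B x z - B y z" and B_diff_right: "B z (x - y) = B z x - B z y"
  using B_add_left[of x "- y" z] B_add_right[of z x "- y"] by (simp_all add: B_minus_left B_minus_right)

lemma B_sum_left: "B (\<Sum>i\<in>S. f i) z = (\<Sum>i\<in>S. B (f i) z)"
  by (induction S rule: infinite_finite_induct) (auto simp: B_add_left)

lemma B_sum_right: "B z (\<Sum>i\<in>S. f i) = (\<Sum>i\<in>S. B z (f i))"
  by (induction S rule: infinite_finite_induct) (auto simp: B_add_right)

lemmas B_lin = B_add_left B_add_right B_scale_left B_scale_right B_minus_left B_minus_right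
  B_diff_left B_diff_right

lemma Q_minus: "Q (- x) = Q x"
  using Q_scale'[of "- 1" x] by (simp add: vector_smult_lneg)

lemma Q_diff: "Q (x - y) = Q x + Q y - B x y"
  using Q_add'[of x "- y"] by (simp add: Q_minus B_minus_right)

lemma perp_span:
  assumes "\<And>s. s \<in> S \<Longrightarrow> B x s = 0" "y \<in> vec.span S"
  shows "B x y = 0"
  using polar_span[OF qf, of S x y] assms by (simp add: B_comm)

context
  fixes v assumes hyp: "hyperbolic_basis v"
begin

lemma hyp_Q [simp]: "i \<in> I \<Longrightarrow> Q (v i) = 0"
  and hyp_B: "i \<in> I \<Longrightarrow> j \<in> I \<Longrightarrow> B (v i) (v j) = (if j = - i then 1 else 0)"
  using hyp unfolding hyperbolic_basis_def by blast+

lemma hyp_inj: "inj_on v I"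
proof (rule inj_onI)
  fix i j assume ij: "i \<in> I" "j \<in> I" "v i = v j"
  then have "B (v j) (v (- i)) = 1" using hyp_B[of i "- i"] by simp
  then show "i = j" using hyp_B[of j "- i"] ij by (auto split: if_splits)
qed

lemma hyp_independent:
  assumes "A \<subseteq> I" shows "vec.independent (v ` A)"
proof
  assume "vec.dependent (v ` A)"
  then obtain i where i: "i \<in> A" "v i \<in> vec.span (v ` A - {v i})"
    unfolding vec.dependent_def by blast
  have "B (v i) (v (- i)) = 0"
  proof (rule polar_span[OF qf _ i(2)])
    fix s assume "s \<in> v ` A - {v i}"
    then obtain j where "j \<in> A" "s = v j" "j \<noteq> i" by blast
    then show "B s (v (- i)) = 0" using hyp_B[of j "- i"] assms i(1) by auto
  qed
  then show False using hyp_B[of i "- i"] i(1) assms by auto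
qed

lemma dim_bspan: "A \<subseteq> I \<Longrightarrow> vec.dim (bspan v A) = card A"
  using hyp_independent hyp_inj unfolding bspan_def
  by (metis card_image inj_on_subset vec.dim_eq_card_independent vec.dim_span)

lemma bspan_I: "bspan v I = UNIV"
proof -
  have "vec.dim (bspan v I) = CARD('m)" by (simp add: dim_bspan card_I dim2n)
  then show ?thesis unfolding bspan_def
    by (intro vec.subspace_dim_equal) (simp_all add: vec_dim_card card_cart_basis)
qed

lemma hyp_expand: "x = (\<Sum>i\<in>I. B x (v (- i)) *s v i)"
proof -
  let ?P = "{x. x = (\<Sum>i\<in>I. B x (v (- i)) *s v i)}"
  have "vec.subspace ?P"
  proof (rule vec.subspaceI)
    fix x y assume "x \<in> ?P" "y \<in> ?P"
    then have "x + y = (\<Sum>i\<in>I. B x (v (- i)) *s v i) + (\<Sum>i\<in>I. B y (v (- i)) *s v i)" by simp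
    also have "\<dots> = (\<Sum>i\<in>I. B (x + y) (v (- i)) *s v i)"
      by (simp add: sum.distrib[symmetric] B_lin vec.scale_left_distrib)
    finally show "x + y \<in> ?P" by simp
  next
    fix c x assume "x \<in> ?P"
    then have "c *s x = c *s (\<Sum>i\<in>I. B x (v (- i)) *s v i)" by simp
    also have "\<dots> = (\<Sum>i\<in>I. B (c *s x) (v (- i)) *s v i)"
      by (simp add: B_lin vec.scale_sum_right vec.scale_scale)
    finally show "c *s x \<in> ?P" by simp
  qed simp
  moreover have "v ` I \<subseteq> ?P"
  proof
    fix y assume "y \<in> v ` I"
    then obtain j where j: "j \<in> I" "y = v j" by blast
    have "(\<Sum>i\<in>I. B y (v (- i)) *s v i) = (\<Sum>i\<in>I. if i = j then v j else 0)"
      using j by (intro sum.cong) (auto simp: hyp_B)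
    then show "y \<in> ?P" using j by simp
  qed
  ultimately have "bspan v I \<subseteq> ?P" unfolding bspan_def by (intro vec.span_minimal)
  then show ?thesis using bspan_I by auto
qed

text \<open>The numbers \<open>B x (v (- i))\<close> are the coordinates of \<open>x\<close> by
  \<open>hyp_expand\<close>. Intersections and perps of spans of basis vectors thereby become
  operations on index sets.\<close>

lemma mem_FS_iff:
  assumes A: "A \<subseteq> I"
  shows "x \<in> bspan v A \<longleftrightarrow> (\<forall>i\<in>I - A. B x (v (- i)) = 0)"
proof
  assume x: "x \<in> bspan v A"
  show "\<forall>i\<in>I - A. B x (v (- i)) = 0"
  proof
    fix i assume i: "i \<in> I - A"
    show "B x (v (- i)) = 0"
    proof (rule polar_span[OF qf _ x[unfolded bspan_def]])
      fix s assume "s \<in> v ` A" then show "B s (v (- i)) = 0" using i A by (auto simp: hyp_B)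
    qed
  qed
next
  assume z: "\<forall>i\<in>I - A. B x (v (- i)) = 0"
  have "x = (\<Sum>i\<in>I. B x (v (- i)) *s v i)" by (rule hyp_expand)
  also have "\<dots> = (\<Sum>i\<in>A. B x (v (- i)) *s v i)"
    using A z by (intro sum.mono_neutral_right) auto
  finally have "x = (\<Sum>i\<in>A. B x (v (- i)) *s v i)" .
  moreover have "(\<Sum>i\<in>A. B x (v (- i)) *s v i) \<in> bspan v A"
    unfolding bspan_def by (intro vec.span_sum vec.span_scale vec.span_base) auto
  ultimately show "x \<in> bspan v A" by simp
qed

lemma bspan_Int: "A \<subseteq> I \<Longrightarrow> A' \<subseteq> I \<Longrightarrow> bspan v A \<inter> bspan v A' = bspan v (A \<inter> A')"
  by (intro Set.set_eqI) (auto simp: mem_FS_iff Int_absorb2 le_infI1)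

lemma bspan_perp:
  assumes A: "A \<subseteq> I"
  shows "{x. \<forall>y\<in>bspan v A. B x y = 0} = bspan v {i \<in> I. - i \<notin> A}"
proof (intro Set.set_eqI iffI)
  fix x assume "x \<in> {x. \<forall>y\<in>bspan v A. B x y = 0}"
  then have "B x (v i) = 0" if "i \<in> A" for i using that by (auto simp: bspan_def vec.span_base)
  then show "x \<in> bspan v {i \<in> I. - i \<notin> A}" by (subst mem_FS_iff) auto
next
  fix x assume x: "x \<in> bspan v {i \<in> I. - i \<notin> A}"
  have "B x (v i) = 0" if "i \<in> A" for i
  proof -
    have "- i \<in> I - {i \<in> I. - i \<notin> A}" using that A by auto
    moreover have "\<forall>i\<in>I - {i \<in> I. - i \<notin> A}. B x (v (- i)) = 0"
      using x by (subst (asm) mem_FS_iff) auto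
    ultimately have "B x (v (- (- i))) = 0" by blast
    then show ?thesis by simp
  qed
  then show "x \<in> {x. \<forall>y\<in>bspan v A. B x y = 0}" using perp_span[of "v ` A" x] unfolding bspan_def by auto
qed

lemma bspan_totally_singular:
  assumes A: "A \<subseteq> I" "\<And>i. i \<in> A \<Longrightarrow> - i \<notin> A"
  shows "totally_singular Q (bspan v A)"
  unfolding bspan_def
proof (rule span_totally_singular[OF qf])
  show "Q s = 0" if "s \<in> v ` A" for s using that A by auto
  show "B s t = 0" if "s \<in> v ` A" "t \<in> v ` A" for s t
    using that A by (auto simp: hyp_B subset_iff)
qed

lemma linear_functional:
  assumes \<phi>: "\<And>x y. \<phi> (x + y) = \<phi> x + \<phi> y" "\<And>c x. \<phi> (c *s x) = c * \<phi> x"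
  shows "\<exists>y. \<forall>x. B x y = \<phi> x"
proof (intro exI allI)
  fix x
  have \<phi>0: "\<phi> 0 = 0" using \<phi>(2)[of 0 0] by simp
  have \<phi>s: "\<phi> (\<Sum>i\<in>S. f i) = (\<Sum>i\<in>S. \<phi> (f i))" for S :: "int set" and f
    by (induction S rule: infinite_finite_induct) (auto simp: \<phi> \<phi>0)
  have "B x (\<Sum>i\<in>I. \<phi> (v i) *s v (- i)) = \<phi> (\<Sum>i\<in>I. B x (v (- i)) *s v i)"
    by (simp add: B_sum_right \<phi>s \<phi> B_lin mult.commute)
  then show "B x (\<Sum>i\<in>I. \<phi> (v i) *s v (- i)) = \<phi> x" using hyp_expand[of x] by simp
qed

lemma independent_functional:
  assumes n: "n \<ge> 1" and S: "vec.independent S"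
  shows "\<exists>y. \<forall>s\<in>S. B s y = f s"
proof -
  \<comment> \<open>A scalar functional is coded as a linear map into the line of
    \<open>v 1\<close>; pairing with \<open>v (- 1)\<close> reads the scalar off again.\<close>
  obtain g where g: "Vector_Spaces.linear (*s) (*s) g" "\<And>s. s \<in> S \<Longrightarrow> g s = f s *s v 1"
    using vec.linear_independent_extend[OF S, of "\<lambda>s. f s *s v 1"] by auto
  have 1: "1 \<in> I" using n by (simp add: I_iff)
  have "\<exists>y. \<forall>x. B x y = B (g x) (v (- 1))"
    by (rule linear_functional) (simp_all add: vec.linear_add[OF g(1)] vec.linear_scale[OF g(1)] B_lin)
  then obtain y where y: "\<And>x. B x y = B (g x) (v (- 1))" by blast
  have "B s y = f s" if "s \<in> S" for s
    using g(2)[OF that] hyp_B[of 1 "- 1"] 1 by (simp add: y B_lin)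
  then show ?thesis by blast
qed

text \<open>A functional that vanishes on a basis of \<open>U\<close> but not at \<open>x\<close> is
  a pairing with some vector. In effect, \<open>U\<close> is its own double perp.\<close>

lemma perp_separates:
  assumes n: "n \<ge> 1" and U: "vec.subspace U" "x \<notin> U"
  shows "\<exists>y. (\<forall>u\<in>U. B u y = 0) \<and> B x y \<noteq> 0"
proof -
  obtain S where S: "S \<subseteq> U" "vec.independent S" "vec.span S = U"
    using vec.basis_subspace_exists[OF U(1)] by metis
  have "vec.independent (insert x S)"
    using vec.dependent_insertD[of x S] S U(2) by auto
  from independent_functional[OF n this, of "\<lambda>s. if s = x then 1 else 0"]
  obtain y where y: "B x y = 1" "\<And>s. s \<in> S \<Longrightarrow> s \<noteq> x \<Longrightarrow> B s y = 0" by auto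
  have "B u y = 0" if "u \<in> U" for u
    by (rule polar_span[OF qf, of S]) (use y S U(2) that in auto)
  then show ?thesis using y(1) by (intro exI[of _ y]) auto
qed

text \<open>The dual vectors of a basis of a generator may be changed by elements of the generator,
  which is enough freedom to make them singular and mutually perpendicular.\<close>

lemma hyperbolic_completion:
  assumes n: "n \<ge> 1" and b: "vec.independent (b ` {1..int n})" "inj_on b {1..int n}"
    and ts: "totally_singular Q (bspan b {1..int n})"
  shows "\<exists>w. hyperbolic_basis w \<and> (\<forall>i\<in>{1..int n}. w i = b i)"
proof -
  let ?P = "{1..int n}"
  have bF: "b i \<in> bspan b ?P" if "i \<in> ?P" for i using that unfolding bspan_def by (auto intro: vec.span_base)
  have bb: "B (b i) (b j) = 0" "Q (b i) = 0" if "i \<in> ?P" "j \<in> ?P" for i j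
    using bF that ts totally_singular_polar[OF qf ts] unfolding totally_singular_def by auto
  have "\<forall>j. \<exists>y. \<forall>s\<in>b ` ?P. B s y = (if s = b j then 1 else 0)"
  proof
    show "\<exists>y. \<forall>s\<in>b ` ?P. B s y = (if s = b j then 1 else 0)" for j
      using independent_functional[OF n b(1), of "\<lambda>s. if s = b j then 1 else 0"] by simp
  qed
  then obtain y where y0: "\<And>j s. s \<in> b ` ?P \<Longrightarrow> B s (y j) = (if s = b j then 1 else 0)" by metis
  have y: "B (b i) (y j) = (if i = j then 1 else 0)" if "i \<in> ?P" "j \<in> ?P" for i j
    using y0[of "b i" j] that b(2) by (auto simp: inj_on_eq_iff)
  then have y': "B (y j) (b i) = (if i = j then 1 else 0)" if "i \<in> ?P" "j \<in> ?P" for i j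
    using that by (simp add: B_comm[of "y j"])
  \<comment> \<open>The multiple of \<open>b j\<close> cancels \<open>Q (y j)\<close>, the sum over
    \<open>k < j\<close> cancels the pairings with earlier \<open>y k\<close>. Placing each
    correction on the later vector avoids a division by 2 and so covers characteristic 2.\<close>
  define z where "z j = y j - Q (y j) *s b j - (\<Sum>k\<in>{1..<j}. B (y j) (y k) *s b k)" for j
  have by': "B (\<Sum>k\<in>{1..<j}. c k *s b k) (y l) = (if l < j then c l else 0)"
    if "j \<in> ?P" "l \<in> ?P" for c j l
  proof -
    have "B (\<Sum>k\<in>{1..<j}. c k *s b k) (y l) = (\<Sum>k\<in>{1..<j}. if k = l then c l else 0)"
      unfolding B_sum_left using that by (intro sum.cong) (auto simp: B_lin y)
    then show ?thesis using that by (simp add: sum.delta)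
  qed
  have bs: "B (b i) (\<Sum>k\<in>{1..<j}. c k *s b k) = 0" "B (\<Sum>k\<in>{1..<j}. c k *s b k) (b i) = 0"
      "Q (\<Sum>k\<in>{1..<j}. c k *s b k) = 0"
    if "j \<in> ?P" "i \<in> ?P" for c j i
  proof -
    have "(\<Sum>k\<in>{1..<j}. c k *s b k) \<in> bspan b ?P"
      unfolding bspan_def using that by (intro vec.span_sum vec.span_scale vec.span_base) auto
    moreover have "b i \<in> bspan b ?P" using that bF by blast
    ultimately show "B (b i) (\<Sum>k\<in>{1..<j}. c k *s b k) = 0" "B (\<Sum>k\<in>{1..<j}. c k *s b k) (b i) = 0"
      "Q (\<Sum>k\<in>{1..<j}. c k *s b k) = 0"
      using totally_singular_polar[OF qf ts] ts unfolding totally_singular_def by auto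
  qed
  have bss: "B (\<Sum>k\<in>{1..<j}. c k *s b k) (\<Sum>k\<in>{1..<l}. d k *s b k) = 0" if "j \<in> ?P" "l \<in> ?P" for c d j l
    unfolding B_sum_right using that by (intro sum.neutral) (auto simp: B_lin bs)
  have yb': "B (y l) (\<Sum>k\<in>{1..<j}. c k *s b k) = (if l < j then c l else 0)"
    if "j \<in> ?P" "l \<in> ?P" for c j l
    using by'[OF that] by (simp add: B_comm[of "y l"])
  have bz: "B (b i) (z j) = (if i = j then 1 else 0)" if "i \<in> ?P" "j \<in> ?P" for i j
    using that by (simp add: z_def B_lin y bb bs)
  have Qz: "Q (z j) = 0" if "j \<in> ?P" for j
    using that by (simp add: z_def Q_diff Q_scale' B_lin bb bs y' yb' y)
  have zz1: "B (z j) (z l) = 0" if "j \<in> ?P" "l \<in> ?P" "l < j" for j l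
    using that by (simp add: z_def B_lin bb bs bss y y' by' yb')
  have zz0: "B (z j) (z j) = 0" if "j \<in> ?P" for j
  proof -
    have "Q (2 *s z j) = Q (z j) + Q (z j) + B (z j) (z j)"
      using Q_add'[of "z j" "z j"] by (metis one_add_one vec.scale_left_distrib vec.scale_one)
    then show ?thesis using Qz[OF that] by (simp add: Q_scale')
  qed
  have zz: "B (z j) (z l) = 0" if "j \<in> ?P" "l \<in> ?P" for j l
    using zz1[of j l] zz1[of l j] zz0 that B_comm[of "z j" "z l"] by (cases j l rule: linorder_cases) auto
  define w where "w i = (if i > 0 then b i else z (- i))" for i
  have "hyperbolic_basis w"
    unfolding hyperbolic_basis_def
  proof (intro conjI ballI)
    fix i assume i: "i \<in> I" then show "Q (w i) = 0"
      by (auto simp: w_def bb(2)[of i i] Qz I_iff)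
    fix j assume j: "j \<in> I"
    consider "i > 0" "j > 0" | "i > 0" "j < 0" | "i < 0" "j > 0" | "i < 0" "j < 0"
      using i j by (force simp: I_iff)
    then show "B (w i) (w j) = (if j = - i then 1 else 0)"
      using i j by cases (auto simp: w_def I_iff bb bz zz B_comm[of "z (- i)" "b j"])
  qed
  then show ?thesis by (intro exI[of _ w]) (auto simp: w_def)
qed

lemma hyp_isometry:
  assumes w: "hyperbolic_basis w"
  obtains h where "Vector_Spaces.linear (*s) (*s) h" "bij h" "\<And>x. Q (h x) = Q x"
    "\<And>i. i \<in> I \<Longrightarrow> h (v i) = w i"
proof -
  define h where "h x = (\<Sum>i\<in>I. B x (v (- i)) *s w i)" for x
  have wB: "B (w i) (w j) = (if j = - i then 1 else 0)" and wQ: "Q (w i) = 0" if "i \<in> I" "j \<in> I" for i j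
    using w that unfolding hyperbolic_basis_def by blast+
  have add: "h (x + y) = h x + h y" for x y
    by (simp add: h_def B_lin sum.distrib[symmetric] vec.scale_left_distrib)
  have scale: "h (c *s x) = c *s h x" for c x
    by (simp add: h_def B_lin vec.scale_sum_right vec.scale_scale)
  have lin: "Vector_Spaces.linear (*s) (*s) h"
    by unfold_locales (simp_all add: add scale)
  have hv: "h (v i) = w i" if i: "i \<in> I" for i
  proof -
    have "h (v i) = (\<Sum>j\<in>I. if j = i then w i else 0)"
      unfolding h_def using i by (intro sum.cong) (auto simp: hyp_B)
    then show ?thesis using i by simp
  qed
  have hB: "B (h x) (w (- j)) = B x (v (- j))" if j: "j \<in> I" for x j
  proof -
    have "B (h x) (w (- j)) = (\<Sum>i\<in>I. if i = j then B x (v (- j)) else 0)"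
      unfolding h_def B_sum_left using j by (intro sum.cong) (auto simp: B_lin wB)
    then show ?thesis using j by simp
  qed
  have hBB: "B (h x) (h y) = B x y" for x y
  proof -
    have "B (h x) (h y) = (\<Sum>i\<in>I. B y (v (- i)) * B (h x) (w i))"
      by (subst (2) h_def) (simp add: B_sum_right B_lin)
    also have "\<dots> = (\<Sum>i\<in>I. B y (v (- i)) * B x (v i))"
      using hB[of "- _"] by (intro sum.cong) auto
    also have "\<dots> = B x (\<Sum>i\<in>I. B y (v (- i)) *s v i)" by (simp add: B_sum_right B_lin)
    also have "\<dots> = B x y" using hyp_expand[of y] by simp
    finally show ?thesis .
  qed
  have Qh: "Q (h x) = Q x" for x
  proof -
    \<comment> \<open>Once \<open>h\<close> is known to preserve \<open>B\<close>, the vectors at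
      which it preserves \<open>Q\<close> form a subspace, and basis vectors suffice.\<close>
    have "vec.subspace {x. Q (h x) = Q x}"
      by (rule vec.subspaceI)
        (auto simp: add scale Q_add' Q_scale' hBB vec.linear_0[OF lin])
    moreover have "v ` I \<subseteq> {x. Q (h x) = Q x}" using hv wQ by auto
    ultimately have "bspan v I \<subseteq> {x. Q (h x) = Q x}" unfolding bspan_def by (intro vec.span_minimal)
    then show ?thesis using bspan_I by auto
  qed
  have "inj h"
  proof (rule injI)
    fix x y assume "h x = h y"
    then have "B x (v (- i)) = B y (v (- i))" if "i \<in> I" for i using hB[OF that] by metis
    then have "(\<Sum>i\<in>I. B x (v (- i)) *s v i) = (\<Sum>i\<in>I. B y (v (- i)) *s v i)" by (intro sum.cong) auto
    then show "x = y" using hyp_expand[of x] hyp_expand[of y] by simp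
  qed
  then have "bij h" by (simp add: bij_def finite_UNIV_inj_surj)
  then show ?thesis using that[OF lin _ Qh hv] by blast
qed

end

end

section \<open>The two classes of generators\<close>

lemma vec_span_subspace: "vec.subspace S \<Longrightarrow> vec.span S = S" for S :: "('a::field ^ 'm) set"
  by (simp add: vec.span_eq_iff)

lemma hyperplane_span:
  fixes N :: "('a::field ^ 'm) set"
  assumes "vec.subspace N" "vec.subspace H" "H \<subseteq> N" "vec.dim N = vec.dim H + 1" "x \<in> N" "x \<notin> H"
  shows "N = vec.span (insert x H)" "y \<in> N \<Longrightarrow> \<exists>c. y - c *s x \<in> H"
proof -
  have sH: "vec.span H = H" using assms(2) by (rule vec_span_subspace)
  have "vec.dim (vec.span (insert x H)) = vec.dim H + 1"
    using assms(6) by (simp add: vec.dim_insert sH)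
  then have "vec.span (insert x H) = N"
    using assms by (intro vec.subspace_dim_equal) (auto dest: vec.span_minimal[of "insert x H" N, rotated])
  then show "N = vec.span (insert x H)" by simp
  then show "y \<in> N \<Longrightarrow> \<exists>c. y - c *s x \<in> H"
    using vec.span_breakdown_eq[of y x H] by (simp add: sH)
qed

text \<open>\<open>v0\<close> is a reference basis: the span of \<open>v0 1, ..., v0 n\<close> fixes
  which of the two classes of generators counts as the first.\<close>

locale hyperbolic_quadric = quadric n Q
  for n :: nat and Q :: "'a::{field,finite} ^ 'm \<Rightarrow> 'a" +
  fixes v0 :: "int \<Rightarrow> 'a ^ 'm"
  assumes hyp0: "hyperbolic_basis v0" and n4: "n \<ge> 4"
begin

lemma n1: "n \<ge> 1" using n4 by simp

lemma genD:
  assumes "N \<in> generators n Q"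
  shows "vec.subspace N" "vec.dim N = n" "\<And>x. x \<in> N \<Longrightarrow> Q x = 0" "\<And>x y. x \<in> N \<Longrightarrow> y \<in> N \<Longrightarrow> B x y = 0"
proof -
  have ts: "totally_singular Q N" using assms by (auto simp: generators_def)
  then show "vec.subspace N" "\<And>x. x \<in> N \<Longrightarrow> Q x = 0" by (auto simp: totally_singular_def)
  show "\<And>x y. x \<in> N \<Longrightarrow> y \<in> N \<Longrightarrow> B x y = 0" using totally_singular_polar[OF qf ts] by blast
  show "vec.dim N = n" using assms by (simp add: generators_def)
qed

lemma generator_hyperbolic_basis:
  assumes N: "N \<in> generators n Q"
  obtains v where "hyperbolic_basis v" "N = bspan v {1..int n}"
proof -
  obtain S where S: "finite S" "vec.independent S" "vec.span S = N" "card S = n"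
    using vec.basis_subspace_exists[OF genD(1)[OF N]] genD(2)[OF N] by metis
  obtain b where b: "bij_betw b {1..int n} S"
    using finite_same_card_bij[of "{1..int n}" S] S by auto
  have bS: "b ` {1..int n} = S" "inj_on b {1..int n}" using b by (auto simp: bij_betw_def)
  have "totally_singular Q (bspan b {1..int n})"
    using N S by (simp add: bspan_def bS generators_def)
  then obtain v where v: "hyperbolic_basis v" "\<forall>i\<in>{1..int n}. v i = b i"
    using hyperbolic_completion[OF hyp0 n1, of b] S bS by auto
  have "v ` {1..int n} = S" using v(2) bS(1) by (metis image_cong)
  then have "bspan v {1..int n} = N" using S by (simp add: bspan_def)
  then show ?thesis using that v(1) by blast
qed

text \<open>In a hyperbolic basis adapted to \<open>N\<close>, the perp of \<open>N\<close> is
  spanned by the same indices as \<open>N\<close>.\<close>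

lemma gen_perp:
  assumes N: "N \<in> generators n Q" and x: "\<And>y. y \<in> N \<Longrightarrow> B x y = 0"
  shows "x \<in> N"
proof -
  obtain v where v: "hyperbolic_basis v" "N = bspan v {1..int n}"
    using generator_hyperbolic_basis[OF N] .
  have "{1..int n} \<subseteq> I" by (auto simp: I_iff)
  from bspan_perp[OF v(1) this] have "x \<in> bspan v {i \<in> I. - i \<notin> {1..int n}}" using x v(2) by auto
  also have "{i \<in> I. - i \<notin> {1..int n}} = {1..int n}" by (auto simp: I_iff)
  finally show ?thesis using v(2) by simp
qed

section \<open>Generators that meet in a hyperplane\<close>

context
  fixes N1 N2
  assumes N1: "N1 \<in> generators n Q" and N2: "N2 \<in> generators n Q" and adj: "vec.dim (N1 \<inter> N2) = n - 1"
begin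

lemma adjacent_hyperplane:
  assumes "x \<in> N1" "x \<notin> N2" "y \<in> N1" shows "\<exists>c. y - c *s x \<in> N1 \<inter> N2"
proof (rule hyperplane_span(2))
  show "vec.dim N1 = vec.dim (N1 \<inter> N2) + 1" using adj n1 genD(2)[OF N1] by simp
qed (use assms genD(1)[OF N1] genD(1)[OF N2] in \<open>auto simp: vec.subspace_inter\<close>)

lemma adjacent_perp:
  assumes x: "x \<in> N1" "x \<notin> N2" and z: "\<And>h. h \<in> N1 \<inter> N2 \<Longrightarrow> B z h = 0" "B z x = 0"
  shows "z \<in> N1"
proof (rule gen_perp[OF N1])
  fix y assume "y \<in> N1"
  then obtain c where "y - c *s x \<in> N1 \<inter> N2" using adjacent_hyperplane x by blast
  then have "B z (y - c *s x) = 0" using z(1) by blast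
  then show "B z y = 0" using z(2) by (simp add: B_lin)
qed

end

text \<open>The perp of \<open>N1 \<inter> N2\<close> is a hyperbolic plane modulo
  \<open>N1 \<inter> N2\<close>, and such a plane has just two singular lines.\<close>

lemma adjacent_cover:
  assumes N1: "N1 \<in> generators n Q" and N2: "N2 \<in> generators n Q" and adj: "vec.dim (N1 \<inter> N2) = n - 1"
    and z: "Q z = 0" "\<And>h. h \<in> N1 \<inter> N2 \<Longrightarrow> B z h = 0"
  shows "z \<in> N1 \<union> N2"
proof (rule ccontr)
  assume nz: "z \<notin> N1 \<union> N2"
  have adj': "vec.dim (N2 \<inter> N1) = n - 1" using adj by (simp add: Int_commute)
  have ex: "\<exists>x. x \<in> M \<and> x \<notin> M'" if "M \<in> generators n Q" "M' \<in> generators n Q" "vec.dim (M \<inter> M') = n - 1" for M M'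
  proof (rule ccontr)
    assume "\<nexists>x. x \<in> M \<and> x \<notin> M'"
    then have "M \<inter> M' = M" by blast
    then show False using that genD(2)[OF that(1)] n1 by simp
  qed
  obtain x1 where x1: "x1 \<in> N1" "x1 \<notin> N2" using ex[OF N1 N2 adj] by blast
  obtain x2 where x2: "x2 \<in> N2" "x2 \<notin> N1" using ex[OF N2 N1 adj'] by blast
  define k where "k = B x1 x2"
  have H1: "B h x1 = 0" "B x1 h = 0" "B h x2 = 0" "B x2 h = 0" "Q h = 0" if "h \<in> N1 \<inter> N2" for h
    using that genD(3,4)[OF N1] genD(3,4)[OF N2] x1(1) x2(1) by auto
  have k: "k \<noteq> 0"
  proof
    assume "k = 0"
    then have "x2 \<in> N1" using H1 by (intro adjacent_perp[OF N1 N2 adj x1]) (auto simp: k_def B_comm[of x2])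
    then show False using x2 by simp
  qed
  have z1: "B z x1 \<noteq> 0" using adjacent_perp[OF N1 N2 adj x1, of z] z(2) nz by auto
  have z2: "B z x2 \<noteq> 0" using adjacent_perp[OF N2 N1 adj' x2, of z] z(2) nz by auto
  define a where "a = B z x2 / k"
  define b where "b = B z x1 / k"
  \<comment> \<open>Removing the components along \<open>x1\<close> and \<open>x2\<close> leaves a
    vector perpendicular to both generators, hence in their intersection; this gives
    \<open>Q z = a * b * k\<close>.\<close>
  define w where "w = z - a *s x1 - b *s x2"
  have 11: "B x1 x1 = 0" "B x2 x2 = 0" "B x2 x1 = k" using genD(4)[OF N1] genD(4)[OF N2] x1 x2 by (auto simp: k_def B_comm)
  have w: "B w x1 = 0" "B w x2 = 0" "\<And>h. h \<in> N1 \<inter> N2 \<Longrightarrow> B w h = 0"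
    using k z(2) H1 11 by (auto simp: w_def B_lin a_def b_def k_def[symmetric])
  have "w \<in> N1" using adjacent_perp[OF N1 N2 adj x1 w(3,1)] by blast
  moreover have "w \<in> N2" using adjacent_perp[OF N2 N1 adj' x2 _ w(2)] w(3) by blast
  ultimately have wH: "w \<in> N1 \<inter> N2" by blast
  have "z = w + (a *s x1 + b *s x2)" by (simp add: w_def)
  then have "Q z = Q w + (Q (a *s x1) + Q (b *s x2) + B (a *s x1) (b *s x2)) + B w (a *s x1 + b *s x2)"
    by (metis Q_add')
  also have "\<dots> = a * b * k"
    using H1[OF wH] w genD(3)[OF N1 x1(1)] genD(3)[OF N2 x2(1)]
    by (simp add: Q_scale' B_lin k_def[symmetric])
  finally show False using z(1) z1 z2 k by (simp add: a_def b_def)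
qed

text \<open>\<open>N2 \<inter> N3\<close> is perpendicular to \<open>m\<close> and to
  \<open>N1 \<inter> N2\<close>, which together span \<open>N1\<close>. It therefore lies in
  \<open>N1\<close>, and \<open>m\<close> accounts for the one extra dimension.\<close>

lemma adjacent_meet:
  assumes N: "N1 \<in> generators n Q" "N2 \<in> generators n Q" "N3 \<in> generators n Q"
    and adj: "vec.dim (N1 \<inter> N2) = n - 1" and m: "m \<in> N3" "m \<in> N1" "m \<notin> N2"
  shows "vec.dim (N1 \<inter> N3) = vec.dim (N2 \<inter> N3) + 1"
proof -
  let ?D = "N1 \<inter> N2 \<inter> N3"
  have sub: "vec.subspace N1" "vec.subspace N2" "vec.subspace N3" using genD(1) N by blast+
  have adj': "vec.dim (N2 \<inter> N1) = n - 1" using adj by (simp add: Int_commute)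
  have "N2 \<inter> N3 \<subseteq> N1"
  proof
    fix y assume y: "y \<in> N2 \<inter> N3"
    show "y \<in> N1"
      using y m genD(4)[OF N(2)] genD(4)[OF N(3)] by (intro adjacent_perp[OF N(1,2) adj m(2,3)]) auto
  qed
  then have 1: "N2 \<inter> N3 = ?D" by blast
  have sD: "vec.subspace ?D" using sub by (intro vec.subspace_inter)
  have "N1 \<inter> N3 = vec.span (insert m ?D)"
  proof
    show "vec.span (insert m ?D) \<subseteq> N1 \<inter> N3"
      using m sub by (intro vec.span_minimal vec.subspace_inter) auto
    show "N1 \<inter> N3 \<subseteq> vec.span (insert m ?D)"
    proof
      fix y assume y: "y \<in> N1 \<inter> N3"
      then obtain c where c: "y - c *s m \<in> N1 \<inter> N2" using adjacent_hyperplane[OF N(1,2) adj m(2,3)] by blast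
      moreover have "y - c *s m \<in> N3" using y m(1) sub(3) by (simp add: vec.subspace_diff vec.subspace_scale)
      ultimately show "y \<in> vec.span (insert m ?D)"
        by (subst vec.span_breakdown_eq) (auto intro!: vec.span_base)
    qed
  qed
  moreover have "vec.dim (vec.span (insert m ?D)) = vec.dim ?D + 1"
    using m(3) sD by (simp add: vec.dim_insert vec_span_subspace)
  ultimately show ?thesis using 1 by simp
qed

text \<open>By \<open>adjacent_meet\<close> it is enough to find a vector of \<open>N3\<close> in
  exactly one of \<open>N1\<close> and \<open>N2\<close>.\<close>

lemma adjacent_parity:
  assumes N: "N1 \<in> generators n Q" "N2 \<in> generators n Q" "N3 \<in> generators n Q"
    and adj: "vec.dim (N1 \<inter> N2) = n - 1"
  shows "odd (vec.dim (N1 \<inter> N3) + vec.dim (N2 \<inter> N3))"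
proof -
  have adj': "vec.dim (N2 \<inter> N1) = n - 1" using adj by (simp add: Int_commute)
  have sub: "vec.subspace N1" "vec.subspace N2" "vec.subspace N3" using genD(1) N by blast+
  have "\<exists>m. m \<in> N3 \<and> (m \<in> N1 \<and> m \<notin> N2 \<or> m \<in> N2 \<and> m \<notin> N1)"
  proof -
    have "N1 \<inter> N2 \<noteq> N1" using adj genD(2)[OF N(1)] n1 by auto
    then obtain x where x: "x \<in> N1" "x \<notin> N2" by blast
    let ?Z = "{a + b |a b. a \<in> N3 \<and> b \<in> N1 \<inter> N2}"
    have Z: "vec.subspace ?Z" using sub by (intro vec.subspace_sums vec.subspace_inter)
    show ?thesis
    proof (cases "x \<in> ?Z")
      case True
      then obtain a b where ab: "x = a + b" "a \<in> N3" "b \<in> N1" "b \<in> N2" by blast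
      have "a = x - b" using ab by simp
      then have "a \<in> N1" using x(1) ab(3) vec.subspace_diff[OF sub(1)] by blast
      moreover have "a \<notin> N2" using ab x sub by (auto simp: vec.subspace_add)
      ultimately show ?thesis using ab by blast
    next
      case False
      \<comment> \<open>Being perpendicular to \<open>N3\<close>, this \<open>y\<close> lies in
        \<open>N3\<close>; being perpendicular to \<open>N1 \<inter> N2\<close>, it lies in
        \<open>N1\<close> or \<open>N2\<close> by \<open>adjacent_cover\<close>, and
        \<open>B x y \<noteq> 0\<close> excludes \<open>N1\<close>.\<close>
      obtain y where y: "\<And>u. u \<in> ?Z \<Longrightarrow> B u y = 0" "B x y \<noteq> 0"
        using perp_separates[OF hyp0 n1 Z False] by blast
      have yu: "B y u = 0" if "u \<in> N3 \<or> u \<in> N1 \<inter> N2" for u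
      proof -
        have "u + 0 \<in> ?Z \<or> 0 + u \<in> ?Z"
          using that sub by (blast intro: vec.subspace_0)
        then have "u \<in> ?Z" by simp
        then show ?thesis using y(1) by (simp add: B_comm)
      qed
      have "y \<in> N3" using gen_perp[OF N(3)] yu by blast
      moreover have "y \<in> N1 \<union> N2"
        using adjacent_cover[OF N(1,2) adj] genD(3)[OF N(3) \<open>y \<in> N3\<close>] yu by blast
      moreover have "y \<notin> N1" using genD(4)[OF N(1) x(1)] y(2) by blast
      ultimately show ?thesis by blast
    qed
  qed
  then show ?thesis
    using adjacent_meet[OF N adj] adjacent_meet[OF N(2,1,3) adj'] by auto
qed

text \<open>The step from \<open>N\<close> to a neighbouring generator through a prescribed singular
  vector: keep the hyperplane of \<open>N\<close> perpendicular to \<open>x\<close> and add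
  \<open>x\<close>.\<close>

lemma exchange_generator:
  assumes N: "N \<in> generators n Q" and x: "Q x = 0" "x \<notin> N"
  defines "H \<equiv> {y \<in> N. B y x = 0}"
  shows "vec.subspace H" "vec.dim H = n - 1" "vec.span (insert x H) \<in> generators n Q"
proof -
  have s: "vec.subspace N" using genD(1)[OF N] .
  show sH: "vec.subspace H" using s unfolding H_def
    by (intro vec.subspaceI) (auto simp: B_lin vec.subspace_0 vec.subspace_add vec.subspace_scale)
  obtain b where b: "b \<in> N" "B x b \<noteq> 0" using gen_perp[OF N, of x] x(2) by blast
  have dN: "vec.dim N = n" using genD(2)[OF N] .
  have "N = vec.span (insert b H)"
  proof
    show "vec.span (insert b H) \<subseteq> N" using b s by (intro vec.span_minimal) (auto simp: H_def)
    show "N \<subseteq> vec.span (insert b H)"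
    proof
      fix y assume y: "y \<in> N"
      have "y - (B y x / B b x) *s b \<in> H"
        using y b s by (auto simp: H_def B_lin B_comm[of b] vec.subspace_diff vec.subspace_scale)
      then show "y \<in> vec.span (insert b H)"
        by (subst vec.span_breakdown_eq) (auto intro!: vec.span_base)
    qed
  qed
  moreover have "b \<notin> H" using b by (auto simp: H_def B_comm)
  ultimately show dH: "vec.dim H = n - 1"
    using dN sH by (simp add: vec.dim_insert vec_span_subspace)
  have "x \<notin> H" using x by (auto simp: H_def)
  then have dN2: "vec.dim (vec.span (insert x H)) = n" using sH dH n1 by (simp add: vec.dim_insert vec_span_subspace)
  have xx: "B x x = 0"
  proof -
    have "Q (2 *s x) = Q x + Q x + B x x"
      using Q_add'[of x x] by (metis one_add_one vec.scale_left_distrib vec.scale_one)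
    then show ?thesis using x(1) by (simp add: Q_scale')
  qed
  have "totally_singular Q (vec.span (insert x H))"
  proof (rule span_totally_singular[OF qf])
    show "Q s = 0" if "s \<in> insert x H" for s
      using that x(1) genD(3)[OF N] by (auto simp: H_def)
    show "B s t = 0" if "s \<in> insert x H" "t \<in> insert x H" for s t
    proof -
      have "B h x = 0" "B x h = 0" if "h \<in> H" for h
        using that B_comm[of x h] by (auto simp: H_def)
      moreover have "B h h' = 0" if "h \<in> H" "h' \<in> H" for h h'
        using that genD(4)[OF N] by (simp add: H_def)
      ultimately show ?thesis using that xx by blast
    qed
  qed
  then show "vec.span (insert x H) \<in> generators n Q" using dN2 by (simp add: generators_def)
qed

text \<open>This expresses by one parity that being in the same class is an equivalence relation
  with at most two classes. Exchanging \<open>N\<close> towards a vector of \<open>N'\<close>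
  changes the parity of \<open>dim (N \<inter> N3)\<close>, raises
  \<open>dim (N \<inter> N')\<close> by one and keeps the third dimension.\<close>

lemma generator_parity:
  assumes N: "N \<in> generators n Q" "N' \<in> generators n Q" "N3 \<in> generators n Q"
  shows "even (vec.dim (N \<inter> N3) + vec.dim (N' \<inter> N3) + vec.dim (N \<inter> N') + n)"
  using N(1)
proof (induction "n - vec.dim (N \<inter> N')" arbitrary: N)
  case 0
  have s: "vec.subspace N" "vec.subspace N'" using 0 genD(1) N by blast+
  have "n \<le> vec.dim (N \<inter> N')" using 0 by simp
  then have "N \<inter> N' = N" "N \<inter> N' = N'"
    using s genD(2)[OF 0(2)] genD(2)[OF N(2)] by (intro vec.subspace_dim_equal vec.subspace_inter; simp)+
  then have "N = N'" by simp
  then show ?case using genD(2)[OF N(2)] by simp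
next
  case (Suc k)
  let ?D = "N \<inter> N'"
  have s: "vec.subspace N" "vec.subspace N'" using Suc genD(1) N by blast+
  have "\<not> N' \<subseteq> N"
  proof
    assume "N' \<subseteq> N"
    then have "?D = N'" by blast
    then show False using Suc(2) genD(2)[OF N(2)] by simp
  qed
  then obtain x where x: "x \<in> N'" "x \<notin> N" by blast
  define H where "H = {y \<in> N. B y x = 0}"
  have Qx: "Q x = 0" using genD(3)[OF N(2) x(1)] .
  note ex = exchange_generator[OF Suc(3) Qx x(2), folded H_def]
  note sH = ex(1) and dH = ex(2)
  define N2 where "N2 = vec.span (insert x H)"
  have N2: "N2 \<in> generators n Q" using ex(3) by (simp add: N2_def)
  have inter: "vec.span (insert x H) \<inter> U = vec.span (insert x (H \<inter> U))" if "vec.subspace U" "x \<in> U" for U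
  proof
    show "vec.span (insert x (H \<inter> U)) \<subseteq> vec.span (insert x H) \<inter> U"
      using that vec.span_mono[of "insert x (H \<inter> U)" "insert x H"]
        vec.span_minimal[of "insert x (H \<inter> U)" U] by blast
    show "vec.span (insert x H) \<inter> U \<subseteq> vec.span (insert x (H \<inter> U))"
    proof
      fix y assume y: "y \<in> vec.span (insert x H) \<inter> U"
      then obtain c where c: "y - c *s x \<in> H"
        using sH by (auto simp: vec.span_breakdown_eq vec_span_subspace)
      then have "y - c *s x \<in> H \<inter> U" using y that by (simp add: vec.subspace_diff vec.subspace_scale)
      then show "y \<in> vec.span (insert x (H \<inter> U))"
        by (subst vec.span_breakdown_eq) (auto intro!: vec.span_base)
    qed
  qed
  have "H \<inter> N' = ?D" using genD(4)[OF N(2)] x by (auto simp: H_def)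
  then have "N2 \<inter> N' = vec.span (insert x ?D)" using inter[OF s(2) x(1)] by (simp add: N2_def)
  moreover have "vec.span ?D = ?D" using s by (simp add: vec_span_subspace vec.subspace_inter)
  then have "x \<notin> vec.span ?D" using x(2) by (metis IntD1)
  ultimately have d2: "vec.dim (N2 \<inter> N') = vec.dim ?D + 1" by (simp add: vec.dim_insert)
  have "N2 \<inter> N = H"
  proof
    show "H \<subseteq> N2 \<inter> N" by (auto simp: N2_def H_def intro: vec.span_base)
    show "N2 \<inter> N \<subseteq> H"
    proof
      fix y assume y: "y \<in> N2 \<inter> N"
      then obtain c where c: "y - c *s x \<in> H"
        using sH by (auto simp: N2_def vec.span_breakdown_eq vec_span_subspace)
      have "y \<in> N" "y - c *s x \<in> N" using y c by (auto simp: H_def)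
      from vec.subspace_diff[OF s(1) this] have "c *s x \<in> N" by simp
      have "c = 0"
      proof (rule ccontr)
        assume "c \<noteq> 0"
        then have "x = inverse c *s (c *s x)" by simp
        also have "\<dots> \<in> N" using \<open>c *s x \<in> N\<close> s(1) by (rule vec.subspace_scale[rotated])
        finally show False using x by simp
      qed
      then show "y \<in> H" using c by simp
    qed
  qed
  then have "vec.dim (N2 \<inter> N) = n - 1" using dH by simp
  then have "odd (vec.dim (N2 \<inter> N3) + vec.dim (N \<inter> N3))"
    using adjacent_parity[OF N2 Suc(3) N(3)] by simp
  moreover have "even (vec.dim (N2 \<inter> N3) + vec.dim (N' \<inter> N3) + vec.dim (N2 \<inter> N') + n)"
    using Suc(1)[OF _ N2] Suc(2) d2 by simp
  ultimately show ?case by (auto simp: d2)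
qed

lemma same_class_iff:
  assumes "N \<in> generators n Q" "N' \<in> generators n Q" "N3 \<in> generators n Q"
  shows "same_class n N N3 \<longleftrightarrow> (same_class n N' N3 \<longleftrightarrow> same_class n N N')"
  using generator_parity[OF assms] unfolding same_class_def by (auto simp: mod_2_eq_odd)

end

section \<open>Chambers\<close>

lemma vec_span_UN_span: "vec.span (\<Union>i\<in>A. vec.span {v i}) = vec.span (v ` A)"
  for v :: "'i \<Rightarrow> 'a::field ^ 'm"
proof -
  have "vec.span {v i} \<subseteq> vec.span (v ` A)" if "i \<in> A" for i
    using that by (intro vec.span_mono) auto
  moreover have "v i \<in> vec.span (\<Union>i\<in>A. vec.span {v i})" if "i \<in> A" for i
    using that by (intro vec.span_base) (auto intro: vec.span_base)
  ultimately show ?thesis unfolding vec.span_eq by auto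
qed

text \<open>Signs of \<open>a\<close> and \<open>b\<close> are arbitrary, so that the
  \<open>s_k\<close> and \<open>u\<close> are instances of one formula and need no separate
  calculations.\<close>

definition signed_swap :: "int \<Rightarrow> int \<Rightarrow> int \<Rightarrow> int" where
  "signed_swap a b x = (if x = a then b else if x = b then a else if x = - a then - b else if x = - b then - a else x)"

text \<open>The generators of the Weyl group are numbered from \<open>1\<close> to \<open>n\<close>, the last one being \<open>u\<close>. The
  \<open>k\<close>-th one is the reflection in the root \<open>e\<^sub>a - e\<^sub>b\<close> where \<open>a\<close> is \<open>root_fst n k\<close> and \<open>b\<close> is
  \<open>root_snd n k\<close> (with \<open>e\<^sub>-\<^sub>i = - e\<^sub>i\<close>).\<close>

definition sigma :: "nat \<Rightarrow> nat \<Rightarrow> int \<Rightarrow> int" where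
  "sigma n k = (if k < n then refl_s k else refl_u n)"

definition root_fst :: "nat \<Rightarrow> nat \<Rightarrow> int" where
  "root_fst n k = int (if k < n then k else n - 1)"

definition root_snd :: "nat \<Rightarrow> nat \<Rightarrow> int" where
  "root_snd n k = (if k < n then int k + 1 else - int n)"

text \<open>Positions in the order \<open>1, \<dots>, n, -n, \<dots>, -1\<close>.\<close>

definition rank :: "nat \<Rightarrow> int \<Rightarrow> int" where
  "rank n i = (if i > 0 then i else 2 * int n + 1 + i)"

definition twist :: "nat \<Rightarrow> int \<Rightarrow> int" where
  "twist n = Transposition.transpose (- int n) (int n)"

text \<open>This is the group of type B, in which the Weyl group of type D has index two. Membership
  in the latter is not stated through generators; it is enforced by requiring both \<open>v\<close>
  and \<open>v \<circ> w\<close> to be \<open>oriented\<close>.\<close>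

definition signed_perm :: "nat \<Rightarrow> (int \<Rightarrow> int) \<Rightarrow> bool" where
  "signed_perm n w \<longleftrightarrow> bij_betw w (frame_indices n) (frame_indices n) \<and>
     (\<forall>i\<in>frame_indices n. w (- i) = - w i)"

lemma sigma_eq_signed_swap:
  assumes "n \<ge> 2" "k \<in> {1..n}"
  shows "sigma n k = signed_swap (root_fst n k) (root_snd n k)"
proof
  fix x
  show "sigma n k x = signed_swap (root_fst n k) (root_snd n k) x"
  proof (cases "k < n")
    case True
    then show ?thesis using assms
      by (auto simp: sigma_def signed_swap_def root_fst_def root_snd_def refl_s_def Transposition.transpose_def)
  next
    case False
    obtain m where m: "n = Suc m" "m \<ge> 1" using assms(1) by (cases n) auto
    show ?thesis using False assms m
      by (auto simp: sigma_def signed_swap_def root_fst_def root_snd_def refl_u_def refl_s_def Let_def Transposition.transpose_def)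
  qed
qed

lemma signed_swap_signed_swap: "a \<noteq> b \<Longrightarrow> a \<noteq> - b \<Longrightarrow> a \<noteq> 0 \<Longrightarrow> b \<noteq> 0 \<Longrightarrow> signed_swap a b (signed_swap a b x) = x"
  by (auto simp: signed_swap_def)

lemma signed_perm_signed_swap:
  assumes "a \<in> frame_indices n" "b \<in> frame_indices n" "a \<noteq> b" "a \<noteq> - b"
  shows "signed_perm n (signed_swap a b)"
proof -
  have "a \<noteq> 0" "b \<noteq> 0" using assms by (auto simp: frame_indices_def)
  then have 1: "signed_swap a b (signed_swap a b x) = x" for x using signed_swap_signed_swap assms by blast
  have 2: "signed_swap a b x \<in> frame_indices n" if "x \<in> frame_indices n" for x
    using that assms by (auto simp: signed_swap_def frame_indices_def)
  have "bij_betw (signed_swap a b) (frame_indices n) (frame_indices n)"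
    by (rule bij_betwI[of _ _ _ "signed_swap a b"]) (auto simp: 1 2)
  then show ?thesis using assms \<open>a \<noteq> 0\<close> \<open>b \<noteq> 0\<close> unfolding signed_perm_def by (auto simp: signed_swap_def)
qed

lemma roots_in:
  assumes "n \<ge> 2" "k \<in> {1..n}"
  shows "root_fst n k \<in> frame_indices n" "root_snd n k \<in> frame_indices n"
    "root_fst n k \<noteq> root_snd n k" "root_fst n k \<noteq> - root_snd n k"
  using assms by (auto simp: root_fst_def root_snd_def frame_indices_def)

lemma signed_perm_sigma: "n \<ge> 2 \<Longrightarrow> k \<in> {1..n} \<Longrightarrow> signed_perm n (sigma n k)"
  by (simp add: sigma_eq_signed_swap signed_perm_signed_swap roots_in)

lemma sigma_sigma: 
  assumes "n \<ge> 2" "k \<in> {1..n}" shows "sigma n k (sigma n k x) = x"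
proof -
  note r = roots_in[OF assms]
  then have "root_fst n k \<noteq> 0" "root_snd n k \<noteq> 0" by (auto simp: frame_indices_def)
  then show ?thesis using r assms by (simp add: sigma_eq_signed_swap signed_swap_signed_swap)
qed

lemma twist_twist: "twist n \<circ> twist n = id"
  by (auto simp: twist_def)

lemma twist_eq: "twist n x = (if x = int n then - int n else if x = - int n then int n else x)"
  by (auto simp: twist_def Transposition.transpose_def)

lemma signed_perm_comp: "signed_perm n w \<Longrightarrow> signed_perm n w' \<Longrightarrow> signed_perm n (w \<circ> w')"
  unfolding signed_perm_def by (auto intro: bij_betw_trans dest: bij_betwE)

lemma signed_perm_id: "signed_perm n id" by (simp add: signed_perm_def)

lemma signed_perm_twist: "n \<ge> 1 \<Longrightarrow> signed_perm n (twist n)"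
proof -
  assume "n \<ge> 1"
  have "twist n (twist n x) = x" for x by (auto simp: twist_eq)
  then have "bij_betw (twist n) (frame_indices n) (frame_indices n)"
    using \<open>n \<ge> 1\<close> by (intro bij_betwI[of _ _ _ "twist n"]) (auto simp: twist_eq frame_indices_def)
  then show ?thesis unfolding signed_perm_def by (auto simp: twist_eq frame_indices_def)
qed

lemma signed_permD:
  assumes "signed_perm n w"
  shows "i \<in> frame_indices n \<Longrightarrow> w i \<in> frame_indices n"
    "i \<in> frame_indices n \<Longrightarrow> w (- i) = - w i"
    "i \<in> frame_indices n \<Longrightarrow> j \<in> frame_indices n \<Longrightarrow> w i = w j \<longleftrightarrow> i = j"
    "A \<subseteq> frame_indices n \<Longrightarrow> w ` A \<subseteq> frame_indices n"
    "A \<subseteq> frame_indices n \<Longrightarrow> card (w ` A) = card A"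
  using assms unfolding signed_perm_def bij_betw_def
  by (auto simp: inj_on_eq_iff card_image inj_on_subset)

context hyperbolic_quadric
begin

text \<open>If \<open>a\<close> comes before \<open>b\<close> in the order given by \<open>rank n\<close>, this change of basis fixes the maximal
  flag of \<open>v\<close>.\<close>

definition elation :: "int \<Rightarrow> int \<Rightarrow> 'a \<Rightarrow> (int \<Rightarrow> 'a ^ 'm) \<Rightarrow> int \<Rightarrow> 'a ^ 'm" where
  "elation a b c v = v(b := v b + c *s v a, - a := v (- a) - c *s v (- b))"

definition seg :: "(int \<Rightarrow> 'a ^ 'm) \<Rightarrow> nat \<Rightarrow> ('a ^ 'm) set" where
  "seg v j = bspan v {1..int j}"

definition chamber :: "(int \<Rightarrow> 'a ^ 'm) \<Rightarrow> ('a ^ 'm) set set" where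
  "chamber v = standard_flag n (\<lambda>i. vec.span {v i})"

text \<open>The maximal flag of \<open>v\<close> does not change if \<open>v n\<close> and \<open>v (- n)\<close> are swapped. Orienting the basis
  makes the chain of spans of initial segments a function of the flag, and it distinguishes
  \<open>s\<^sub>n\<^sub>-\<^sub>1\<close> from \<open>u\<close>.\<close>

definition oriented :: "(int \<Rightarrow> 'a ^ 'm) set" where
  "oriented = {v. hyperbolic_basis v \<and> same_class n (seg v n) (seg v0 n)}"

abbreviation "tw \<equiv> twist n"
abbreviation "\<sigma> \<equiv> sigma n"

lemma oriented_hyp: "v \<in> oriented \<Longrightarrow> hyperbolic_basis v" by (simp add: oriented_def)

lemma pos_I: "j \<le> n \<Longrightarrow> {1..int j} \<subseteq> I" by (auto simp: I_iff)

lemma insert_I: "insert (- int n) {1..int n - 1} \<subseteq> I" using n4 by (auto simp: I_iff)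

lemma bspan_comp: "bspan (v \<circ> w) A = bspan v (w ` A)" by (simp add: bspan_def image_comp)

lemma hyp_comp:
  assumes v: "hyperbolic_basis v" and w: "signed_perm n w"
  shows "hyperbolic_basis (v \<circ> w)"
  unfolding hyperbolic_basis_def comp_def
proof (intro conjI ballI)
  fix i assume i: "i \<in> I"
  show "Q (v (w i)) = 0" using hyp_Q[OF v signed_permD(1)[OF w i]] .
  fix j assume j: "j \<in> I"
  have "w j = - w i \<longleftrightarrow> j = - i"
    using signed_permD(2)[OF w i] signed_permD(3)[OF w j, of "- i"] i by simp
  then show "B (v (w i)) (v (w j)) = (if j = - i then 1 else 0)"
    using hyp_B[OF v signed_permD(1)[OF w i] signed_permD(1)[OF w j]] by simp
qed

lemma dim_seg: "hyperbolic_basis v \<Longrightarrow> j \<le> n \<Longrightarrow> vec.dim (seg v j) = j"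
  using dim_bspan[OF _ pos_I] by (simp add: seg_def)

lemma subspace_bspan [simp]: "vec.subspace (bspan v A)" by (simp add: bspan_def vec.subspace_span)

lemma bspan_base: "i \<in> A \<Longrightarrow> v i \<in> bspan v A" by (auto simp: bspan_def intro: vec.span_base)

lemma bspan_mono: "A \<subseteq> A' \<Longrightarrow> bspan v A \<subseteq> bspan v A'" by (auto simp: bspan_def intro!: vec.span_mono)

lemma bspan_insert: "bspan v (insert i A) = vec.span (insert (v i) (v ` A))" by (simp add: bspan_def)

lemma bspan_subset: "(\<And>i. i \<in> A \<Longrightarrow> v i \<in> U) \<Longrightarrow> vec.subspace U \<Longrightarrow> bspan v A \<subseteq> U"
  unfolding bspan_def by (intro vec.span_minimal) auto

lemma bspan_notin: "hyperbolic_basis v \<Longrightarrow> A \<subseteq> I \<Longrightarrow> i \<in> I \<Longrightarrow> v i \<in> bspan v A \<Longrightarrow> i \<in> A"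
  using mem_FS_iff[of v A "v i"] hyp_B[of v i "- i"] by (cases "i \<in> A") auto

text \<open>The other generator of the flag. It meets \<open>seg v n\<close> in
  \<open>seg v (n - 1)\<close>, which belongs to the chain of segments but not to the flag.\<close>

definition twin :: "(int \<Rightarrow> 'a ^ 'm) \<Rightarrow> ('a ^ 'm) set" where
  "twin v = bspan v (insert (- int n) {1..int n - 1})"

lemma chamber_eq: "chamber v = seg v ` {1..n - 2} \<union> {seg v n, twin v}"
proof -
  have "frame_span (\<lambda>i. vec.span {v i}) A = bspan v A" for A
    by (simp add: frame_span_def bspan_def vec_span_UN_span)
  then show ?thesis by (simp add: chamber_def standard_flag_def seg_def twin_def)
qed

lemma seg_gen: "hyperbolic_basis v \<Longrightarrow> seg v n \<in> generators n Q"
  using bspan_totally_singular[OF _ pos_I] dim_seg by (auto simp: generators_def seg_def)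

lemma card_twin: "card (insert (- int n) {1..int n - 1}) = n"
  using n4 by (subst card_insert_disjoint) auto

lemma twin_gen:
  assumes v: "hyperbolic_basis v" shows "twin v \<in> generators n Q"
proof -
  have "totally_singular Q (bspan v (insert (- int n) {1..int n - 1}))"
    using n4 by (intro bspan_totally_singular[OF v insert_I]) auto
  then show ?thesis using dim_bspan[OF v insert_I] card_twin by (auto simp: generators_def twin_def)
qed

lemma seg_Nt_Int: 
  assumes v: "hyperbolic_basis v" shows "seg v n \<inter> twin v = seg v (n - 1)"
proof -
  have *: "{1..int n} \<inter> insert (- int n) {1..int n - 1} = {1..int (n - 1)}" using n4 by auto
  show ?thesis using bspan_Int[OF v pos_I[of n] insert_I] unfolding * by (simp add: seg_def twin_def)
qed

lemma seg_Nt_class: "hyperbolic_basis v \<Longrightarrow> \<not> same_class n (twin v) (seg v n)"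
proof -
  assume v: "hyperbolic_basis v"
  obtain m where "n = Suc m" using n4 by (cases n) auto
  then show ?thesis using seg_Nt_Int[OF v] dim_seg[OF v, of m]
    unfolding same_class_def by (simp add: Int_commute mod_2_eq_odd)
qed

lemma tw_image: "tw ` {1..int n} = insert (- int n) {1..int n - 1}"
  "j < n \<Longrightarrow> tw ` {1..int j} = {1..int j}"
  "tw ` (insert (- int n) {1..int n - 1}) = {1..int n}"
proof -
  have i: "tw ` {1..int j} = {1..int j}" if "j < n" for j
  proof -
    have "tw ` {1..int j} = id ` {1..int j}" using that by (intro image_cong) (auto simp: twist_eq)
    then show ?thesis by simp
  qed
  show "j < n \<Longrightarrow> tw ` {1..int j} = {1..int j}" by (rule i)
  have *: "{1..int n} = insert (int n) {1..int (n - 1)}" using n4 by auto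
  have **: "{1..int n - 1} = {1..int (n - 1)}" using n4 by auto
  have "n - 1 < n" using n4 by simp
  then have ins: "tw ` insert x {1..int (n - 1)} = insert (tw x) {1..int (n - 1)}" for x
    by (simp only: image_insert i)
  show "tw ` {1..int n} = insert (- int n) {1..int n - 1}"
    unfolding * ** ins by (simp add: twist_eq)
  show "tw ` (insert (- int n) {1..int n - 1}) = {1..int n}"
    unfolding * ** ins by (simp add: twist_eq)
qed

lemma seg_tw: "seg (v \<circ> tw) n = twin v" "j < n \<Longrightarrow> seg (v \<circ> tw) j = seg v j" "twin (v \<circ> tw) = seg v n"
  unfolding seg_def twin_def bspan_comp tw_image by (simp_all add: tw_image(2))

lemma hyp_tw: "hyperbolic_basis v \<Longrightarrow> hyperbolic_basis (v \<circ> tw)"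
  using hyp_comp signed_perm_twist n1 by blast

lemma chamber_tw: "chamber (v \<circ> tw) = chamber v"
proof -
  have "seg (v \<circ> tw) ` {1..n - 2} = seg v ` {1..n - 2}" using n4 by (intro image_cong) (auto simp: seg_tw)
  then show ?thesis by (auto simp: chamber_eq seg_tw)
qed

text \<open>The vector \<open>v' (- n)\<close> is singular and perpendicular to
  \<open>seg v (n - 1)\<close>, so \<open>adjacent_cover\<close> places it in \<open>seg v n\<close>
  or \<open>twin v\<close>, and it cannot lie in \<open>seg v n\<close>.\<close>

lemma twin_subset:
  assumes v: "hyperbolic_basis v" "hyperbolic_basis v'" and eq: "\<And>j. j \<le> n \<Longrightarrow> seg v j = seg v' j"
  shows "twin v' \<subseteq> twin v"
  unfolding twin_def[of v']
proof (rule bspan_subset)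
  have n': "int (n - 1) = int n - 1" using n4 by simp
  have U1: "seg v (n - 1) \<subseteq> twin v" using seg_Nt_Int[OF v(1)] by blast
  fix i assume "i \<in> insert (- int n) {1..int n - 1}"
  then consider "i \<in> {1..int n - 1}" | "i = - int n" by blast
  then show "v' i \<in> twin v"
  proof cases
    case 1
    then have "v' i \<in> seg v' (n - 1)" by (simp add: seg_def bspan_base n')
    then show ?thesis using eq[of "n - 1"] U1 by auto
  next
    case 2
    have iI: "i \<in> I" using n4 2 by (auto simp: I_iff)
    have "v' i \<in> seg v n \<union> twin v"
    proof (rule adjacent_cover[OF seg_gen[OF v(1)] twin_gen[OF v(1)]])
      show "vec.dim (seg v n \<inter> twin v) = n - 1" using seg_Nt_Int[OF v(1)] dim_seg[OF v(1)] by simp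
      show "Q (v' i) = 0" using hyp_Q[OF v(2) iI] .
      fix h assume "h \<in> seg v n \<inter> twin v"
      then have "h \<in> seg v' (n - 1)" using seg_Nt_Int[OF v(1)] eq[of "n - 1"] by auto
      then show "B (v' i) h = 0" unfolding seg_def bspan_def n'
      proof (rule perp_span[rotated])
        fix s assume "s \<in> v' ` {1..int n - 1}"
        then show "B (v' i) s = 0" using 2 iI hyp_B[OF v(2) iI] by (auto simp: I_iff)
      qed
    qed
    moreover have "v' i \<notin> seg v n"
    proof
      assume "v' i \<in> seg v n"
      then have "v' i \<in> bspan v' {1..int n}" using eq[of n] by (simp add: seg_def)
      then have "i \<in> {1..int n}" using bspan_notin[OF v(2) pos_I iI] by blast
      then show False using 2 by auto
    qed
    ultimately show ?thesis by blast
  qed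
qed (simp add: twin_def)

lemma twin_cong:
  assumes "hyperbolic_basis v" "hyperbolic_basis v'" "\<And>j. j \<le> n \<Longrightarrow> seg v j = seg v' j"
  shows "twin v = twin v'"
  using twin_subset[of v v'] twin_subset[of v' v] assms by blast

lemma seg_tw_cong:
  assumes v: "hyperbolic_basis v" "hyperbolic_basis v'" and eq: "\<And>j. j \<le> n \<Longrightarrow> seg v j = seg v' j" and j: "j \<le> n"
  shows "seg (v \<circ> tw) j = seg (v' \<circ> tw) j"
  using twin_cong[OF v eq] eq[OF j] j by (cases "j = n") (auto simp: seg_tw)

lemma chamber_cong:
  assumes v: "hyperbolic_basis v" "hyperbolic_basis v'" and eq: "\<And>j. j \<le> n \<Longrightarrow> seg v j = seg v' j"
  shows "chamber v = chamber v'"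
proof -
  have "seg v ` {1..n - 2} = seg v' ` {1..n - 2}" using eq by (intro image_cong) auto
  then show ?thesis using twin_cong[OF v eq] eq[of n] by (simp add: chamber_eq)
qed

lemma chamber_dim_small:
  assumes v: "hyperbolic_basis v" and U: "U \<in> chamber v" "vec.dim U = j" "j \<le> n - 2"
  shows "U = seg v j"
  using U dim_seg[OF v] genD(2)[OF twin_gen[OF v]] n4 by (auto simp: chamber_eq)

lemma chamber_dim_n:
  assumes v: "hyperbolic_basis v" and U: "U \<in> chamber v" "vec.dim U = n"
  shows "U = seg v n \<or> U = twin v"
  using U dim_seg[OF v] n4 by (auto simp: chamber_eq)

text \<open>Small members are recognised by their dimension, and orientation prevents the two
  generators from being mixed up. The segment of dimension \<open>n - 1\<close> is recovered as
  their intersection.\<close>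

lemma chamber_eqD:
  assumes v: "v \<in> oriented" "v' \<in> oriented" and eq: "chamber v = chamber v'"
  shows "j \<le> n \<Longrightarrow> seg v j = seg v' j"
proof -
  have h: "hyperbolic_basis v" "hyperbolic_basis v'" using v oriented_hyp by auto
  have small: "seg v j = seg v' j" if "1 \<le> j" "j \<le> n - 2" for j
  proof -
    have "seg v j \<in> chamber v" using that by (auto simp: chamber_eq)
    then show ?thesis using chamber_dim_small[OF h(2) _ dim_seg[OF h(1), of j]] that eq by auto
  qed
  have n: "seg v n = seg v' n"
  proof -
    have "same_class n (seg v' n) (seg v0 n)" "same_class n (seg v n) (seg v0 n)" using v by (auto simp: oriented_def)
    then have s: "same_class n (seg v n) (seg v' n)"
      using same_class_iff[of "seg v n" "seg v' n" "seg v0 n"] seg_gen h hyp0 by blast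
    have "seg v n \<in> chamber v" by (simp add: chamber_eq)
    then have "seg v n = seg v' n \<or> seg v n = twin v'"
      using chamber_dim_n[OF h(2) _ dim_seg[OF h(1), of n]] eq by simp
    then show ?thesis using s seg_Nt_class[OF h(2)] by metis
  qed
  have "twin v \<noteq> seg v n"
    using seg_Nt_class[OF h(1)] dim_seg[OF h(1), of n] by (metis same_class_def Int_absorb order.refl)
  moreover have "twin v \<in> chamber v" by (simp add: chamber_eq)
  then have "twin v = seg v' n \<or> twin v = twin v'"
    using chamber_dim_n[OF h(2) _ genD(2)[OF twin_gen[OF h(1)]]] eq by simp
  ultimately have "twin v = twin v'" using n by metis
  then have n': "seg v (n - 1) = seg v' (n - 1)" using seg_Nt_Int h n by metis
  assume "j \<le> n"
  then consider "j = 0" | "1 \<le> j" "j \<le> n - 2" | "j = n - 1" | "j = n" by linarith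
  then show "seg v j = seg v' j" using small n n' by cases (auto simp: seg_def bspan_def)
qed

lemma sigma_image:
  assumes "k \<in> {1..<n}" "j \<le> n" "j \<noteq> k"
  shows "\<sigma> k ` {1..int j} = {1..int j}"
proof -
  have s: "\<sigma> k x = signed_swap (int k) (int k + 1) x" for x
    using assms n4 sigma_eq_signed_swap[of n k] by (simp add: root_fst_def root_snd_def)
  have "\<sigma> k x \<in> {1..int j}" if "x \<in> {1..int j}" for x
    using that assms by (auto simp: s signed_swap_def)
  moreover have "\<sigma> k (\<sigma> k x) = x" for x using sigma_sigma[of n k x] assms n4 by auto
  ultimately show ?thesis by (metis (no_types, lifting) image_eqI image_subsetI subsetI subset_antisym)
qed

text \<open>For \<open>k < n\<close> the first \<open>n\<close> vectors span the same space. For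
  \<open>u\<close> two of them are replaced, the intersection has dimension \<open>n - 2\<close>,
  and the class stays the same.\<close>

lemma oriented_sigma:
  assumes v: "v \<in> oriented" and k: "k \<in> {1..n}"
  shows "v \<circ> \<sigma> k \<in> oriented"
proof -
  have h: "hyperbolic_basis v" and h': "hyperbolic_basis (v \<circ> \<sigma> k)"
    using v oriented_hyp hyp_comp signed_perm_sigma[of n k] k n4 by auto
  have "same_class n (seg v n) (seg (v \<circ> \<sigma> k) n)"
  proof (cases "k < n")
    case True
    then have "seg (v \<circ> \<sigma> k) n = seg v n" using k sigma_image[of k n] by (simp add: seg_def bspan_comp)
    then show ?thesis using dim_seg[OF h] by (simp add: same_class_def)
  next
    case False
    then have kn: "k = n" using k by simp
    have s: "\<sigma> n x = signed_swap (int n - 1) (- int n) x" for x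
      using n4 sigma_eq_signed_swap[of n n] by (simp add: root_fst_def root_snd_def of_nat_diff)
    have *: "{1..int n} = insert (int n) (insert (int n - 1) {1..int (n - 2)})" using n4 by auto
    have "\<sigma> n ` {1..int (n - 2)} = id ` {1..int (n - 2)}"
      using n4 by (intro image_cong) (auto simp: s signed_swap_def)
    then have A: "\<sigma> n ` {1..int (n - 2)} = {1..int (n - 2)}" by (simp only: image_id id_apply)
    have "\<sigma> n ` {1..int n} = insert (- (int n - 1)) (insert (- int n) {1..int (n - 2)})"
      unfolding * image_insert A using n4 by (simp add: s signed_swap_def)
    moreover from this have "{1..int n} \<inter> \<sigma> n ` {1..int n} = {1..int (n - 2)}" using n4 by auto
    ultimately have "seg v n \<inter> seg (v \<circ> \<sigma> n) n = seg v (n - 2)"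
      using bspan_Int[OF h pos_I[of n] signed_permD(4)[OF signed_perm_sigma pos_I[of n], of n]] n4
      by (simp add: seg_def bspan_comp)
    then have "vec.dim (seg v n \<inter> seg (v \<circ> \<sigma> n) n) = n - 2" using dim_seg[OF h] by simp
    then show ?thesis unfolding same_class_def kn using n4 by (simp add: mod2_eq_if)
  qed
  moreover have "same_class n (seg v n) (seg v0 n)" using v by (simp add: oriented_def)
  ultimately have "same_class n (seg (v \<circ> \<sigma> k) n) (seg v0 n)"
    using same_class_iff[of "seg v n" "seg (v \<circ> \<sigma> k) n" "seg v0 n"] seg_gen h h' hyp0 by blast
  then show ?thesis using h' by (simp add: oriented_def)
qed

section \<open>Elations and the adjustment of one member of a chain\<close>

lemma hyp_elation:
  assumes v: "hyperbolic_basis v" and ab: "a \<in> I" "b \<in> I" "a \<noteq> b" "a \<noteq> - b"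
  shows "hyperbolic_basis (elation a b c v)"
proof -
  note q = hyp_Q[OF v] and bb = hyp_B[OF v]
  have nz: "a \<noteq> 0" "b \<noteq> 0" using ab by auto
  let ?e = "elation a b c v"
  have e: "?e i = (if i = - a then v (- a) - c *s v (- b) else if i = b then v b + c *s v a else v i)" for i
    by (simp add: elation_def)
  have 1: "Q (?e i) = 0" if "i \<in> I" for i
    using that ab nz by (auto simp: e Q_add' Q_diff Q_scale' q bb B_lin)
  have 2: "B (?e i) (?e j) = (if j = - i then 1 else 0)" if "i \<in> I" "j \<in> I" for i j
  proof -
    have sym: "B (?e i) (?e j) = (if j = - i then 1 else 0)" if "i \<in> I" "j \<in> I" "i = - a" for i j
      using that ab nz by (auto simp: e bb B_lin)
    have sym2: "B (?e i) (?e j) = (if j = - i then 1 else 0)" if "i \<in> I" "j \<in> I" "i = b" "j \<noteq> - a" for i j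
      using that ab nz by (auto simp: e bb B_lin)
    show ?thesis
    proof -
      consider "i = - a" | "i = b" "j \<noteq> - a" | "j = - a" | "j = b" "i \<noteq> - a"
        | "i \<noteq> - a" "i \<noteq> b" "j \<noteq> - a" "j \<noteq> b" by blast
      then show ?thesis
      proof cases
        case 1 then show ?thesis using sym that by blast
      next
        case 2 then show ?thesis using sym2 that by blast
      next
        case 3 then show ?thesis using sym[OF that(2,1)] B_comm[of "?e i" "?e j"] by auto
      next
        case 4 then show ?thesis using sym2[OF that(2,1)] B_comm[of "?e i" "?e j"] by auto
      next
        case 5 then show ?thesis using that by (simp add: e bb)
      qed
    qed
  qed
  show ?thesis unfolding hyperbolic_basis_def using 1 2 by blast
qed

lemma bspan_elation:
  assumes v: "hyperbolic_basis v" and ab: "a \<in> I" "b \<in> I" "a \<noteq> b" "a \<noteq> - b"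
    and A: "A \<subseteq> I" "b \<in> A \<Longrightarrow> a \<in> A" "- a \<in> A \<Longrightarrow> - b \<in> A"
  shows "bspan (elation a b c v) A = bspan v A"
proof (rule vec.subspace_dim_equal)
  show "bspan (elation a b c v) A \<subseteq> bspan v A"
  proof (rule bspan_subset)
    fix i assume i: "i \<in> A"
    show "elation a b c v i \<in> bspan v A"
      using i A(2,3) by (auto simp: elation_def intro!: bspan_base vec.subspace_add vec.subspace_diff vec.subspace_scale)
  qed simp
  show "vec.dim (bspan v A) \<le> vec.dim (bspan (elation a b c v) A)"
    using dim_bspan[OF v A(1)] dim_bspan[OF hyp_elation[OF v ab] A(1)] by simp
qed simp_all

lemma seg_elation:
  assumes v: "hyperbolic_basis v" and ab: "a \<in> I" "b \<in> I" "a \<noteq> - b" "rank n a < rank n b" and j: "j \<le> n"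
  shows "seg (elation a b c v) j = seg v j"
  unfolding seg_def
proof (rule bspan_elation[OF v ab(1,2) _ ab(3) pos_I[OF j]])
  show "a \<noteq> b" using ab(4) by auto
  show "b \<in> {1..int j} \<Longrightarrow> a \<in> {1..int j}" using ab by (auto simp: rank_def I_iff split: if_splits)
  show "- a \<in> {1..int j} \<Longrightarrow> - b \<in> {1..int j}" using ab by (auto simp: rank_def I_iff split: if_splits)
qed

text \<open>A root group argument in coordinates. The chains of \<open>v \<circ> w\<close> and
  \<open>v2\<close> differ only in the \<open>k\<close>-th member; an elation along the root from
  \<open>w k\<close> to \<open>w (k + 1)\<close>, followed by the reflection, carries the first
  chain to the second.\<close>

lemma step_chain:
  assumes v: "hyperbolic_basis v" and w: "signed_perm n w" and v2: "hyperbolic_basis v2" and k: "k \<in> {1..<n}"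
    and asc: "rank n (w (int k)) < rank n (w (int k + 1))"
    and agr: "\<And>j. j \<le> n \<Longrightarrow> j \<noteq> k \<Longrightarrow> seg (v \<circ> w) j = seg v2 j" and ne: "seg (v \<circ> w) k \<noteq> seg v2 k"
  shows "\<exists>c. \<forall>j\<le>n. seg (elation (w (int k)) (w (int k + 1)) c v \<circ> w \<circ> \<sigma> k) j = seg v2 j"
proof -
  define u where "u = v \<circ> w"
  define a where "a = w (int k)"
  define b where "b = w (int k + 1)"
  have kI: "int k \<in> I" "int k + 1 \<in> I" "- int k \<in> I" "- (int k + 1) \<in> I" using k by (auto simp: I_iff)
  note wD = signed_permD[OF w]
  have ab: "a \<in> I" "b \<in> I" "a \<noteq> b" "a \<noteq> - b"
  proof -
    show "a \<in> I" "b \<in> I" using wD(1) kI unfolding a_def b_def by blast+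
    show "a \<noteq> b" using wD(3)[OF kI(1,2)] by (simp add: a_def b_def)
    have "w (int k) \<noteq> w (- (int k + 1))" using wD(3)[OF kI(1,4)] by simp
    then show "a \<noteq> - b" unfolding wD(2)[OF kI(2)] a_def b_def .
  qed
  have hu: "hyperbolic_basis u" using hyp_comp[OF v w] by (simp add: u_def)
  have iv: "{1..int k + 1} = insert (int k + 1) (insert (int k) {1..int k - 1})"
    "{1..int k} = insert (int k) {1..int k - 1}" using k by auto
  have U: "seg x (k - 1) = bspan x {1..int k - 1}" "seg x k = bspan x (insert (int k) {1..int k - 1})"
    "seg x (Suc k) = bspan x (insert (int k + 1) (insert (int k) {1..int k - 1}))" for x
  proof -
    have *: "int (k - 1) = int k - 1" "int (Suc k) = int k + 1" using k by auto
    show "seg x (k - 1) = bspan x {1..int k - 1}" "seg x k = bspan x (insert (int k) {1..int k - 1})"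
      "seg x (Suc k) = bspan x (insert (int k + 1) (insert (int k) {1..int k - 1}))"
      unfolding seg_def * iv by (rule refl)+
  qed
  define z where "z = v2 (int k)"
  have z: "z \<in> seg v2 k" "z \<in> seg v2 (Suc k)" by (auto simp: U z_def intro: bspan_base)
  have low: "seg u (k - 1) = seg v2 (k - 1)" using agr[of "k - 1"] k by (auto simp: u_def)
  have up: "seg u (Suc k) = seg v2 (Suc k)" using agr[of "Suc k"] k by (auto simp: u_def)
  have zn: "z \<notin> seg u k"
  proof
    assume zu: "z \<in> seg u k"
    have "seg v2 k \<subseteq> seg u k"
      unfolding U(2)[of v2]
    proof (rule bspan_subset)
      fix i assume "i \<in> insert (int k) {1..int k - 1}"
      then consider "i = int k" | "i \<in> {1..int k - 1}" by blast
      then show "v2 i \<in> seg u k"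
      proof cases
        case 2
        then have "v2 i \<in> seg v2 (k - 1)" unfolding U(1) by (rule bspan_base)
        then have "v2 i \<in> seg u (k - 1)" by (simp only: low)
        moreover have "seg u (k - 1) \<subseteq> seg u k" unfolding U by (rule bspan_mono) auto
        ultimately show ?thesis by blast
      qed (use zu in \<open>simp add: z_def\<close>)
    qed (simp add: seg_def)
    then have "seg v2 k = seg u k"
      using dim_seg[OF hu, of k] dim_seg[OF v2, of k] k by (intro vec.subspace_dim_equal) (auto simp: seg_def)
    then show False using ne by (simp add: u_def)
  qed
  \<comment> \<open>Modulo \<open>seg u (k - 1)\<close> the new member is a line in the plane of
    \<open>u k\<close> and \<open>u (k + 1)\<close>, different from that of \<open>u k\<close>. The
    coefficients \<open>\<alpha>\<close> and \<open>\<beta>\<close> are the coordinates of its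
    spanning vector \<open>z\<close>.\<close>
  obtain \<beta> where \<beta>: "z - \<beta> *s u (int k + 1) \<in> vec.span (insert (u (int k)) (u ` {1..int k - 1}))"
  proof -
    have "z \<in> seg u (Suc k)" using z(2) by (simp only: up)
    then show ?thesis using that unfolding U bspan_insert image_insert by (auto simp: vec.span_breakdown_eq)
  qed
  then obtain \<alpha> where \<alpha>: "z - \<beta> *s u (int k + 1) - \<alpha> *s u (int k) \<in> vec.span (u ` {1..int k - 1})"
    by (auto simp: vec.span_breakdown_eq)
  then have "z - \<beta> *s u (int k + 1) - \<alpha> *s u (int k) \<in> seg u (k - 1)" unfolding U(1) bspan_def .
  then have h: "z - \<beta> *s u (int k + 1) - \<alpha> *s u (int k) \<in> seg v2 (k - 1)" by (simp only: low)
  have \<beta>0: "\<beta> \<noteq> 0"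
  proof
    assume "\<beta> = 0"
    then have "z \<in> vec.span (insert (u (int k)) (u ` {1..int k - 1}))" using \<beta> by simp
    then show False using zn by (simp add: U bspan_insert)
  qed
  \<comment> \<open>Rescaling \<open>z\<close> to coefficient 1 at \<open>u (k + 1)\<close> shows
    the line to be spanned by \<open>u (k + 1) + c *s u k\<close>, which is what the elation makes
    of \<open>u (k + 1)\<close>.\<close>
  define c where "c = \<alpha> / \<beta>"
  define v' where "v' = elation a b c v"
  have hv': "hyperbolic_basis v'" using hyp_elation[OF v ab] by (simp add: v'_def)
  have hv'w: "hyperbolic_basis (v' \<circ> w \<circ> \<sigma> k)"
    using hv' hyp_comp w signed_perm_sigma[of n k] k n4 by auto
  have "seg (v' \<circ> w \<circ> \<sigma> k) j = seg v2 j" if j: "j \<le> n" for j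
  proof (cases "j = k")
    case False
    have "seg (v' \<circ> w \<circ> \<sigma> k) j = bspan v' (w ` {1..int j})"
      using sigma_image[OF k j False] by (simp add: seg_def bspan_comp)
    \<comment> \<open>For \<open>j \<noteq> k\<close>, an initial segment containing
      \<open>k + 1\<close> also contains \<open>k\<close>, so the elation preserves its
      span.\<close>
    also have "\<dots> = bspan v (w ` {1..int j})"
      unfolding v'_def
    proof (rule bspan_elation[OF v ab wD(4)[OF pos_I[OF j]]])
      assume "b \<in> w ` {1..int j}"
      then have "int k + 1 \<in> {1..int j}" unfolding b_def using wD(3)[of "int k + 1"] kI pos_I[OF j] by blast
      then show "a \<in> w ` {1..int j}" unfolding a_def using k by auto
    next
      assume "- a \<in> w ` {1..int j}"
      then have "- int k \<in> {1..int j}" unfolding a_def using wD(2)[of "int k"] wD(3)[of "- int k"] kI pos_I[OF j] by force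
      then show "- b \<in> w ` {1..int j}" by auto
    qed
    also have "\<dots> = seg v2 j" using agr[OF j False] by (simp add: seg_def bspan_comp)
    finally show ?thesis .
  next
    case True
    have sk: "\<sigma> k x = signed_swap (int k) (int k + 1) x" for x
      using k n4 sigma_eq_signed_swap[of n k] by (simp add: root_fst_def root_snd_def)
    have "seg (v' \<circ> w \<circ> \<sigma> k) k \<subseteq> seg v2 k"
      unfolding U(2)[of "_ \<circ> _"]
    proof (rule bspan_subset)
      fix i assume "i \<in> insert (int k) {1..int k - 1}"
      then consider "i = int k" | "i \<in> {1..int k - 1}" by blast
      then show "(v' \<circ> w \<circ> \<sigma> k) i \<in> seg v2 k"
      proof cases
        case 1
        have "b \<noteq> - a" using ab(4) by auto
        then have "(v' \<circ> w \<circ> \<sigma> k) i = u (int k + 1) + c *s u (int k)"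
          using 1 by (simp add: sk signed_swap_def v'_def elation_def u_def b_def[symmetric] a_def[symmetric])
        also have "\<dots> = inverse \<beta> *s (z - (z - \<beta> *s u (int k + 1) - \<alpha> *s u (int k)))"
          using \<beta>0 by (simp add: c_def vec.scale_right_distrib field_simps)
        also have "\<dots> \<in> seg v2 k"
        proof -
          have "seg v2 (k - 1) \<subseteq> seg v2 k" unfolding U by (rule bspan_mono) auto
          then have "z - \<beta> *s u (int k + 1) - \<alpha> *s u (int k) \<in> seg v2 k" using h by blast
          moreover have "vec.subspace (seg v2 k)" by (simp add: seg_def)
          ultimately show ?thesis using z(1) vec.subspace_scale vec.subspace_diff by blast
        qed
        finally show ?thesis .
      next
        case 2
        have iI: "i \<in> I" using 2 k by (auto simp: I_iff)
        have "w i \<noteq> b" using 2 wD(3)[OF iI kI(2)] by (auto simp: b_def)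
        moreover have "w i \<noteq> - a" using 2 wD(3)[OF iI kI(3)] wD(2)[OF kI(1)] k by (auto simp: a_def)
        ultimately have "(v' \<circ> w \<circ> \<sigma> k) i = u i"
          using 2 by (simp add: sk signed_swap_def v'_def elation_def u_def)
        also have "\<dots> \<in> seg u (k - 1)" unfolding U using 2 by (rule bspan_base)
        also have "\<dots> \<subseteq> seg v2 k" unfolding low unfolding U by (rule bspan_mono) auto
        finally show ?thesis .
      qed
    qed (simp add: seg_def)
    then have "seg (v' \<circ> w \<circ> \<sigma> k) k = seg v2 k"
      using dim_seg[OF hv'w, of k] dim_seg[OF v2, of k] k by (intro vec.subspace_dim_equal) (auto simp: seg_def)
    then show ?thesis using True by simp
  qed
  then show ?thesis unfolding v'_def a_def b_def by blast
qed

end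

section \<open>Relative positions of chambers\<close>

context hyperbolic_quadric
begin

abbreviation "\<alpha> \<equiv> root_fst n"
abbreviation "\<beta> \<equiv> root_snd n"
abbreviation "rk \<equiv> rank n"

text \<open>In terms of roots: \<open>w\<close> keeps the \<open>k\<close>-th simple root positive,
  so that \<open>w \<circ> \<sigma> k\<close> is longer than \<open>w\<close>.\<close>

definition ascent :: "(int \<Rightarrow> int) \<Rightarrow> nat \<Rightarrow> bool" where
  "ascent w k \<longleftrightarrow> rk (w (\<alpha> k)) < rk (w (\<beta> k))"

definition idx :: "nat \<Rightarrow> nat" where "idx k = (if k < n then k else n - 1)"

text \<open>Swapping \<open>v n\<close> and \<open>v (- n)\<close> conjugates \<open>u\<close> to \<open>s\<^sub>n\<^sub>-\<^sub>1\<close>, so \<open>u\<close> needs no separate treatment.\<close>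

definition twisted :: "nat \<Rightarrow> (int \<Rightarrow> 'a ^ 'm) \<Rightarrow> int \<Rightarrow> 'a ^ 'm" where
  "twisted k v = (if k < n then v else v \<circ> tw)"

text \<open>Membership in a common \<open>k\<close>-panel, equality included. Using all segments,
  also that of dimension \<open>n - 1\<close>, makes it visibly an equivalence relation.\<close>

definition agree :: "nat \<Rightarrow> (int \<Rightarrow> 'a ^ 'm) \<Rightarrow> (int \<Rightarrow> 'a ^ 'm) \<Rightarrow> bool" where
  "agree k v v' \<longleftrightarrow> (\<forall>j\<le>n. j \<noteq> idx k \<longrightarrow> seg (twisted k v) j = seg (twisted k v') j)"

text \<open>Relative position \<open>w\<close>, encoded by a common apartment: a single basis
  exhibits both flags.\<close>

definition pos_rel :: "(int \<Rightarrow> int) \<Rightarrow> (('a ^ 'm) set set \<times> ('a ^ 'm) set set) set" where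
  "pos_rel w = {(chamber v, chamber (v \<circ> w)) |v. v \<in> oriented \<and> v \<circ> w \<in> oriented}"

lemma n2: "n \<ge> 2" using n4 by simp

lemmas sp_sigma = signed_perm_sigma[OF n2] and roots = roots_in[OF n2]
  and sigma_inv = sigma_sigma[OF n2] and sigma_signed_swap = sigma_eq_signed_swap[OF n2]

lemma alpha_idx: "\<alpha> k = int (idx k)" by (simp add: root_fst_def idx_def)

lemma idx_bounds: "k \<in> {1..n} \<Longrightarrow> idx k \<in> {1..<n}" using n4 by (auto simp: idx_def)

lemma sigma_inv': "k \<in> {1..n} \<Longrightarrow> \<sigma> k \<circ> \<sigma> k = id" using sigma_inv by auto

lemma sigma_roots: "k \<in> {1..n} \<Longrightarrow> \<sigma> k (\<alpha> k) = \<beta> k" "k \<in> {1..n} \<Longrightarrow> \<sigma> k (\<beta> k) = \<alpha> k"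
  using roots[of k] by (auto simp: sigma_signed_swap signed_swap_def)

lemma sigma_n_tw: "\<sigma> n \<circ> tw = tw \<circ> \<sigma> (n - 1)"
proof
  fix x
  obtain m where m: "n = Suc m" "m \<ge> 1" using n4 by (cases n) auto
  show "(\<sigma> n \<circ> tw) x = (tw \<circ> \<sigma> (n - 1)) x"
    using m sigma_signed_swap[of n] sigma_signed_swap[of "n - 1"] by (auto simp: signed_swap_def root_fst_def root_snd_def twist_eq)
qed

lemma agree_refl: "agree k v v" and agree_sym: "agree k v v' \<Longrightarrow> agree k v' v"
  and agree_trans: "agree k v v' \<Longrightarrow> agree k v' v'' \<Longrightarrow> agree k v v''"
  unfolding agree_def by simp_all

lemma twisted_hyp: "hyperbolic_basis v \<Longrightarrow> hyperbolic_basis (twisted k v)"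
  by (simp add: twisted_def hyp_tw)

lemma twisted_cong:
  assumes "v \<in> oriented" "v' \<in> oriented" "chamber v = chamber v'" "j \<le> n" shows "seg (twisted k v) j = seg (twisted k v') j"
  using assms chamber_eqD[OF assms(1-3)] seg_tw_cong[of v v' j] oriented_hyp by (auto simp: twisted_def)

lemma agree_cong: "v \<in> oriented \<Longrightarrow> v' \<in> oriented \<Longrightarrow> chamber v = chamber v' \<Longrightarrow> agree k v v'"
  unfolding agree_def using twisted_cong by blast

lemma chamber_vt_cong:
  assumes "hyperbolic_basis v" "hyperbolic_basis v'" "\<And>j. j \<le> n \<Longrightarrow> seg (twisted k v) j = seg (twisted k v') j"
  shows "chamber v = chamber v'"
  using chamber_cong[OF twisted_hyp[OF assms(1)] twisted_hyp[OF assms(2)] assms(3)] by (auto simp: twisted_def chamber_tw split: if_splits)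

lemma oriented_vt_cong:
  assumes v: "hyperbolic_basis v" and v': "v' \<in> oriented" and eq: "\<And>j. j \<le> n \<Longrightarrow> seg (twisted k v) j = seg (twisted k v') j"
  shows "v \<in> oriented"
proof -
  have "seg v n = seg v' n"
  proof (cases "k < n")
    case False
    have *: "x \<circ> tw \<circ> tw = x" for x :: "int \<Rightarrow> 'a ^ 'm" by (simp add: comp_assoc twist_twist)
    show ?thesis using seg_tw_cong[OF twisted_hyp[OF v] twisted_hyp[OF oriented_hyp[OF v']] eq, of n] False by (simp add: twisted_def *)
  qed (use eq[of n] in \<open>simp add: twisted_def\<close>)
  then show ?thesis using v v' by (simp add: oriented_def)
qed

text \<open>At an ascent, the elation of \<open>step_chain\<close> belongs to a root that is
  positive for \<open>v\<close>, so it does not change \<open>chamber v\<close>. Hence all other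
  chambers in the \<open>k\<close>-panel of \<open>chamber (v \<circ> w)\<close> are in position
  \<open>w \<circ> \<sigma> k\<close> from \<open>chamber v\<close>.\<close>

lemma step_chamber:
  assumes v: "v \<in> oriented" "v \<circ> w \<in> oriented" and w: "signed_perm n w" and v2: "v2 \<in> oriented" and k: "k \<in> {1..n}"
    and agr: "agree k (v \<circ> w) v2" and ne: "chamber (v \<circ> w) \<noteq> chamber v2" and asc: "ascent w k"
  shows "\<exists>c. elation (w (\<alpha> k)) (w (\<beta> k)) c v \<in> oriented \<and> chamber (elation (w (\<alpha> k)) (w (\<beta> k)) c v) = chamber v \<and>
    elation (w (\<alpha> k)) (w (\<beta> k)) c v \<circ> w \<circ> \<sigma> k \<in> oriented \<and>
    chamber (elation (w (\<alpha> k)) (w (\<beta> k)) c v \<circ> w \<circ> \<sigma> k) = chamber v2"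
proof -
  let ?a = "w (\<alpha> k)" and ?b = "w (\<beta> k)"
  note hv = oriented_hyp[OF v(1)] and h2 = oriented_hyp[OF v2] and hw = oriented_hyp[OF v(2)]
  note wD = signed_permD[OF w]
  have r: "\<alpha> k \<in> I" "\<beta> k \<in> I" "\<alpha> k \<noteq> \<beta> k" "\<alpha> k \<noteq> - \<beta> k" using roots[OF k] .
  have ab: "?a \<in> I" "?b \<in> I" "?a \<noteq> ?b" "?a \<noteq> - ?b"
    using wD(1)[OF r(1)] wD(1)[OF r(2)] wD(3)[OF r(1,2)] r wD(3)[OF r(1), of "- \<beta> k"] wD(2)[OF r(2)] by auto
  define w' where "w' = (if k < n then w else w \<circ> tw)"
  have w': "signed_perm n w'"
    unfolding w'_def using w signed_perm_comp signed_perm_twist[OF n1] by auto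
  have ab': "w' (int (idx k)) = ?a" "w' (int (idx k) + 1) = ?b"
    using k n4 by (auto simp: w'_def idx_def root_fst_def root_snd_def twist_eq)
  have vw': "v \<circ> w' = twisted k (v \<circ> w)" by (simp add: w'_def twisted_def comp_assoc)
  have ne': "seg (v \<circ> w') (idx k) \<noteq> seg (twisted k v2) (idx k)"
  proof
    assume "seg (v \<circ> w') (idx k) = seg (twisted k v2) (idx k)"
    then have "seg (twisted k (v \<circ> w)) j = seg (twisted k v2) j" if "j \<le> n" for j
      using agr that unfolding agree_def vw' by (cases "j = idx k") auto
    then show False using ne chamber_vt_cong[OF hw h2] by blast
  qed
  have "\<exists>c. \<forall>j\<le>n. seg (elation (w' (int (idx k))) (w' (int (idx k) + 1)) c v \<circ> w' \<circ> \<sigma> (idx k)) j = seg (twisted k v2) j"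
  proof (rule step_chain[OF hv w' twisted_hyp[OF h2] idx_bounds[OF k] _ _ ne'])
    show "rk (w' (int (idx k))) < rk (w' (int (idx k) + 1))" using asc by (simp add: ab' ascent_def)
    show "seg (v \<circ> w') j = seg (twisted k v2) j" if "j \<le> n" "j \<noteq> idx k" for j
      using agr that unfolding agree_def vw' by blast
  qed
  then obtain c where c: "\<And>j. j \<le> n \<Longrightarrow> seg (elation ?a ?b c v \<circ> w' \<circ> \<sigma> (idx k)) j = seg (twisted k v2) j"
    unfolding ab' by blast
  let ?v = "elation ?a ?b c v"
  have hv': "hyperbolic_basis ?v" using hyp_elation[OF hv ab] .
  have Uv: "seg ?v j = seg v j" if "j \<le> n" for j
    using seg_elation[OF hv ab(1,2,4) _ that] asc by (simp add: ascent_def)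
  have vP: "?v \<in> oriented" using hv' Uv[of n] v(1) by (simp add: oriented_def)
  have chv: "chamber ?v = chamber v" using chamber_cong[OF hv' hv Uv] .
  \<comment> \<open>For \<open>k = n\<close>, moving \<open>tw\<close> past the reflection turns
    \<open>\<sigma> (n - 1)\<close> into \<open>\<sigma> n\<close>.\<close>
  have eq: "?v \<circ> w' \<circ> \<sigma> (idx k) = twisted k (?v \<circ> w \<circ> \<sigma> k)"
  proof (cases "k < n")
    case False
    then have "k = n" using k by simp
    then show ?thesis using sigma_n_tw by (simp add: w'_def twisted_def idx_def comp_assoc)
  qed (simp add: w'_def twisted_def idx_def)
  have h3: "hyperbolic_basis (?v \<circ> w \<circ> \<sigma> k)" using hyp_comp hv' w sp_sigma k by blast
  have c': "seg (twisted k (?v \<circ> w \<circ> \<sigma> k)) j = seg (twisted k v2) j" if "j \<le> n" for j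
    using c[OF that] by (simp only: eq)
  have "?v \<circ> w \<circ> \<sigma> k \<in> oriented" using oriented_vt_cong[OF h3 v2 c'] .
  moreover have "chamber (?v \<circ> w \<circ> \<sigma> k) = chamber v2" using chamber_vt_cong[OF h3 h2 c'] .
  ultimately show ?thesis using vP chv by blast
qed

section \<open>Separating positions that differ by a simple reflection\<close>

lemma sigma_image_idx:
  assumes k: "k \<in> {1..n}"
  shows "\<sigma> k ` {1..int (idx k)} = insert (\<beta> k) ({1..int (idx k)} - {\<alpha> k})" "\<beta> k \<notin> {1..int (idx k)}"
    "\<alpha> k \<in> {1..int (idx k)}"
proof -
  show a: "\<alpha> k \<in> {1..int (idx k)}" using idx_bounds[OF k] by (simp add: alpha_idx)
  have "\<sigma> k x = id x" if "x \<in> {1..int (idx k)} - {\<alpha> k}" for x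
    using that k n4 by (auto simp: sigma_signed_swap signed_swap_def alpha_idx root_snd_def idx_def split: if_splits)
  then have "\<sigma> k ` ({1..int (idx k)} - {\<alpha> k}) = id ` ({1..int (idx k)} - {\<alpha> k})" by (rule image_cong[OF refl])
  then have *: "\<sigma> k ` ({1..int (idx k)} - {\<alpha> k}) = {1..int (idx k)} - {\<alpha> k}"
    by (simp only: image_id id_apply)
  have "\<sigma> k ` insert (\<alpha> k) ({1..int (idx k)} - {\<alpha> k}) = insert (\<beta> k) ({1..int (idx k)} - {\<alpha> k})"
    by (simp only: image_insert sigma_roots(1)[OF k] *)
  then show "\<sigma> k ` {1..int (idx k)} = insert (\<beta> k) ({1..int (idx k)} - {\<alpha> k})"
    using a by (simp only: insert_Diff)
  show "\<beta> k \<notin> {1..int (idx k)}" using k n4 by (auto simp: root_snd_def idx_def)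
qed

text \<open>An initial segment containing \<open>a\<close> but nothing after \<open>a\<close> whose span depends on the flag only. For
  negative \<open>a\<close> it spans the perp of a member of the flag.\<close>

lemma canonical_subspace:
  assumes v: "hyperbolic_basis v" "hyperbolic_basis v'" and eq: "\<And>j. j \<le> n \<Longrightarrow> seg v j = seg v' j" and a: "a \<in> I"
  obtains L where "L \<subseteq> I" "a \<in> L" "\<And>b. b \<in> I \<Longrightarrow> rk a < rk b \<Longrightarrow> b \<notin> L" "bspan v L = bspan v' L"
proof -
  consider "a > 0" | "a = - int n" | "a < 0" "a > - int n" using a by (force simp: I_iff)
  then show ?thesis
  proof cases
    case 1
    show ?thesis
    proof (rule that[of "{1..a}"])
      show "bspan v {1..a} = bspan v' {1..a}" using eq[of "nat a"] a 1 by (simp add: seg_def I_iff)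
    qed (use 1 a in \<open>auto simp: I_iff rank_def split: if_splits\<close>)
  next
    case 2
    show ?thesis
    proof (rule that[of "insert (- int n) {1..int n - 1}"])
      show "bspan v (insert (- int n) {1..int n - 1}) = bspan v' (insert (- int n) {1..int n - 1})"
        using twin_cong[OF v eq] by (simp add: twin_def)
    qed (use 2 n4 in \<open>auto simp: I_iff rank_def split: if_splits\<close>)
  next
    case 3
    define j where "j = nat (- a) - 1"
    have j: "int j = - a - 1" "j \<le> n" using 3 by (auto simp: j_def)
    show ?thesis
    proof (rule that[of "{i \<in> I. - i \<notin> {1..int j}}"])
      show "bspan v {i \<in> I. - i \<notin> {1..int j}} = bspan v' {i \<in> I. - i \<notin> {1..int j}}"
        using bspan_perp[OF v(1) pos_I[OF j(2)]] bspan_perp[OF v(2) pos_I[OF j(2)]] eq[OF j(2)] by (simp add: seg_def)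
    qed (use 3 j a in \<open>auto simp: I_iff rank_def split: if_splits\<close>)
  qed
qed

text \<open>The set \<open>L\<close> contains \<open>w (\<alpha> k)\<close> but not
  \<open>w (\<beta> k)\<close>. The intersection of its span with the \<open>idx k\<close>-th
  segment of the second flag would therefore have two dimensions differing by one.\<close>

lemma pos_rel_disjoint:
  assumes v: "v \<in> oriented" "v \<circ> w \<in> oriented" and v1: "v1 \<in> oriented" "v1 \<circ> w \<circ> \<sigma> k \<in> oriented" and w: "signed_perm n w"
    and k: "k \<in> {1..n}" and asc: "ascent w k"
    and eq: "chamber v = chamber v1" "chamber (v \<circ> w) = chamber (v1 \<circ> w \<circ> \<sigma> k)"
  shows False
proof -
  note hv = oriented_hyp[OF v(1)] and h1 = oriented_hyp[OF v1(1)]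
  note wD = signed_permD[OF w]
  have r: "\<alpha> k \<in> I" "\<beta> k \<in> I" using roots[OF k] by blast+
  obtain L where L: "L \<subseteq> I" "w (\<alpha> k) \<in> L" "\<And>b. b \<in> I \<Longrightarrow> rk (w (\<alpha> k)) < rk b \<Longrightarrow> b \<notin> L" "bspan v L = bspan v1 L"
    using canonical_subspace[OF hv h1 chamber_eqD[OF v(1) v1(1) eq(1)] wD(1)[OF r(1)]] by blast
  let ?A = "{1..int (idx k)}"
  have ik: "idx k \<le> n" using idx_bounds[OF k] by simp
  have AI: "?A \<subseteq> I" "\<sigma> k ` ?A \<subseteq> I" using pos_I[OF ik] signed_permD(4)[OF sp_sigma[OF k]] by blast+
  have "bspan v (w ` ?A) = bspan v1 (w ` \<sigma> k ` ?A)"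
    using chamber_eqD[OF v(2) v1(2) eq(2) ik] by (simp add: seg_def bspan_comp)
  then have "bspan v (L \<inter> w ` ?A) = bspan v1 (L \<inter> w ` \<sigma> k ` ?A)"
    using bspan_Int[OF hv L(1) wD(4)[OF AI(1)]] bspan_Int[OF h1 L(1) wD(4)[OF AI(2)]] L(4) by simp
  then have c: "card (L \<inter> w ` ?A) = card (L \<inter> w ` \<sigma> k ` ?A)"
    using dim_bspan[OF hv, of "L \<inter> w ` ?A"] dim_bspan[OF h1, of "L \<inter> w ` \<sigma> k ` ?A"] L(1) by (simp add: le_infI1)
  let ?A' = "?A - {\<alpha> k}"
  have "w (\<beta> k) \<notin> L" using L(3)[OF wD(1)[OF r(2)]] asc by (simp add: ascent_def)
  then have 1: "L \<inter> w ` \<sigma> k ` ?A = L \<inter> w ` ?A'" unfolding sigma_image_idx(1)[OF k] by auto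
  have "w ` ?A = insert (w (\<alpha> k)) (w ` ?A')" using sigma_image_idx(3)[OF k] by blast
  then have 2: "L \<inter> w ` ?A = insert (w (\<alpha> k)) (L \<inter> w ` ?A')" using L(2) by auto
  have "w (\<alpha> k) \<notin> w ` ?A'" using wD(3)[OF r(1)] AI(1) by blast
  then have "card (L \<inter> w ` ?A) = card (L \<inter> w ` ?A') + 1" unfolding 2 by (subst card_insert_disjoint) auto
  then show False using c 1 by simp
qed

lemma ascent_id: "k \<in> {1..n} \<Longrightarrow> ascent id k"
  using n4 by (auto simp: ascent_def rank_def root_fst_def root_snd_def)

text \<open>Both directions use earlier lemmas at \<open>w = id\<close>: distinctness is
  \<open>pos_rel_disjoint\<close>, existence is \<open>step_chamber\<close>. Position
  \<open>\<sigma> k\<close> becomes an equivalence relation without its diagonal.\<close>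

lemma pos_rel_sigma_iff:
  assumes v: "v \<in> oriented" "v' \<in> oriented" and k: "k \<in> {1..n}"
  shows "(chamber v, chamber v') \<in> pos_rel (\<sigma> k) \<longleftrightarrow> chamber v \<noteq> chamber v' \<and> agree k v v'"
proof
  assume "(chamber v, chamber v') \<in> pos_rel (\<sigma> k)"
  then obtain u where u: "chamber v = chamber u" "chamber v' = chamber (u \<circ> \<sigma> k)" "u \<in> oriented" "u \<circ> \<sigma> k \<in> oriented"
    by (auto simp: pos_rel_def)
  have "seg (twisted k u) j = seg (twisted k (u \<circ> \<sigma> k)) j" if "j \<le> n" "j \<noteq> idx k" for j
  proof -
    have "twisted k (u \<circ> \<sigma> k) = twisted k u \<circ> \<sigma> (idx k)"
    proof (cases "k < n")
      case False
      then have "k = n" using k by simp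
      then show ?thesis using sigma_n_tw by (simp add: twisted_def idx_def comp_assoc)
    qed (simp add: twisted_def idx_def)
    then show ?thesis using sigma_image[OF idx_bounds[OF k] that] by (simp add: seg_def bspan_comp)
  qed
  then have "agree k u (u \<circ> \<sigma> k)" by (simp add: agree_def)
  then have "agree k v v'" using agree_cong[OF v(1) u(3,1)] agree_cong[OF u(4) v(2) u(2)[symmetric]] agree_trans by blast
  moreover have "chamber v \<noteq> chamber v'"
  proof
    assume "chamber v = chamber v'"
    then show False
      using pos_rel_disjoint[of u id u k] u k ascent_id[OF k] signed_perm_id by simp
  qed
  ultimately show "chamber v \<noteq> chamber v' \<and> agree k v v'" by blast
next
  assume "chamber v \<noteq> chamber v' \<and> agree k v v'"
  then obtain c where c: "elation (\<alpha> k) (\<beta> k) c v \<in> oriented" "chamber (elation (\<alpha> k) (\<beta> k) c v) = chamber v"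
    "elation (\<alpha> k) (\<beta> k) c v \<circ> \<sigma> k \<in> oriented" "chamber (elation (\<alpha> k) (\<beta> k) c v \<circ> \<sigma> k) = chamber v'"
    using step_chamber[of v id v' k] v k ascent_id[OF k] signed_perm_id by auto
  then show "(chamber v, chamber v') \<in> pos_rel (\<sigma> k)" unfolding pos_rel_def by (intro CollectI exI[of _ "elation (\<alpha> k) (\<beta> k) c v"]) simp
qed

lemma pos_rel_dom: "(M, M') \<in> pos_rel w \<Longrightarrow> \<exists>v\<in>oriented. M = chamber v" and pos_rel_ran: "(M, M') \<in> pos_rel w \<Longrightarrow> \<exists>v\<in>oriented. M' = chamber v"
  by (auto simp: pos_rel_def)

lemma pos_rel_step:
  assumes "(M, M') \<in> pos_rel w" and M2: "M2 \<in> chamber ` oriented" "M' \<noteq> M2" and agr: "\<And>v v'. v \<in> oriented \<Longrightarrow> v' \<in> oriented \<Longrightarrow> M' = chamber v \<Longrightarrow> M2 = chamber v' \<Longrightarrow> agree k v v'"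
    and w: "signed_perm n w" and k: "k \<in> {1..n}" and asc: "ascent w k"
  shows "(M, M2) \<in> pos_rel (w \<circ> \<sigma> k)"
proof -
  obtain v where v: "v \<in> oriented" "v \<circ> w \<in> oriented" "M = chamber v" "M' = chamber (v \<circ> w)" using assms(1) by (auto simp: pos_rel_def)
  obtain v2 where v2: "v2 \<in> oriented" "M2 = chamber v2" using M2 by blast
  have "agree k (v \<circ> w) v2" "chamber (v \<circ> w) \<noteq> chamber v2" using agr v v2 M2 by auto
  from step_chamber[OF v(1,2) w v2(1) k this asc] show ?thesis
  proof (elim exE conjE)
    fix c let ?e = "elation (w (\<alpha> k)) (w (\<beta> k)) c v"
    assume e: "?e \<in> oriented" "chamber ?e = chamber v" "?e \<circ> w \<circ> \<sigma> k \<in> oriented" "chamber (?e \<circ> w \<circ> \<sigma> k) = chamber v2"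
    then show ?thesis unfolding pos_rel_def v(3) v2(2) comp_assoc
      by (intro CollectI exI[of _ ?e]) (simp add: comp_assoc)
  qed
qed

lemma pos_rel_comp:
  assumes "(M, M') \<in> pos_rel w" "(M', M2) \<in> pos_rel (\<sigma> k)"
    and w: "signed_perm n w" and k: "k \<in> {1..n}" and asc: "ascent w k"
  shows "(M, M2) \<in> pos_rel (w \<circ> \<sigma> k)"
proof (rule pos_rel_step[OF assms(1) _ _ _ w k asc])
  show "M2 \<in> chamber ` oriented" using pos_rel_ran[OF assms(2)] by blast
  obtain u u' where u: "u \<in> oriented" "u' \<in> oriented" "M' = chamber u" "M2 = chamber u'" using pos_rel_dom[OF assms(2)] pos_rel_ran[OF assms(2)] by blast
  show "M' \<noteq> M2" using pos_rel_sigma_iff[OF u(1,2) k] assms(2) u by simp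
  show "agree k v v'" if "v \<in> oriented" "v' \<in> oriented" "M' = chamber v" "M2 = chamber v'" for v v'
    using pos_rel_sigma_iff[OF that(1,2) k] assms(2) that by simp
qed

lemma pos_rel_factor:
  assumes "(M, M2) \<in> pos_rel (w \<circ> \<sigma> k)" and k: "k \<in> {1..n}"
  shows "\<exists>M'. (M, M') \<in> pos_rel w \<and> (M', M2) \<in> pos_rel (\<sigma> k)"
proof -
  obtain v where v: "v \<in> oriented" "v \<circ> w \<circ> \<sigma> k \<in> oriented" "M = chamber v" "M2 = chamber (v \<circ> w \<circ> \<sigma> k)"
    using assms(1) by (auto simp: pos_rel_def comp_assoc)
  have "v \<circ> w = v \<circ> w \<circ> \<sigma> k \<circ> \<sigma> k" using sigma_inv'[OF k] by (simp add: comp_assoc)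
  then have vw: "v \<circ> w \<in> oriented" using oriented_sigma[OF v(2) k] by simp
  show ?thesis unfolding pos_rel_def v(3,4) using v(1,2) vw by (intro exI[of _ "chamber (v \<circ> w)"]) blast
qed

text \<open>Two intermediate chambers would share the panel of \<open>M2\<close>; by
  \<open>pos_rel_step\<close> the second would then be in position
  \<open>w \<circ> \<sigma> k\<close> from \<open>M\<close> besides \<open>w\<close>. Together with
  \<open>pos_rel_comp\<close> and \<open>pos_rel_factor\<close> this gives exactly one path.\<close>

lemma pos_rel_unique:
  assumes 1: "(M, M1) \<in> pos_rel w" "(M1, M2) \<in> pos_rel (\<sigma> k)" and 2: "(M, M1') \<in> pos_rel w" "(M1', M2) \<in> pos_rel (\<sigma> k)"
    and w: "signed_perm n w" and k: "k \<in> {1..n}" and asc: "ascent w k"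
  shows "M1 = M1'"
proof (rule ccontr)
  assume ne: "M1 \<noteq> M1'"
  obtain u2 where u2: "u2 \<in> oriented" "M2 = chamber u2" using pos_rel_ran[OF 1(2)] by blast
  have "(M, M1') \<in> pos_rel (w \<circ> \<sigma> k)"
  proof (rule pos_rel_step[OF 1(1) _ ne _ w k asc])
    show "M1' \<in> chamber ` oriented" using pos_rel_dom[OF 2(2)] by blast
    show "agree k v v'" if "v \<in> oriented" "v' \<in> oriented" "M1 = chamber v" "M1' = chamber v'" for v v'
    proof -
      have "agree k v u2" using pos_rel_sigma_iff[OF that(1) u2(1) k] 1(2) that u2 by simp
      moreover have "agree k v' u2" using pos_rel_sigma_iff[OF that(2) u2(1) k] 2(2) that u2 by simp
      ultimately show ?thesis using agree_trans agree_sym by blast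
    qed
  qed
  then obtain v1 where v1: "v1 \<in> oriented" "v1 \<circ> w \<circ> \<sigma> k \<in> oriented" "M = chamber v1" "M1' = chamber (v1 \<circ> w \<circ> \<sigma> k)"
    by (auto simp: pos_rel_def comp_assoc)
  obtain v where v: "v \<in> oriented" "v \<circ> w \<in> oriented" "M = chamber v" "M1' = chamber (v \<circ> w)" using 2(1) by (auto simp: pos_rel_def)
  show False using pos_rel_disjoint[OF v(1,2) v1(1,2) w k asc] v v1 by simp
qed

lemma pos_rel_converse:
  assumes "w \<circ> w' = id" "w' \<circ> w = id"
  shows "(M, M') \<in> pos_rel w \<longleftrightarrow> (M', M) \<in> pos_rel w'"
proof -
  have *: "(M', M) \<in> pos_rel w'" if ww: "w \<circ> w' = id" "(M, M') \<in> pos_rel w" for w w' M M'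
  proof -
    obtain v where v: "v \<in> oriented" "v \<circ> w \<in> oriented" "M = chamber v" "M' = chamber (v \<circ> w)" using ww(2) by (auto simp: pos_rel_def)
    have "v \<circ> w \<circ> w' = v" using ww(1) by (simp add: comp_assoc)
    then show ?thesis using v unfolding pos_rel_def by (intro CollectI exI[of _ "v \<circ> w"]) simp
  qed
  show ?thesis using *[OF assms(1)] *[OF assms(2)] by blast
qed

lemma bspan_cong: "(\<And>i. i \<in> A \<Longrightarrow> v i = v' i) \<Longrightarrow> bspan v A = bspan v' A"
  unfolding bspan_def by (simp cong: image_cong)

lemma oriented_cong:
  assumes "\<And>i. i \<in> I \<Longrightarrow> v i = v' i" shows "v \<in> oriented \<longleftrightarrow> v' \<in> oriented"
proof -
  have "seg v n = seg v' n" unfolding seg_def using pos_I[of n] assms by (intro bspan_cong) auto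
  moreover have "hyperbolic_basis y" if "hyperbolic_basis x" "\<And>i. i \<in> I \<Longrightarrow> y i = x i" for x y
    unfolding hyperbolic_basis_def
  proof (intro conjI ballI)
    fix i j assume ij: "i \<in> I" "j \<in> I"
    show "Q (y i) = 0" unfolding that(2)[OF ij(1)] using hyp_Q[OF that(1) ij(1)] .
    show "B (y i) (y j) = (if j = - i then 1 else 0)"
      unfolding that(2)[OF ij(1)] that(2)[OF ij(2)] using hyp_B[OF that(1) ij] .
  qed
  then have "hyperbolic_basis v \<longleftrightarrow> hyperbolic_basis v'" using assms by metis
  ultimately show ?thesis by (simp add: oriented_def)
qed

lemma chamber_cong': 
  assumes "\<And>i. i \<in> I \<Longrightarrow> v i = v' i" shows "chamber v = chamber v'"
proof -
  have "seg v j = seg v' j" if "j \<le> n" for j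
    unfolding seg_def using pos_I[OF that] assms by (intro bspan_cong) auto
  moreover have "twin v = twin v'" unfolding twin_def using insert_I assms by (intro bspan_cong) auto
  moreover have "seg v ` {1..n - 2} = seg v' ` {1..n - 2}" using calculation by (intro image_cong) auto
  ultimately show ?thesis by (simp add: chamber_eq)
qed

lemma pos_rel_cong:
  assumes "\<And>i. i \<in> I \<Longrightarrow> w i = w' i" shows "pos_rel w = pos_rel w'"
proof -
  have "v \<circ> w \<in> oriented \<longleftrightarrow> v \<circ> w' \<in> oriented" "chamber (v \<circ> w) = chamber (v \<circ> w')" for v
    using oriented_cong[of "v \<circ> w" "v \<circ> w'"] chamber_cong'[of "v \<circ> w" "v \<circ> w'"] assms by simp_all
  then show ?thesis unfolding pos_rel_def by (intro Collect_cong) metis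
qed

text \<open>The neighbours arise from the elations of one root group, parametrised by the field, so
  a panel has \<open>CARD('a) + 1\<close> chambers.\<close>

lemma pos_rel_degree:
  assumes v: "v \<in> oriented" and k: "k \<in> {1..n}"
  shows "card {M'. (chamber v, M') \<in> pos_rel (\<sigma> k)} = CARD('a)"
proof -
  let ?e = "\<lambda>c. elation (\<alpha> k) (\<beta> k) c v"
  note hv = oriented_hyp[OF v] and r = roots[OF k]
  have he: "hyperbolic_basis (?e c)" for c using hyp_elation[OF hv r] .
  have lt: "rk (\<alpha> k) < rk (\<beta> k)" using ascent_id[OF k] by (simp add: ascent_def)
  have Ue: "seg (?e c) j = seg v j" if "j \<le> n" for c j using seg_elation[OF hv r(1,2,4) lt that] .
  have eP: "?e c \<in> oriented" for c using he Ue[of n] v by (simp add: oriented_def)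
  have che: "chamber (?e c) = chamber v" for c using chamber_cong[OF he hv Ue] .
  have ik: "idx k \<le> n" using idx_bounds[OF k] by simp
  let ?A = "insert (\<beta> k) ({1..int (idx k)} - {\<alpha> k})"
  have AI: "?A \<subseteq> I" using pos_I[OF ik] r by auto
  have "bij_betw (\<lambda>c. chamber (?e c \<circ> \<sigma> k)) UNIV {M'. (chamber v, M') \<in> pos_rel (\<sigma> k)}"
  proof (rule bij_betwI')
    fix c c' :: 'a
    show "chamber (?e c \<circ> \<sigma> k) = chamber (?e c' \<circ> \<sigma> k) \<longleftrightarrow> c = c'"
    proof
      assume "chamber (?e c \<circ> \<sigma> k) = chamber (?e c' \<circ> \<sigma> k)"
      from chamber_eqD[OF oriented_sigma[OF eP k] oriented_sigma[OF eP k] this ik]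
      have "bspan (?e c) ?A = bspan (?e c') ?A" unfolding seg_def bspan_comp sigma_image_idx(1)[OF k] .
      moreover have "?e c (\<beta> k) \<in> bspan (?e c) ?A" by (rule bspan_base) simp
      ultimately have "?e c (\<beta> k) \<in> bspan (?e c') ?A" by simp
      \<comment> \<open>The coordinate at \<open>?e c' (\<alpha> k)\<close>, an index outside
        \<open>?A\<close>, has to vanish; its value is \<open>c - c'\<close>.\<close>
      then have "B (?e c (\<beta> k)) (?e c' (- \<alpha> k)) = 0"
        unfolding mem_FS_iff[OF he AI] using r by blast
      moreover have "B (?e c (\<beta> k)) (?e c' (- \<alpha> k)) = c - c'"
        using r by (auto simp: elation_def B_lin hyp_B[OF hv])
      ultimately show "c = c'" by simp
    qed simp
  next
    show "chamber (?e c \<circ> \<sigma> k) \<in> {M'. (chamber v, M') \<in> pos_rel (\<sigma> k)}" for c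
      unfolding pos_rel_def using eP che oriented_sigma[OF eP k] by (intro CollectI exI[of _ "?e c"]) simp
  next
    fix M' assume "M' \<in> {M'. (chamber v, M') \<in> pos_rel (\<sigma> k)}"
    then obtain v' where v': "v' \<in> oriented" "M' = chamber v'" "(chamber v, chamber v') \<in> pos_rel (\<sigma> k)" using pos_rel_ran by blast
    then have "chamber v \<noteq> chamber v'" "agree k v v'" using pos_rel_sigma_iff[OF v v'(1) k] by auto
    then show "\<exists>c\<in>UNIV. M' = chamber (?e c \<circ> \<sigma> k)"
      using step_chamber[of v id v' k] v v' k ascent_id[OF k] signed_perm_id by auto
  qed
  then show ?thesis by (metis bij_betw_same_card)
qed

end

section \<open>Inversions and the longest element\<close>

text \<open>Each root \<open>e_x - e_y\<close> occurs twice, as \<open>(x, y)\<close> and as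
  \<open>(- y, - x)\<close>, so the cardinality is twice the length. The pairs with
  \<open>y = - x\<close> are left out because \<open>2 e_x\<close> is not a root in type D.\<close>

definition inversions :: "nat \<Rightarrow> (int \<Rightarrow> int) \<Rightarrow> (int \<times> int) set" where
  "inversions n w = {(x, y). x \<in> frame_indices n \<and> y \<in> frame_indices n \<and> y \<noteq> - x \<and>
     rank n x < rank n y \<and> rank n (w y) < rank n (w x)}"

lemma finite_inversions: "finite (inversions n w)"
  by (rule finite_subset[of _ "frame_indices n \<times> frame_indices n"])
    (auto simp: inversions_def frame_indices_def)

lemma rank_minus: "x \<in> frame_indices n \<Longrightarrow> rank n (- x) = 2 * int n + 1 - rank n x"
  by (auto simp: rank_def frame_indices_def)

lemma rank_inj: "x \<in> frame_indices n \<Longrightarrow> y \<in> frame_indices n \<Longrightarrow> rank n x = rank n y \<longleftrightarrow> x = y"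
  by (auto simp: rank_def frame_indices_def split: if_splits)

text \<open>The fact that a simple reflection permutes the positive roots other than its own. In
  terms of ranks, negation is \<open>r \<mapsto> N - r\<close> and the claim is integer
  arithmetic.\<close>

lemma simple_root_unique:
  assumes n: "n \<ge> 2" and k: "k \<in> {1..n}" and x: "x \<in> frame_indices n" and y: "y \<in> frame_indices n" "y \<noteq> - x"
    and less: "rank n x < rank n y"
    and ne: "(x, y) \<noteq> (root_fst n k, root_snd n k)" "(x, y) \<noteq> (- root_snd n k, - root_fst n k)"
  shows "rank n (sigma n k x) < rank n (sigma n k y)"
proof -
  let ?r = "rank n x" and ?s = "rank n y" and ?a = "rank n (root_fst n k)" and ?b = "rank n (root_snd n k)"
  define N where "N = 2 * int n + 1"
  define \<tau> where "\<tau> r = (if r = ?a then ?b else if r = ?b then ?a else if r = N - ?a then N - ?b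
    else if r = N - ?b then N - ?a else r)" for r
  note roots = roots_in[OF n k]
  have mI: "- z \<in> frame_indices n" if "z \<in> frame_indices n" for z using that by (auto simp: frame_indices_def)
  have rm: "rank n (- z) = N - rank n z" if "z \<in> frame_indices n" for z
    using rank_minus[OF that] by (simp add: N_def)
  have eq: "rank n z = rank n z' \<longleftrightarrow> z = z'" "rank n z = N - rank n z' \<longleftrightarrow> z = - z'"
    if "z \<in> frame_indices n" "z' \<in> frame_indices n" for z z'
    using rank_inj[OF that] rank_inj[OF that(1) mI[OF that(2)]] rm[OF that(2)] by auto
  have tau: "rank n (sigma n k z) = \<tau> (rank n z)" if "z \<in> frame_indices n" for z
    unfolding \<tau>_def signed_swap_def sigma_eq_signed_swap[OF n k] eq[OF that roots(1)] eq[OF that roots(2)]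
    using rm roots by simp
  have ne': "\<not> (?r = ?a \<and> ?s = ?b)" "\<not> (?r = N - ?b \<and> ?s = N - ?a)" "?s \<noteq> N - ?r"
    using ne x y eq roots by auto
  \<comment> \<open>The second alternative is \<open>u\<close>: its second index \<open>- n\<close>
    has rank \<open>n + 1\<close>, skipping the rank of \<open>n\<close>.\<close>
  have ab: "?b = ?a + 1 \<and> ?b \<le> int n \<or> ?a = int n - 1 \<and> ?b = int n + 1"
    using k n by (auto simp: rank_def root_fst_def root_snd_def)
  have "\<tau> ?r < \<tau> ?s"
    using ab less ne' unfolding \<tau>_def N_def by (smt (verit))
  then show ?thesis by (simp add: tau x y)
qed

text \<open>The inversions of \<open>w\<close> are carried to the new ones by \<open>?f\<close>,
  except for \<open>?p\<close>, the two copies of the simple root itself.\<close>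

lemma card_inversions_sigma:
  assumes n: "n \<ge> 2" and k: "k \<in> {1..n}" and w: "signed_perm n w"
    and asc: "rank n (w (root_fst n k)) < rank n (w (root_snd n k))"
  shows "card (inversions n (w \<circ> sigma n k)) = card (inversions n w) + 2"
proof -
  let ?a = "root_fst n k" and ?b = "root_snd n k" and ?s = "sigma n k" and ?I = "frame_indices n"
  note r = roots_in[OF n k] and wD = signed_permD[OF w] and sD = signed_permD[OF signed_perm_sigma[OF n k]]
  have mI: "- x \<in> ?I" if "x \<in> ?I" for x using that by (auto simp: frame_indices_def)
  have sr: "?s ?a = ?b" "?s ?b = ?a" using r by (auto simp: sigma_eq_signed_swap[OF n k] signed_swap_def)
  have sr': "?s (- ?a) = - ?b" "?s (- ?b) = - ?a" using sD(2) r(1,2) sr by simp_all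
  have ss: "?s (?s x) = x" for x using sigma_sigma[OF n k] .
  have lt: "rank n ?a < rank n ?b" using n k by (auto simp: rank_def root_fst_def root_snd_def)
  have lt': "rank n (- ?b) < rank n (- ?a)" using lt rank_minus r by simp
  have asc': "rank n (w (- ?b)) < rank n (w (- ?a))" using asc rank_minus wD(1,2) r by simp
  let ?p = "{(?a, ?b), (- ?b, - ?a)}"
  let ?f = "map_prod ?s ?s"
  have move: "?f z \<in> inversions n (w \<circ> ?s) - ?p" if "z \<in> inversions n w" for z
  proof -
    obtain x y where z: "z = (x, y)" by (cases z)
    have xy: "x \<in> ?I" "y \<in> ?I" "y \<noteq> - x" "rank n x < rank n y" "rank n (w y) < rank n (w x)"
      using that by (auto simp: z inversions_def)
    have ne: "(x, y) \<noteq> (?a, ?b)" "(x, y) \<noteq> (- ?b, - ?a)" using xy asc asc' by auto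
    have "?s y \<noteq> - ?s x" using sD(2)[OF xy(1)] sD(3)[OF xy(2) mI[OF xy(1)]] xy(3) by simp
    moreover have "(?s x, ?s y) \<notin> ?p"
    proof
      assume "(?s x, ?s y) \<in> ?p"
      then have "(?s (?s x), ?s (?s y)) \<in> {(?b, ?a), (- ?a, - ?b)}" using sr sr' by auto
      then show False using ss xy(4) lt lt' by auto
    qed
    ultimately show ?thesis
      using sD(1) xy simple_root_unique[OF n k xy(1,2,3,4) ne] by (simp add: z inversions_def ss)
  qed
  have bwd: "?f z \<in> inversions n w" if "z \<in> inversions n (w \<circ> ?s) - ?p" for z
  proof -
    obtain x y where z: "z = (x, y)" by (cases z)
    have xy: "x \<in> ?I" "y \<in> ?I" "y \<noteq> - x" "rank n x < rank n y" "rank n (w (?s y)) < rank n (w (?s x))"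
      and ne: "(x, y) \<noteq> (?a, ?b)" "(x, y) \<noteq> (- ?b, - ?a)"
      using that by (auto simp: z inversions_def)
    have "?s y \<noteq> - ?s x" using sD(2)[OF xy(1)] sD(3)[OF xy(2) mI[OF xy(1)]] xy(3) by simp
    then show ?thesis
      using sD(1) xy simple_root_unique[OF n k xy(1,2,3,4) ne] by (simp add: z inversions_def)
  qed
  have "bij_betw ?f (inversions n w) (inversions n (w \<circ> ?s) - ?p)"
  proof (rule bij_betwI[where g = ?f])
    show "?f \<in> inversions n w \<rightarrow> inversions n (w \<circ> ?s) - ?p" using move by blast
    show "?f \<in> inversions n (w \<circ> ?s) - ?p \<rightarrow> inversions n w" using bwd by blast
  qed (auto simp: ss)
  then have 1: "card (inversions n (w \<circ> ?s) - ?p) = card (inversions n w)" by (rule bij_betw_same_card[symmetric])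
  have p: "?p \<subseteq> inversions n (w \<circ> ?s)"
    using r lt lt' asc asc' mI by (auto simp: inversions_def sr sr')
  have "?a \<noteq> - ?b" using r by blast
  then have "card ?p = 2" by simp
  moreover have "card ?p \<le> card (inversions n (w \<circ> ?s))" using p finite_inversions by (rule card_mono[rotated])
  moreover have "card (inversions n (w \<circ> ?s) - ?p) = card (inversions n (w \<circ> ?s)) - card ?p"
    using p by (intro card_Diff_subset) auto
  ultimately show ?thesis using 1 by simp
qed

text \<open>Type B contains the extra symmetry \<open>twist n\<close> of the simple roots of type D,
  hence two solutions. Without descents \<open>w\<close> is positive and increasing on
  \<open>1, ..., n - 1\<close> and stays below the absolute value of \<open>w n\<close>, which
  leaves no other choice.\<close>

lemma no_descent:
  assumes n: "n \<ge> 2" and w: "signed_perm n w"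
    and nd: "\<And>k. k \<in> {1..n} \<Longrightarrow> rank n (w (root_fst n k)) < rank n (w (root_snd n k))"
  shows "(\<forall>i\<in>frame_indices n. w i = i) \<or> (\<forall>i\<in>frame_indices n. w i = twist n i)"
proof -
  note wD = signed_permD[OF w]
  have wI: "w (int i) \<noteq> 0" "\<bar>w (int i)\<bar> \<le> int n" if "1 \<le> i" "i \<le> n" for i
    using wD(1)[of "int i"] that by (auto simp: frame_indices_def)
  have A: "rank n (w (int i)) < rank n (w (int i + 1))" if "1 \<le> i" "i < n" for i
    using nd[of i] that by (simp add: root_fst_def root_snd_def)
  have Bn: "rank n (w (int (n - 1))) < rank n (- w (int n))"
    using nd[of n] wD(2)[of "int n"] n by (simp add: root_fst_def root_snd_def frame_indices_def)
  obtain m where m: "n = Suc m" "m \<ge> 1" using n by (cases n) auto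
  have An: "rank n (w (int m)) < rank n (w (int n))" using A[of m] m by (simp add: add.commute)
  have wm: "0 < w (int m)" "w (int m) < \<bar>w (int n)\<bar>"
    using An Bn wI[of m] wI[of n] m by (auto simp: rank_def split: if_splits)
  have step: "0 < w (int i) \<and> w (int i) < w (int i + 1)" if "1 \<le> i" "i < m" "0 < w (int i + 1)" for i
    using A[of i] that wI[of i] wI[of "Suc i"] m by (auto simp: rank_def add.commute split: if_splits)
  have pos: "0 < w (int (m - j))" if "j < m" for j
    using that
  proof (induction j)
    case (Suc j)
    have e: "int (m - Suc j) + 1 = int (m - j)" using Suc.prems by simp
    show ?case using step[of "m - Suc j"] Suc unfolding e by simp
  qed (use wm in simp)
  have pos': "0 < w (int i)" if "1 \<le> i" "i \<le> m" for i
    using pos[of "m - i"] that by (simp add: of_nat_diff)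
  have incr: "w (int i) < w (int i + 1)" if "1 \<le> i" "i < m" for i
    using step[of i] pos'[of "Suc i"] that by (simp add: add.commute)
  have low: "int i \<le> w (int i)" if "1 \<le> i" "i \<le> m" for i
    using that
  proof (induction i rule: nat_induct_at_least)
    case base then show ?case using pos'[of 1] by simp
  next
    case (Suc i) then show ?case using incr[of i] by (simp add: add.commute)
  qed
  have up: "w (int (m - j)) \<le> int (m - j)" if "j < m" for j
    using that
  proof (induction j)
    case 0 then show ?case using wm wI[of n] m by simp
  next
    case (Suc j)
    have e: "int (m - Suc j) + 1 = int (m - j)" using Suc.prems by simp
    have "1 \<le> m - Suc j" "m - Suc j < m" "w (int (m - j)) \<le> int (m - j)" using Suc by simp_all
    moreover have "w (int (m - Suc j)) < w (int (m - j))" using incr[of "m - Suc j"] calculation unfolding e by blast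
    ultimately show ?case using e by linarith
  qed
  have id: "w (int i) = int i" if "1 \<le> i" "i \<le> m" for i
    using low[OF that] up[of "m - i"] that by simp
  have "\<bar>w (int n)\<bar> = int n" using wm id[of m] wI[of n] m by simp
  have idm: "w (- int i) = - w (int i)" if "1 \<le> i" "i \<le> n" for i
    using wD(2)[of "int i"] that by (simp add: frame_indices_def)
  have all: "(\<forall>i\<in>frame_indices n. w i = f i)"
    if f: "\<And>i. 1 \<le> i \<Longrightarrow> i \<le> n \<Longrightarrow> w (int i) = f (int i)" "\<And>i. 1 \<le> i \<Longrightarrow> i \<le> n \<Longrightarrow> f (- int i) = - f (int i)" for f
  proof
    fix i assume i: "i \<in> frame_indices n"
    show "w i = f i"
    proof (cases "i > 0")
      case True
      then show ?thesis using f(1)[of "nat i"] i by (simp add: frame_indices_def)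
    next
      case False
      define j where "j = nat (- i)"
      have j: "1 \<le> j" "j \<le> n" "i = - int j" using False i by (auto simp: j_def frame_indices_def)
      then show ?thesis using f[OF j(1,2)] idm[OF j(1,2)] by simp
    qed
  qed
  show ?thesis
  proof (cases "w (int n) = int n")
    case True
    then have "w (int i) = int i" if "1 \<le> i" "i \<le> n" for i using id[of i] that m by (cases "i = n") auto
    then have "\<forall>i\<in>frame_indices n. w i = i" by (intro all) simp_all
    then show ?thesis by (rule disjI1)
  next
    case False
    then have "w (int n) = - int n" using \<open>\<bar>w (int n)\<bar> = int n\<close> by linarith
    then have "w (int i) = twist n (int i)" if "1 \<le> i" "i \<le> n" for i
      using id[of i] that m by (cases "i = n") (auto simp: twist_eq)
    moreover have "twist n (- int i) = - twist n (int i)" if "1 \<le> i" "i \<le> n" for i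
      using that by (simp add: twist_eq)
    ultimately have "\<forall>i\<in>frame_indices n. w i = twist n i" by (intro all)
    then show ?thesis by (rule disjI2)
  qed
qed

section \<open>The longest element and the braid relations\<close>

lemma w0_w0: "w0 n (w0 n x) = x" by (simp add: w0_def)

lemma signed_perm_w0: "signed_perm n (w0 n)"
proof -
  have "bij_betw (w0 n) (frame_indices n) (frame_indices n)"
    by (rule bij_betwI[of _ _ _ "w0 n"]) (auto simp: w0_w0, auto simp: w0_def frame_indices_def)
  then show ?thesis by (auto simp: signed_perm_def w0_def)
qed

lemma rank_w0:
  assumes "x \<in> frame_indices n" "y \<in> frame_indices n" "y \<noteq> - x" "rank n x < rank n y"
  shows "rank n (w0 n y) < rank n (w0 n x)"
  using assms by (auto simp: rank_def w0_def frame_indices_def split: if_splits)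

text \<open>All pairs of increasing rank with \<open>y \<noteq> - x\<close> are inverted, for odd
  \<open>n\<close> as well, where the only exception is the excluded pair of \<open>n\<close> and
  \<open>- n\<close>. They are half of the \<open>2 n (2 n - 2)\<close> ordered pairs.\<close>

lemma card_inversions_w0: "card (inversions n (w0 n)) = 2 * (n * (n - 1))"
proof -
  let ?I = "frame_indices n"
  let ?T = "inversions n (w0 n)"
  have T: "?T = {(x, y). x \<in> ?I \<and> y \<in> ?I \<and> y \<noteq> - x \<and> rank n x < rank n y}"
    using rank_w0 by (auto simp: inversions_def)
  have finI: "finite ?I" by (simp add: frame_indices_def)
  have cI: "card ?I = 2 * n"
  proof -
    have "card ({- int n..int n} - {0}) = card {- int n..int n} - 1" by (subst card_Diff_subset) auto
    then show ?thesis by (simp add: frame_indices_def)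
  qed
  have un: "?T \<union> prod.swap ` ?T = Sigma ?I (\<lambda>x. ?I - {x, - x})"
  proof (intro equalityI subsetI)
    fix z assume "z \<in> ?T \<union> prod.swap ` ?T"
    then show "z \<in> Sigma ?I (\<lambda>x. ?I - {x, - x})" by (auto simp: T)
  next
    fix z assume z: "z \<in> Sigma ?I (\<lambda>x. ?I - {x, - x})"
    obtain x y where xy: "z = (x, y)" by (cases z)
    have "x \<in> ?I" "y \<in> ?I" "y \<noteq> x" "y \<noteq> - x" using z xy by auto
    then have "rank n x \<noteq> rank n y" using rank_inj by blast
    then consider "rank n x < rank n y" | "rank n y < rank n x" by linarith
    then show "z \<in> ?T \<union> prod.swap ` ?T"
    proof cases
      case 1 then show ?thesis using \<open>x \<in> ?I\<close> \<open>y \<in> ?I\<close> \<open>y \<noteq> - x\<close> by (simp add: T xy)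
    next
      case 2 
      then have "(y, x) \<in> ?T" using \<open>x \<in> ?I\<close> \<open>y \<in> ?I\<close> \<open>y \<noteq> - x\<close> by (auto simp: T)
      then show ?thesis unfolding xy by force
    qed
  qed
  have disj: "?T \<inter> prod.swap ` ?T = {}" by (auto simp: T)
  have fT: "finite ?T" by (rule finite_inversions)
  have "card (prod.swap ` ?T) = card ?T" by (intro card_image) simp
  then have "2 * card ?T = card (Sigma ?I (\<lambda>x. ?I - {x, - x}))"
    using card_Un_disjoint[OF fT finite_imageI[OF fT] disj] unfolding un by simp
  also have "\<dots> = (\<Sum>x\<in>?I. card (?I - {x, - x}))" using finI by simp
  also have "\<dots> = (\<Sum>x\<in>?I. 2 * n - 2)"
  proof (rule sum.cong)
    fix x assume x: "x \<in> ?I"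
    then have "{x, - x} \<subseteq> ?I" "x \<noteq> - x" by (auto simp: frame_indices_def)
    then show "card (?I - {x, - x}) = 2 * n - 2" by (simp add: card_Diff_subset cI)
  qed simp
  also have "\<dots> = 2 * n * (2 * n - 2)" by (simp add: cI)
  finally show ?thesis by (simp add: right_diff_distrib' mult.assoc)
qed

lemma signed_swap_equivariant:
  assumes w: "signed_perm n w" and ab: "a \<in> frame_indices n" "b \<in> frame_indices n" and x: "x \<in> frame_indices n"
  shows "w (signed_swap a b x) = signed_swap (w a) (w b) (w x)"
proof -
  note wD = signed_permD[OF w]
  have mI: "- z \<in> frame_indices n" if "z \<in> frame_indices n" for z using that by (auto simp: frame_indices_def)
  have "w x = w a \<longleftrightarrow> x = a" "w x = w b \<longleftrightarrow> x = b" "w x = - w a \<longleftrightarrow> x = - a" "w x = - w b \<longleftrightarrow> x = - b"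
    using wD(3)[OF x ab(1)] wD(3)[OF x ab(2)] wD(3)[OF x mI[OF ab(1)]] wD(3)[OF x mI[OF ab(2)]]
      wD(2)[OF ab(1)] wD(2)[OF ab(2)] by simp_all
  then show ?thesis using wD(2)[OF ab(1)] wD(2)[OF ab(2)] by (simp add: signed_swap_def)
qed

lemma signed_swap_minus: "a \<noteq> b \<Longrightarrow> a \<noteq> - b \<Longrightarrow> a \<noteq> 0 \<Longrightarrow> b \<noteq> 0 \<Longrightarrow> signed_swap (- a) (- b) = signed_swap a b"
  by (rule ext) (simp add: signed_swap_def)

text \<open>For even \<open>n\<close>, \<open>w0\<close> negates every root and commutes with the
  reflections. For odd \<open>n\<close> it fixes \<open>n\<close>, which exchanges
  \<open>s_(n-1)\<close> and \<open>u\<close>.\<close>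

lemma w0_sigma:
  assumes n: "n \<ge> 2" and k: "k \<in> {1..n}"
  shows "\<exists>l\<in>{1..n}. (\<forall>x\<in>frame_indices n. sigma n k (w0 n x) = w0 n (sigma n l x)) \<and>
    (\<forall>x\<in>frame_indices n. sigma n l (w0 n x) = w0 n (sigma n k x))"
proof -
  define l where "l = (if even n \<or> k < n - 1 then k else if k = n then n - 1 else n)"
  have l: "l \<in> {1..n}" using n k by (auto simp: l_def)
  have "k = n \<or> k = n - 1 \<or> k < n - 1" using k by auto
  then have "l = k \<and> (even n \<or> k < n - 1) \<or> odd n \<and> k = n \<and> l = n - 1 \<or> odd n \<and> k = n - 1 \<and> l = n"
    using n unfolding l_def by auto
  then consider "l = k" "even n \<or> k < n - 1" | "odd n" "k = n" "l = n - 1" | "odd n" "k = n - 1" "l = n"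
    by blast
  then have eq: "signed_swap (w0 n (root_fst n l)) (w0 n (root_snd n l)) = signed_swap (root_fst n k) (root_snd n k)"
  proof cases
    case 1
    then have "w0 n (root_fst n l) = - root_fst n k" "w0 n (root_snd n l) = - root_snd n k"
      using k by (auto simp: root_fst_def root_snd_def w0_def)
    moreover have "root_fst n k \<noteq> 0" "root_snd n k \<noteq> 0"
      using roots_in(1,2)[OF n k] by (auto simp: frame_indices_def)
    ultimately show ?thesis using roots_in(3,4)[OF n k] by (simp add: signed_swap_minus)
  next
    case 2
    then have "w0 n (root_fst n l) = - (int n - 1)" "w0 n (root_snd n l) = int n"
      using n by (auto simp: root_fst_def root_snd_def w0_def of_nat_diff)
    moreover have "root_fst n k = int n - 1" "root_snd n k = - int n"
      using 2 n by (auto simp: root_fst_def root_snd_def of_nat_diff)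
    ultimately show ?thesis using signed_swap_minus[of "int n - 1" "- int n"] n by simp
  next
    case 3
    then have "w0 n (root_fst n l) = - (int n - 1)" "w0 n (root_snd n l) = - int n"
      using n by (auto simp: root_fst_def root_snd_def w0_def of_nat_diff)
    moreover have "root_fst n k = int n - 1" "root_snd n k = int n"
      using 3 n by (auto simp: root_fst_def root_snd_def of_nat_diff)
    ultimately show ?thesis using signed_swap_minus[of "int n - 1" "int n"] n by simp
  qed
  have 1: "sigma n k (w0 n x) = w0 n (sigma n l x)" if "x \<in> frame_indices n" for x
    using signed_swap_equivariant[OF signed_perm_w0 roots_in(1,2)[OF n l] that] eq
    by (simp add: sigma_eq_signed_swap[OF n k] sigma_eq_signed_swap[OF n l])
  have 2: "sigma n l (w0 n x) = w0 n (sigma n k x)" if "x \<in> frame_indices n" for x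
    using 1[of "w0 n x"] signed_permD(1)[OF signed_perm_w0 that] by (metis w0_w0)
  show ?thesis using l 1 2 by blast
qed

lemma sigma_braid:
  assumes n: "n \<ge> 4" and kl: "l = k + 1 \<and> k \<ge> 1 \<and> l < n \<or> k = n - 2 \<and> l = n" and x: "x \<in> frame_indices n"
  shows "sigma n k (sigma n l (sigma n k x)) = sigma n l (sigma n k (sigma n l x))"
    "rank n (sigma n k (root_fst n l)) < rank n (sigma n k (root_snd n l))"
    "rank n (sigma n l (root_fst n k)) < rank n (sigma n l (root_snd n k))"
    "rank n (sigma n k (sigma n l (root_fst n k))) < rank n (sigma n k (sigma n l (root_snd n k)))"
    "rank n (sigma n l (sigma n k (root_fst n l))) < rank n (sigma n l (sigma n k (root_snd n l)))"
proof -
  have n2: "n \<ge> 2" and k: "k \<in> {1..n}" and l: "l \<in> {1..n}" using n kl by auto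
  \<comment> \<open>The two reflections swap neighbours in the triple \<open>a, b, c\<close>; both
    sides of the relation are then the swap of \<open>a\<close> and \<open>c\<close>.\<close>
  obtain a b c :: int where abc: "root_fst n k = a" "root_snd n k = b" "root_fst n l = b \<and> root_snd n l = c"
    "1 \<le> a" "b = a + 1" "c = b + 1 \<and> b < int n \<or> c = - int n \<and> a = int n - 2"
  proof (cases "l < n")
    case True
    then show ?thesis using kl
      by (intro that[of "int k" "int k + 1" "int k + 2"]) (auto simp: root_fst_def root_snd_def)
  next
    case False
    then have "k = n - 2" "l = n" using kl by auto
    then show ?thesis using n
      by (intro that[of "int n - 2" "int n - 1" "- int n"]) (auto simp: root_fst_def root_snd_def of_nat_diff)
  qed
  note * = sigma_eq_signed_swap[OF n2 k] sigma_eq_signed_swap[OF n2 l]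
  have d: "a \<noteq> b" "a \<noteq> c" "b \<noteq> c" "a \<noteq> - b" "a \<noteq> - c" "b \<noteq> - c" "a \<noteq> 0" "b \<noteq> 0" "c \<noteq> 0"
  proof -
    have "0 < a" "a < b" "b < c \<or> c = - int n \<and> a + 2 = int n" using abc(4,5,6) by linarith+
    then show "a \<noteq> b" "a \<noteq> c" "b \<noteq> c" "a \<noteq> - b" "a \<noteq> - c" "b \<noteq> - c" "a \<noteq> 0" "b \<noteq> 0" "c \<noteq> 0"
      using abc(5) n by linarith+
  qed
  have s: "signed_swap a b a = b" "signed_swap a b b = a" "signed_swap a b c = c" "signed_swap b c a = a" "signed_swap b c b = c" "signed_swap b c c = b"
    using d by (auto simp: signed_swap_def)
  have k': "sigma n k = signed_swap a b" and l': "sigma n l = signed_swap b c" using * abc by simp_all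
  show "sigma n k (sigma n l (sigma n k x)) = sigma n l (sigma n k (sigma n l x))"
  proof -
    have abI: "a \<in> frame_indices n" "b \<in> frame_indices n" "c \<in> frame_indices n"
      using roots_in[OF n2 k] roots_in[OF n2 l] abc by auto
    have sp: "signed_perm n (signed_swap a b)" "signed_perm n (signed_swap b c)"
      using abI d by (auto intro: signed_perm_signed_swap)
    have "signed_swap a b (signed_swap b c (signed_swap a b x)) = signed_swap a c x"
      using signed_swap_equivariant[OF sp(1) abI(2,3) signed_permD(1)[OF sp(1) x]] signed_swap_signed_swap[of a b x] d by (simp add: s)
    moreover have "signed_swap b c (signed_swap a b (signed_swap b c x)) = signed_swap a c x"
      using signed_swap_equivariant[OF sp(2) abI(1,2) signed_permD(1)[OF sp(2) x]] signed_swap_signed_swap[of b c x] d by (simp add: s)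
    ultimately show ?thesis by (simp add: k' l')
  qed
  have "rank n a < rank n b" "rank n b < rank n c"
    using abc(4,5,6) n by (auto simp: rank_def)
  then show "rank n (sigma n k (root_fst n l)) < rank n (sigma n k (root_snd n l))"
    "rank n (sigma n l (root_fst n k)) < rank n (sigma n l (root_snd n k))"
    "rank n (sigma n k (sigma n l (root_fst n k))) < rank n (sigma n k (sigma n l (root_snd n k)))"
    "rank n (sigma n l (sigma n k (root_fst n l))) < rank n (sigma n l (sigma n k (root_snd n l)))"
    unfolding k' l' using abc(1,2,3) by (simp_all add: s)
qed

section \<open>EKR-sets of chambers\<close>

context hyperbolic_quadric
begin

definition chambers :: "('a ^ 'm) set set set" where "chambers = chamber ` oriented"

text \<open>The index type consists of all sets of sets of vectors, which is finite. Functions on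
  chambers are the vectors supported on \<open>chambers\<close>, singled out by
  \<open>chamber_functions\<close>.\<close>

definition pos_op :: "(int \<Rightarrow> int) \<Rightarrow> real ^ (('a ^ 'm) set set) \<Rightarrow> real ^ (('a ^ 'm) set set)" where
  "pos_op w f = (\<chi> M. \<Sum>M'\<in>{M'. (M, M') \<in> pos_rel w}. f $ M')"

definition chamber_functions :: "(real ^ (('a ^ 'm) set set)) set" where "chamber_functions = {f. \<forall>M. M \<notin> chambers \<longrightarrow> f $ M = 0}"

lemma pos_rel_in_chambers: "(M, M') \<in> pos_rel w \<Longrightarrow> M \<in> chambers \<and> M' \<in> chambers"
  by (auto simp: pos_rel_def chambers_def)

lemma pos_op_linear: "linear (pos_op w)"
  by (auto simp: linear_iff pos_op_def vec_eq_iff sum.distrib sum_distrib_left)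

lemma pos_op_chamber_functions: "pos_op w f \<in> chamber_functions"
proof -
  have "{M'. (M, M') \<in> pos_rel w} = {}" if "M \<notin> chambers" for M using pos_rel_in_chambers that by blast
  then show ?thesis by (simp add: chamber_functions_def pos_op_def)
qed

lemma subspace_chamber_functions: "subspace chamber_functions"
  by (auto simp: subspace_def chamber_functions_def)

text \<open>Every chamber in position \<open>w \<circ> \<sigma> k\<close> is reached through exactly
  one intermediate chamber, so the double sum has no multiplicities.\<close>

lemma pos_op_comp:
  assumes w: "signed_perm n w" and k: "k \<in> {1..n}" and asc: "ascent w k"
  shows "pos_op w (pos_op (\<sigma> k) f) = pos_op (w \<circ> \<sigma> k) f"
proof -
  have "pos_op w (pos_op (\<sigma> k) f) $ M = pos_op (w \<circ> \<sigma> k) f $ M" for M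
  proof -
    let ?S = "Sigma {M'. (M, M') \<in> pos_rel w} (\<lambda>M'. {M''. (M', M'') \<in> pos_rel (\<sigma> k)})"
    have "bij_betw snd ?S {M''. (M, M'') \<in> pos_rel (w \<circ> \<sigma> k)}"
      unfolding bij_betw_def
    proof
      show "inj_on snd ?S"
        using pos_rel_unique[OF _ _ _ _ w k asc] by (auto simp: inj_on_def)
      show "snd ` ?S = {M''. (M, M'') \<in> pos_rel (w \<circ> \<sigma> k)}"
      proof (intro equalityI subsetI)
        fix M'' assume "M'' \<in> snd ` ?S"
        then show "M'' \<in> {M''. (M, M'') \<in> pos_rel (w \<circ> \<sigma> k)}" using pos_rel_comp[OF _ _ w k asc] by auto
      next
        fix M'' assume "M'' \<in> {M''. (M, M'') \<in> pos_rel (w \<circ> \<sigma> k)}"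
        then obtain M' where "(M, M') \<in> pos_rel w" "(M', M'') \<in> pos_rel (\<sigma> k)" using pos_rel_factor[OF _ k] by blast
        then show "M'' \<in> snd ` ?S" by force
      qed
    qed
    from sum.reindex_bij_betw[OF this, of "\<lambda>M''. f $ M''"]
    show ?thesis by (simp add: pos_op_def sum.Sigma case_prod_unfold)
  qed
  then show ?thesis by (simp add: vec_eq_iff)
qed

lemma pos_op_inner:
  assumes "w \<circ> w' = id" "w' \<circ> w = id"
  shows "pos_op w f \<bullet> g = f \<bullet> pos_op w' g"
proof -
  have e: "(\<Sum>M'\<in>{M'. (M, M') \<in> pos_rel w}. h M') = (\<Sum>M'\<in>UNIV. if (M, M') \<in> pos_rel w then h M' else 0)"
    for M w and h :: "('a ^ 'm) set set \<Rightarrow> real"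
    by (simp add: sum.If_cases)
  have "pos_op w f \<bullet> g = (\<Sum>M\<in>UNIV. \<Sum>M'\<in>UNIV. if (M, M') \<in> pos_rel w then f $ M' * g $ M else 0)"
    unfolding inner_vec_def pos_op_def by (simp add: e sum_distrib_right if_distrib[of "\<lambda>x. x * _"] cong: if_cong)
  also have "\<dots> = (\<Sum>M'\<in>UNIV. \<Sum>M\<in>UNIV. if (M, M') \<in> pos_rel w then f $ M' * g $ M else 0)"
    by (rule sum.swap)
  also have "\<dots> = (\<Sum>M'\<in>UNIV. \<Sum>M\<in>UNIV. if (M', M) \<in> pos_rel w' then f $ M' * g $ M else 0)"
    by (simp add: pos_rel_converse[OF assms])
  also have "\<dots> = f \<bullet> pos_op w' g"
    unfolding inner_vec_def pos_op_def by (simp add: e sum_distrib_left if_distrib[of "\<lambda>x. _ * x"] cong: if_cong)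
  finally show ?thesis .
qed

lemma pos_op_cong: "(\<And>i. i \<in> I \<Longrightarrow> w i = w' i) \<Longrightarrow> pos_op w = pos_op w'"
  by (rule ext) (simp add: pos_op_def pos_rel_cong[of w w'])

lemma pos_op_id: "f \<in> chamber_functions \<Longrightarrow> pos_op id f = f"
proof -
  assume f: "f \<in> chamber_functions"
  have "{M'. (M, M') \<in> pos_rel id} = (if M \<in> chambers then {M} else {})" for M
    by (auto simp: pos_rel_def chambers_def)
  then show ?thesis using f by (simp add: pos_op_def chamber_functions_def vec_eq_iff)
qed

lemma tw_not_oriented: "v \<in> oriented \<Longrightarrow> v \<circ> tw \<notin> oriented"
proof
  assume v: "v \<in> oriented" "v \<circ> tw \<in> oriented"
  have h: "hyperbolic_basis v" using oriented_hyp v by blast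
  have "same_class n (twin v) (seg v0 n)" "same_class n (seg v n) (seg v0 n)"
    using v by (simp_all add: oriented_def seg_tw)
  then have "same_class n (twin v) (seg v n)"
    using same_class_iff[of "twin v" "seg v n" "seg v0 n"] seg_gen twin_gen h hyp0 by blast
  then show False using seg_Nt_class[OF h] by blast
qed

text \<open>Descents are split off on the right until none is left. The remaining element is the
  identity or \<open>tw\<close> on the frame, and \<open>tw\<close> is impossible because both bases
  are oriented.\<close>

lemma pos_op_word:
  assumes "signed_perm n w" "v \<in> oriented" "v \<circ> w \<in> oriented"
  shows "\<exists>ks. set ks \<subseteq> {1..n} \<and> 2 * length ks = card (inversions n w) \<and>
    (\<forall>f\<in>chamber_functions. pos_op w f = foldr (\<lambda>k. pos_op (\<sigma> k)) ks f)"
  using assms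
proof (induction "card (inversions n w)" arbitrary: w rule: less_induct)
  case less
  note w = less.prems(1)
  show ?case
  proof (cases "\<forall>k\<in>{1..n}. ascent w k")
    case True
    then have "(\<forall>i\<in>I. w i = i) \<or> (\<forall>i\<in>I. w i = tw i)"
      using no_descent[OF n2 w] by (auto simp: ascent_def)
    moreover have "\<not> (\<forall>i\<in>I. w i = tw i)"
    proof
      assume "\<forall>i\<in>I. w i = tw i"
      then have "v \<circ> w \<in> oriented \<longleftrightarrow> v \<circ> tw \<in> oriented" by (intro oriented_cong) simp
      then show False using tw_not_oriented[OF less.prems(2)] less.prems(3) by blast
    qed
    ultimately have id: "\<forall>i\<in>I. w i = i" by blast
    then have "pos_op w = pos_op id" by (intro pos_op_cong) simp
    moreover have "inversions n w = {}" using id by (auto simp: inversions_def)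
    ultimately show ?thesis using pos_op_id by (intro exI[of _ "[]"]) simp
  next
    case False
    then obtain k where k: "k \<in> {1..n}" "\<not> ascent w k" by blast
    note wD = signed_permD[OF w] and r = roots[OF k(1)]
    define w' where "w' = w \<circ> \<sigma> k"
    have ww: "w = w' \<circ> \<sigma> k" using sigma_inv'[OF k(1)] by (simp add: w'_def comp_assoc)
    have w': "signed_perm n w'" unfolding w'_def using w sp_sigma[OF k(1)] by (rule signed_perm_comp)
    have asc: "ascent w' k"
      using k(2) rank_inj[OF wD(1)[OF r(1)] wD(1)[OF r(2)]] wD(3)[OF r(1,2)] r(3)
      by (simp add: ascent_def w'_def sigma_roots[OF k(1)])
    have c: "card (inversions n w) = card (inversions n w') + 2"
      using card_inversions_sigma[OF n2 k(1) w'] asc unfolding ww ascent_def by blast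
    have "v \<circ> w' \<in> oriented" using oriented_sigma[OF less.prems(3) k(1)] by (simp add: w'_def comp_assoc)
    then obtain ks where ks: "set ks \<subseteq> {1..n}" "2 * length ks = card (inversions n w')"
      "\<And>f. f \<in> chamber_functions \<Longrightarrow> pos_op w' f = foldr (\<lambda>k. pos_op (\<sigma> k)) ks f"
      using less.hyps[of w'] c w' less.prems(2) by auto
    have "pos_op w f = foldr (\<lambda>k. pos_op (\<sigma> k)) (ks @ [k]) f" if "f \<in> chamber_functions" for f
      using pos_op_comp[OF w' k(1) asc, of f] ks(3)[OF pos_op_chamber_functions] by (simp add: ww[symmetric])
    then show ?thesis using ks c k by (intro exI[of _ "ks @ [k]"]) auto
  qed
qed

text \<open>The two spans of the first \<open>n\<close> vectors meet in dimension 0 or 1 according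
  to the parity of \<open>n\<close>, hence are in the same class.\<close>

lemma w0_oriented:
  assumes v: "v \<in> oriented" shows "v \<circ> w0 n \<in> oriented"
proof -
  have h: "hyperbolic_basis v" and h': "hyperbolic_basis (v \<circ> w0 n)"
    using v oriented_hyp hyp_comp signed_perm_w0 by auto
  have "{1..int n} \<inter> w0 n ` {1..int n} = (if even n then {} else {int n})"
  proof (cases "even n")
    case False
    then have "w0 n (int n) = int n" by (simp add: w0_def)
    then have "int n \<in> w0 n ` {1..int n}" using n4 by (intro image_eqI[of _ _ "int n"]) auto
    then show ?thesis using False n4 by (auto simp: w0_def split: if_splits)
  qed (auto simp: w0_def)
  then have "seg v n \<inter> seg (v \<circ> w0 n) n = bspan v (if even n then {} else {int n})"
    using bspan_Int[OF h pos_I[of n] signed_permD(4)[OF signed_perm_w0 pos_I[of n]]] by (simp add: seg_def bspan_comp)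
  moreover have "(if even n then {} else {int n}) \<subseteq> I" using n4 by (auto simp: I_iff)
  ultimately have "vec.dim (seg v n \<inter> seg (v \<circ> w0 n) n) = card (if even n then {} else {int n})"
    using dim_bspan[OF h] by metis
  then have "same_class n (seg v n) (seg (v \<circ> w0 n) n)" by (auto simp: same_class_def mod_2_eq_odd)
  then have "same_class n (seg (v \<circ> w0 n) n) (seg v0 n)"
    using same_class_iff[of "seg v n" "seg (v \<circ> w0 n) n" "seg v0 n"] seg_gen h h' hyp0 v by (auto simp: oriented_def)
  then show ?thesis using h' by (simp add: oriented_def)
qed

lemma v0_oriented: "v0 \<in> oriented"
  using hyp0 dim_seg[OF hyp0] by (simp add: oriented_def same_class_def)

text \<open>On a panel of \<open>CARD('a) + 1\<close> chambers the operator is the all-ones matrix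
  minus the identity.\<close>

lemma pos_op_square:
  assumes k: "k \<in> {1..n}" and f: "f \<in> chamber_functions"
  shows "pos_op (\<sigma> k) (pos_op (\<sigma> k) f) = (real CARD('a) - 1) *\<^sub>R pos_op (\<sigma> k) f + real CARD('a) *\<^sub>R f"
proof -
  let ?N = "\<lambda>M. {M'. (M, M') \<in> pos_rel (\<sigma> k)}"
  have "pos_op (\<sigma> k) (pos_op (\<sigma> k) f) $ M = ((real CARD('a) - 1) *\<^sub>R pos_op (\<sigma> k) f + real CARD('a) *\<^sub>R f) $ M" for M
  proof (cases "M \<in> chambers")
    case False
    then show ?thesis using pos_op_chamber_functions f by (auto simp: chamber_functions_def)
  next
    case True
    then obtain v where v: "v \<in> oriented" "M = chamber v" by (auto simp: chambers_def)
    have card: "card (?N M) = CARD('a)" using pos_rel_degree[OF v(1) k] v by simp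
    have MN: "M \<notin> ?N M" using pos_rel_sigma_iff[OF v(1) v(1) k] v by simp
    \<comment> \<open>The sum over the whole panel; each neighbour sees this sum without its own
      term.\<close>
    define S where "S = (\<Sum>M'\<in>?N M. f $ M') + f $ M"
    have nb: "(\<Sum>M''\<in>?N M'. f $ M'') = S - f $ M'" if M': "M' \<in> ?N M" for M'
    proof -
      obtain v' where v': "v' \<in> oriented" "M' = chamber v'" using M' pos_rel_ran by blast
      have a: "agree k v v'" "M \<noteq> M'" using pos_rel_sigma_iff[OF v(1) v'(1) k] M' v v' by auto
      have "?N M' = insert M (?N M) - {M'}"
      proof (intro equalityI subsetI)
        fix M'' assume m: "M'' \<in> ?N M'"
        obtain u where u: "u \<in> oriented" "M'' = chamber u" using m pos_rel_ran by blast
        have "agree k v' u" "M' \<noteq> M''" using pos_rel_sigma_iff[OF v'(1) u(1) k] m v' u by auto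
        then show "M'' \<in> insert M (?N M) - {M'}"
          using pos_rel_sigma_iff[OF v(1) u(1) k] agree_trans[OF a(1)] v u by auto
      next
        fix M'' assume m: "M'' \<in> insert M (?N M) - {M'}"
        then obtain u where u: "u \<in> oriented" "M'' = chamber u" using pos_rel_ran v by blast
        have "agree k v u"
          using m pos_rel_sigma_iff[OF v(1) u(1) k] agree_cong[OF v(1) u(1)] v u by auto
        then have "agree k v' u" using a(1) agree_sym agree_trans by blast
        then show "M'' \<in> ?N M'" using pos_rel_sigma_iff[OF v'(1) u(1) k] m v' u by auto
      qed
      then have "(\<Sum>M''\<in>?N M'. f $ M'') = (\<Sum>M''\<in>insert M (?N M). f $ M'') - f $ M'"
        using M' by (simp add: sum_diff1)
      then show ?thesis using MN by (simp add: S_def)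
    qed
    have "pos_op (\<sigma> k) (pos_op (\<sigma> k) f) $ M = (\<Sum>M'\<in>?N M. \<Sum>M''\<in>?N M'. f $ M'')" by (simp add: pos_op_def)
    also have "\<dots> = (\<Sum>M'\<in>?N M. S - f $ M')" using nb by (intro sum.cong) auto
    also have "\<dots> = real CARD('a) * S - (S - f $ M)" by (simp add: sum_subtractf card S_def)
    finally show ?thesis by (simp add: pos_op_def S_def algebra_simps)
  qed
  then show ?thesis by (simp add: vec_eq_iff)
qed

text \<open>\<open>pos_op_comp\<close> appends generators on the right. The version on the left,
  \<open>left\<close>, is its adjoint, because \<open>\<sigma> l \<circ> w0 n\<close> and
  \<open>w0 n \<circ> \<sigma> k\<close> agree on the frame.\<close>

lemma pos_op_w0_commute:
  assumes k: "k \<in> {1..n}" and l: "l \<in> {1..n}"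
    and eq: "\<And>x. x \<in> I \<Longrightarrow> \<sigma> k (w0 n x) = w0 n (\<sigma> l x)" "\<And>x. x \<in> I \<Longrightarrow> \<sigma> l (w0 n x) = w0 n (\<sigma> k x)"
  shows "pos_op (\<sigma> k) (pos_op (w0 n) f) = pos_op (w0 n) (pos_op (\<sigma> l) f)"
proof -
  have asc: "pos_op (w0 n) f = pos_op (w0 n \<circ> \<sigma> j) (pos_op (\<sigma> j) f)" if j: "j \<in> {1..n}" for j f
  proof -
    have "signed_perm n (w0 n \<circ> \<sigma> j)" using signed_perm_w0 sp_sigma[OF j] by (rule signed_perm_comp)
    moreover have "ascent (w0 n \<circ> \<sigma> j) j"
      using rank_w0[OF roots(1,2)[OF j]] roots(4)[OF j] ascent_id[OF j] by (auto simp: ascent_def sigma_roots[OF j])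
    ultimately have "pos_op (w0 n \<circ> \<sigma> j) (pos_op (\<sigma> j) f) = pos_op (w0 n \<circ> \<sigma> j \<circ> \<sigma> j) f" using j by (intro pos_op_comp)
    then show ?thesis using sigma_inv'[OF j] by (simp add: comp_assoc)
  qed
  have w0w0: "w0 n \<circ> w0 n = id" by (auto simp: w0_w0)
  have left: "pos_op (\<sigma> k) (pos_op (w0 n \<circ> \<sigma> l) f) = pos_op (w0 n) f" for f
  proof -
    have inv: "(w0 n \<circ> \<sigma> l) \<circ> (\<sigma> l \<circ> w0 n) = id" "(\<sigma> l \<circ> w0 n) \<circ> (w0 n \<circ> \<sigma> l) = id"
      using sigma_inv[OF l] by (auto simp: w0_w0)
    have "pos_op (\<sigma> k) (pos_op (w0 n \<circ> \<sigma> l) f) \<bullet> g = pos_op (w0 n) f \<bullet> g" for g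
    proof -
      have "pos_op (\<sigma> k) (pos_op (w0 n \<circ> \<sigma> l) f) \<bullet> g = f \<bullet> pos_op (\<sigma> l \<circ> w0 n) (pos_op (\<sigma> k) g)"
        using pos_op_inner[OF sigma_inv'[OF k] sigma_inv'[OF k]] pos_op_inner[OF inv] by simp
      also have "pos_op (\<sigma> l \<circ> w0 n) = pos_op (w0 n \<circ> \<sigma> k)" using eq(2) by (intro pos_op_cong) simp
      also have "pos_op (w0 n \<circ> \<sigma> k) (pos_op (\<sigma> k) g) = pos_op (w0 n) g" using asc[OF k] by simp
      also have "f \<bullet> pos_op (w0 n) g = pos_op (w0 n) f \<bullet> g" using pos_op_inner[OF w0w0 w0w0] by simp
      finally show ?thesis .
    qed
    then show ?thesis using vector_eq_rdot by blast
  qed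
  have "pos_op (\<sigma> k) (pos_op (w0 n) f) = pos_op (\<sigma> k) (pos_op (w0 n \<circ> \<sigma> l) (pos_op (\<sigma> l) f))"
    using asc[OF l] by simp
  then show ?thesis using left by simp
qed

lemma pos_op_braid:
  assumes kl: "l = k + 1 \<and> k \<ge> 1 \<and> l < n \<or> k = n - 2 \<and> l = n"
  shows "pos_op (\<sigma> k) (pos_op (\<sigma> l) (pos_op (\<sigma> k) f)) = pos_op (\<sigma> l) (pos_op (\<sigma> k) (pos_op (\<sigma> l) f))"
proof -
  have k: "k \<in> {1..n}" and l: "l \<in> {1..n}" using n4 kl by auto
  have "1 \<in> I" using n4 by (auto simp: I_iff)
  note br = sigma_braid[OF n4 kl]
  have asc: "ascent (\<sigma> k) l" "ascent (\<sigma> l) k" "ascent (\<sigma> k \<circ> \<sigma> l) k" "ascent (\<sigma> l \<circ> \<sigma> k) l"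
    using br(2-5)[OF \<open>1 \<in> I\<close>] by (simp_all add: ascent_def)
  have "pos_op (\<sigma> k) (pos_op (\<sigma> l) (pos_op (\<sigma> k) f)) = pos_op (\<sigma> k \<circ> \<sigma> l \<circ> \<sigma> k) f"
    using pos_op_comp[OF sp_sigma[OF k] l asc(1)] pos_op_comp[OF signed_perm_comp[OF sp_sigma[OF k] sp_sigma[OF l]] k asc(3)] by simp
  moreover have "pos_op (\<sigma> l) (pos_op (\<sigma> k) (pos_op (\<sigma> l) f)) = pos_op (\<sigma> l \<circ> \<sigma> k \<circ> \<sigma> l) f"
    using pos_op_comp[OF sp_sigma[OF l] k asc(2)] pos_op_comp[OF signed_perm_comp[OF sp_sigma[OF l] sp_sigma[OF k]] l asc(4)] by simp
  moreover have "pos_op (\<sigma> k \<circ> \<sigma> l \<circ> \<sigma> k) = pos_op (\<sigma> l \<circ> \<sigma> k \<circ> \<sigma> l)"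
    using br(1) by (intro pos_op_cong) simp
  ultimately show ?thesis by simp
qed

lemma chamber_EKR_bound:
  assumes C: "C \<subseteq> chambers" and opp: "\<And>M M'. M \<in> C \<Longrightarrow> M' \<in> C \<Longrightarrow> (M, M') \<notin> pos_rel (w0 n)"
  shows "real (card C) * (1 + real CARD('a) ^ (n - 1)) \<le> real (card chambers)"
proof -
  let ?q = "real CARD('a)" and ?A = "\<lambda>k. pos_op (\<sigma> k)" and ?S = "{1..n}"
  obtain ks where ks: "set ks \<subseteq> ?S" "2 * length ks = card (inversions n (w0 n))"
    "\<And>f. f \<in> chamber_functions \<Longrightarrow> pos_op (w0 n) f = foldr ?A ks f"
    using pos_op_word[OF signed_perm_w0 v0_oriented w0_oriented[OF v0_oriented]] by auto
  \<comment> \<open>Half of the number of inversions is \<open>n (n - 1)\<close>; divided by the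
    \<open>n\<close> generators it leaves the exponent of the bound.\<close>
  have len: "length ks = (n - 1) * card ?S" using ks(2) by (simp add: card_inversions_w0 mult.commute)
  let ?Br = "{(k, l). k \<in> ?S \<and> l \<in> ?S \<and> (\<forall>x\<in>chamber_functions. ?A k (?A l (?A k x)) = ?A l (?A k (?A l x)))}"
  have edge: "(k, l) \<in> ?Br" "(l, k) \<in> ?Br" if "l = k + 1 \<and> k \<ge> 1 \<and> l < n \<or> k = n - 2 \<and> l = n" for k l
    using pos_op_braid[OF that] that n4 by auto
  \<comment> \<open>Connectedness of the diagram: every node is linked to node 1, the node
    \<open>n\<close> by way of \<open>n - 2\<close>.\<close>
  have from1: "(1, k) \<in> ?Br\<^sup>* \<and> (k, 1) \<in> ?Br\<^sup>*" if "1 \<le> k" "k < n" for k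
    using that
  proof (induction k rule: nat_induct_at_least)
    case (Suc k)
    then show ?case using edge[of "Suc k" k]
      by (auto intro: rtrancl.rtrancl_into_rtrancl converse_rtrancl_into_rtrancl)
  qed simp
  have from1': "(1, k) \<in> ?Br\<^sup>* \<and> (k, 1) \<in> ?Br\<^sup>*" if "k \<in> ?S" for k
  proof (cases "k < n")
    case True then show ?thesis using from1 that by simp
  next
    case False
    then have "k = n" using that by simp
    then show ?thesis using edge[of n "n - 2"] from1[of "n - 2"] n4
      by (auto intro: rtrancl.rtrancl_into_rtrancl converse_rtrancl_into_rtrancl)
  qed
  have w0w0: "w0 n \<circ> w0 n = id" by (auto simp: w0_w0)
  have "card {0, 1 :: 'a} \<le> CARD('a)" by (intro card_mono) auto
  then have q: "?q > 1" by simp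
  interpret hecke_module chamber_functions ?S ?q ?A "pos_op (w0 n)" ks
  proof (rule hecke_module.intro)
    show "?A k x \<bullet> y = x \<bullet> ?A k y" if "k \<in> ?S" for k x y
      using pos_op_inner[OF sigma_inv'[OF that] sigma_inv'[OF that]] .
    show "pos_op (w0 n) x \<bullet> y = x \<bullet> pos_op (w0 n) y" for x y using pos_op_inner[OF w0w0 w0w0] .
    show "(k, l) \<in> ?Br\<^sup>*" if "k \<in> ?S" "l \<in> ?S" for k l
      using from1'[OF that(1)] from1'[OF that(2)] by (meson rtrancl_trans)
    show "\<exists>l\<in>?S. \<forall>x\<in>chamber_functions. ?A k (pos_op (w0 n) x) = pos_op (w0 n) (?A l x) \<and> ?A l (pos_op (w0 n) x) = pos_op (w0 n) (?A k x)"
      if k: "k \<in> ?S" for k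
    proof -
      obtain l where "l \<in> ?S" "\<forall>x\<in>I. \<sigma> k (w0 n x) = w0 n (\<sigma> l x)" "\<forall>x\<in>I. \<sigma> l (w0 n x) = w0 n (\<sigma> k x)"
        using w0_sigma[OF n2 k] by blast
      then show ?thesis using pos_op_w0_commute[OF k] pos_op_w0_commute[OF _ k] by blast
    qed
    show "linear (?A k)" if "k \<in> ?S" for k by (rule pos_op_linear)
    show "linear (pos_op (w0 n))" by (rule pos_op_linear)
  qed (use n4 q ks subspace_chamber_functions pos_op_chamber_functions pos_op_square in simp_all)
  define x :: "real ^ (('a ^ 'm) set set)" where "x = (\<chi> M. if M \<in> C then 1 else 0)"
  define y :: "real ^ (('a ^ 'm) set set)" where "y = (\<chi> M. if M \<in> chambers then 1 else 0)"
  have xV: "x \<in> chamber_functions" and yV: "y \<in> chamber_functions" using C by (auto simp: x_def y_def chamber_functions_def)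
  have Ay: "?A k y = ?q *\<^sub>R y" if k: "k \<in> ?S" for k
  proof -
    have "?A k y $ M = (?q *\<^sub>R y) $ M" for M
    proof (cases "M \<in> chambers")
      case True
      then obtain v where v: "v \<in> oriented" "M = chamber v" by (auto simp: chambers_def)
      have "?A k y $ M = (\<Sum>M'\<in>{M'. (M, M') \<in> pos_rel (\<sigma> k)}. 1)"
        unfolding pos_op_def vec_lambda_beta using pos_rel_in_chambers by (intro sum.cong refl) (auto simp: y_def)
      then show ?thesis using pos_rel_degree[OF v(1) k] v True by (simp add: y_def)
    next
      case False
      then show ?thesis using pos_op_chamber_functions[of "\<sigma> k" y] by (simp add: chamber_functions_def y_def)
    qed
    then show ?thesis by (simp add: vec_eq_iff)
  qed
  have xT: "x \<bullet> pos_op (w0 n) x = 0"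
  proof -
    have "x $ M * pos_op (w0 n) x $ M = 0" for M
    proof (cases "M \<in> C")
      case True
      then have "pos_op (w0 n) x $ M = 0" unfolding pos_op_def using opp by (auto simp: x_def intro!: sum.neutral)
      then show ?thesis by simp
    qed (simp add: x_def)
    then show ?thesis unfolding inner_vec_def inner_real_def by (intro sum.neutral ballI)
  qed
  have xx: "x \<bullet> x = real (card C)" and xy: "x \<bullet> y = real (card C)" and yy: "y \<bullet> y = real (card chambers)"
  proof -
    have s: "(\<Sum>M\<in>UNIV. if M \<in> D then 1 else 0) = real (card D)" for D :: "('a ^ 'm) set set set"
      by (simp add: sum.If_cases)
    have "x \<bullet> x = (\<Sum>M\<in>UNIV. if M \<in> C then 1 else 0)" "x \<bullet> y = (\<Sum>M\<in>UNIV. if M \<in> C then 1 else 0)"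
      "y \<bullet> y = (\<Sum>M\<in>UNIV. if M \<in> chambers then 1 else 0)"
      unfolding inner_vec_def x_def y_def using C by (auto intro!: sum.cong)
    then show "x \<bullet> x = real (card C)" "x \<bullet> y = real (card C)" "y \<bullet> y = real (card chambers)" by (simp_all only: s)
  qed
  have "(real (card C))\<^sup>2 * (1 + ?q ^ (n - 1)) \<le> real (card C) * real (card chambers)"
    using hoffman_bound[OF len xV xT yV Ay] by (simp only: xx xy yy)
  then show ?thesis by (cases "card C = 0") (simp_all add: power2_eq_square mult.assoc)
qed

end

section \<open>Flags of arbitrary cotype\<close>

context hyperbolic_quadric
begin

section \<open>Extending flags to maximal flags\<close>

lemma chain_adapted_basis:
  fixes W :: "('a ^ 'm) set"
  assumes "vec.subspace W" "finite S" "\<And>U. U \<in> S \<Longrightarrow> vec.subspace U \<and> U \<subseteq> W"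
    "\<And>U U'. U \<in> S \<Longrightarrow> U' \<in> S \<Longrightarrow> U \<subseteq> U' \<or> U' \<subseteq> U"
  shows "\<exists>b. inj_on b {1..int (vec.dim W)} \<and> vec.independent (b ` {1..int (vec.dim W)}) \<and>
    bspan b {1..int (vec.dim W)} = W \<and> (\<forall>U\<in>S. bspan b {1..int (vec.dim U)} = U)"
  using assms
proof (induction "vec.dim W" arbitrary: W S rule: less_induct)
  case less
  note W = less.prems(1) and S = less.prems(2-4)
  \<comment> \<open>\<open>T\<close> is the largest member of the chain other than \<open>W\<close>,
    or \<open>{0}\<close> if there is none; the disjunction allows for
    \<open>W = {0}\<close>.\<close>
  have "\<exists>T. vec.subspace T \<and> T \<subseteq> W \<and> (T \<noteq> W \<or> T = {0}) \<and> (\<forall>U\<in>S - {W}. U \<subseteq> T) \<and> (T \<noteq> {0} \<longrightarrow> T \<in> S)"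
  proof (cases "S - {W} = {}")
    case True
    then show ?thesis using W by (intro exI[of _ "{0}"]) (auto simp: vec.subspace_0)
  next
    case False
    have "\<exists>m\<in>S - {W}. \<forall>b\<in>S - {W}. m \<subseteq> b \<longrightarrow> m = b"
      using finite_has_maximal[of "S - {W}"] S(1) False by auto
    then obtain T where T: "T \<in> S - {W}" "\<And>U. U \<in> S - {W} \<Longrightarrow> T \<subseteq> U \<Longrightarrow> T = U" by blast
    have "U \<subseteq> T" if "U \<in> S - {W}" for U using T(2)[OF that] S(3)[of U T] that T(1) by blast
    moreover have "vec.subspace T" "T \<subseteq> W" "T \<noteq> W" "T \<in> S" using T(1) S(2)[of T] by auto
    ultimately show ?thesis by (intro exI[of _ T]) simp
  qed
  then obtain T where T: "vec.subspace T" "T \<subseteq> W" "T \<noteq> W \<or> T = {0}" "\<forall>U\<in>S - {W}. U \<subseteq> T" "T \<noteq> {0} \<longrightarrow> T \<in> S"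
    by (elim exE conjE) (rule that)
  let ?t = "vec.dim T" and ?w = "vec.dim W"
  have "\<exists>b. inj_on b {1..int ?t} \<and> vec.independent (b ` {1..int ?t}) \<and> bspan b {1..int ?t} = T \<and>
    (\<forall>U\<in>S - {W}. bspan b {1..int (vec.dim U)} = U)"
  proof (cases "T = {0}")
    case True
    then have "U = {0}" if "U \<in> S - {W}" for U
      using bspec[OF T(4) that] S(2)[of U] that vec.subspace_0[of U] by blast
    then show ?thesis using True by (intro exI[of _ undefined]) (auto simp: bspan_def vec.dim_singleton vec.independent_empty)
  next
    case False
    then have "T \<noteq> W" using T(3) by blast
    then have "?t < ?w" using vec.subspace_dim_equal[OF T(1) W T(2)] vec.dim_subset[OF T(2)] by linarith
    from less.hyps[OF this T(1), of "S - {W}"] show ?thesis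
      using S T(4) by auto
  qed
  then obtain b where b: "inj_on b {1..int ?t}" "vec.independent (b ` {1..int ?t})" "bspan b {1..int ?t} = T"
    "\<And>U. U \<in> S - {W} \<Longrightarrow> bspan b {1..int (vec.dim U)} = U" by blast
  have tw: "?t \<le> ?w" using T(2) by (rule vec.dim_subset)
  have "b ` {1..int ?t} \<subseteq> W" using b(3) T(2) by (auto simp: bspan_def intro: vec.span_base)
  then obtain D where D: "b ` {1..int ?t} \<subseteq> D" "D \<subseteq> W" "vec.independent D" "W \<subseteq> vec.span D"
    using vec.maximal_independent_subset_extend[OF _ b(2)] by blast
  have finD: "finite D" using D(3) by (rule vec.finiteI_independent)
  have spD: "vec.span D = W" using D(2,4) W by (simp add: vec.span_subspace)
  have cD: "card D = ?w" using D(3) spD by (metis vec.dim_eq_card_independent vec.dim_span)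
  have "card (D - b ` {1..int ?t}) = ?w - ?t"
    using D(1) finD cD b(1) by (simp add: card_Diff_subset finite_subset card_image)
  moreover have "card {int ?t + 1..int ?w} = ?w - ?t" using tw by simp
  ultimately obtain c where c: "bij_betw c {int ?t + 1..int ?w} (D - b ` {1..int ?t})"
    using finite_same_card_bij[of "{int ?t + 1..int ?w}" "D - b ` {1..int ?t}"] finD by auto
  define a where "a i = (if i \<le> int ?t then b i else c i)" for i
  have ab: "a ` {1..int j} = b ` {1..int j}" if "j \<le> ?t" for j
    using that by (intro image_cong) (auto simp: a_def)
  have ac: "a ` {int ?t + 1..int ?w} = c ` {int ?t + 1..int ?w}" by (intro image_cong) (auto simp: a_def)
  have iv: "{1..int ?w} = {1..int ?t} \<union> {int ?t + 1..int ?w}" using tw by auto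
  have img: "a ` {1..int ?w} = D"
    unfolding iv image_Un ac ab[OF order.refl] using c D(1) by (auto simp: bij_betw_def)
  have "inj_on a {1..int ?w}"
    using img cD by (intro eq_card_imp_inj_on) auto
  moreover have "bspan a {1..int (vec.dim U)} = U" if U: "U \<in> S" for U
  proof (cases "U = W")
    case True then show ?thesis using img spD by (simp add: bspan_def)
  next
    case False
    then have "vec.dim U \<le> ?t" using T(4) U by (intro vec.dim_subset) auto
    then show ?thesis using b(4)[of U] U False ab by (simp add: bspan_def)
  qed
  ultimately show ?case using img D(3) spD by (intro exI[of _ a]) (simp add: bspan_def)
qed

lemma chain_hyperbolic_basis:
  assumes N: "N \<in> generators n Q" and S: "finite S" "\<And>U. U \<in> S \<Longrightarrow> vec.subspace U \<and> U \<subseteq> N"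
    "\<And>U U'. U \<in> S \<Longrightarrow> U' \<in> S \<Longrightarrow> U \<subseteq> U' \<or> U' \<subseteq> U"
  shows "\<exists>v. hyperbolic_basis v \<and> seg v n = N \<and> (\<forall>U\<in>S. seg v (vec.dim U) = U)"
proof -
  obtain b where b: "inj_on b {1..int n}" "vec.independent (b ` {1..int n})"
    "bspan b {1..int n} = N" "\<And>U. U \<in> S \<Longrightarrow> bspan b {1..int (vec.dim U)} = U"
    using chain_adapted_basis[OF genD(1)[OF N] S] unfolding genD(2)[OF N] by blast
  obtain v where v: "hyperbolic_basis v" "\<forall>i\<in>{1..int n}. v i = b i"
    using hyperbolic_completion[OF hyp0 n1 b(2,1)] b(3) N by (auto simp: generators_def)
  have "seg v j = bspan b {1..int j}" if "j \<le> n" for j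
    unfolding seg_def using v(2) that by (intro bspan_cong) auto
  moreover have "vec.dim U \<le> n" if "U \<in> S" for U
    using vec.dim_subset[of U N] S(2)[OF that] genD(2)[OF N] by simp
  ultimately show ?thesis using v(1) b by (intro exI[of _ v]) simp
qed

text \<open>Choose a generator meeting \<open>T\<close> in the largest possible dimension. If it
  missed a vector of \<open>T\<close>, an exchange with this vector would enlarge the
  intersection.\<close>

lemma generator_extension:
  assumes T: "totally_singular Q T"
  shows "\<exists>N\<in>generators n Q. T \<subseteq> N"
proof -
  let ?d = "\<lambda>N. vec.dim (N \<inter> T)"
  have "generators n Q \<noteq> {}" using seg_gen[OF hyp0] by blast
  then have "Max (?d ` generators n Q) \<in> ?d ` generators n Q" by (intro Max_in) simp_all
  then obtain N where N: "N \<in> generators n Q" "Max (?d ` generators n Q) = ?d N" by blast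
  have mx: "?d N' \<le> ?d N" if "N' \<in> generators n Q" for N'
    unfolding N(2)[symmetric] using that by (intro Max_ge) simp_all
  note N = N(1)
  have "T \<subseteq> N"
  proof (rule ccontr)
    assume "\<not> T \<subseteq> N"
    then obtain x where x: "x \<in> T" "x \<notin> N" by blast
    have sT: "vec.subspace T" and Qx: "Q x = 0" using T x by (auto simp: totally_singular_def)
    let ?N = "vec.span (insert x {y \<in> N. B y x = 0})"
    have N2: "?N \<in> generators n Q" using exchange_generator(3)[OF N Qx x(2)] .
    have sub: "vec.subspace (N \<inter> T)" using genD(1)[OF N] sT by (rule vec.subspace_inter)
    have "insert x (N \<inter> T) \<subseteq> ?N \<inter> T"
      using x totally_singular_polar[OF qf T] by (auto intro!: vec.span_base)
    then have "vec.dim (insert x (N \<inter> T)) \<le> vec.dim (?N \<inter> T)" by (rule vec.dim_subset)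
    moreover have "vec.dim (insert x (N \<inter> T)) = vec.dim (N \<inter> T) + 1"
      using x sub by (simp add: vec.dim_insert vec_span_subspace)
    ultimately show False using mx[OF N2] by simp
  qed
  then show ?thesis using N by blast
qed

text \<open>The flag has no generator (one is added), one, or two, whose intersection then joins the
  chain. A third is impossible: generators of a flag are in pairwise different classes, and there
  are only two.\<close>

lemma flag_in_chamber:
  assumes x: "x \<in> flags n Q"
  shows "\<exists>v. hyperbolic_basis v \<and> x \<subseteq> chamber v"
proof -
  define S where "S = {U \<in> x. vec.dim U \<le> n - 2}"
  define G where "G = {U \<in> x. vec.dim U = n}"
  have xE: "U \<in> elements n Q" if "U \<in> x" for U using x that by (auto simp: flags_def)
  have inc: "incident n Q U U'" if "U \<in> x" "U' \<in> x" for U U' using x that by (auto simp: flags_def)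
  have xSG: "x = S \<union> G" using xE by (auto simp: S_def G_def elements_def generators_def)
  have S: "vec.subspace U" "1 \<le> vec.dim U" "vec.dim U \<le> n - 2" "totally_singular Q U" if "U \<in> S" for U
    using that xE[of U] n4 by (auto simp: S_def elements_def generators_def totally_singular_def)
  have G: "U \<in> generators n Q" if "U \<in> G" for U
    using that xE[of U] n4 by (auto simp: G_def elements_def generators_def)
  have finS: "finite S" by simp
  have chain: "U \<subseteq> U' \<or> U' \<subseteq> U" if "U \<in> S" "U' \<in> S" for U U'
    using inc[of U U'] that S(3)[OF that(1)] genD(2)[of U] n4 by (auto simp: S_def incident_def)
  have SG: "U \<subseteq> U'" if "U \<in> S" "U' \<in> G" for U U'
  proof -
    have "\<not> U' \<subseteq> U"
      using vec.dim_subset[of U' U] S(3)[OF that(1)] genD(2)[OF G[OF that(2)]] n4 by auto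
    then show ?thesis using inc[of U U'] that S(3)[OF that(1)] genD(2)[of U] n4 by (auto simp: S_def G_def incident_def)
  qed
  have GG: "\<not> same_class n U U' \<and> vec.dim (U \<inter> U') = n - 1" if "U \<in> G" "U' \<in> G" "U \<noteq> U'" for U U'
  proof -
    have "\<not> U \<subseteq> U'" "\<not> U' \<subseteq> U"
      using that vec.subspace_dim_equal[of U U'] vec.subspace_dim_equal[of U' U] genD(1,2)[OF G] by auto
    then show ?thesis using inc[of U U'] that by (auto simp: G_def incident_def)
  qed
  have fin: "\<exists>v. hyperbolic_basis v \<and> x \<subseteq> chamber v"
    if v: "hyperbolic_basis v" "\<forall>U\<in>S. seg v (vec.dim U) = U" and "G \<subseteq> {seg v n, twin v}" for v
  proof -
    have "S \<subseteq> seg v ` {1..n - 2}"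
    proof
      fix U assume U: "U \<in> S"
      then have "U = seg v (vec.dim U)" using v(2) by simp
      then show "U \<in> seg v ` {1..n - 2}" by (rule image_eqI) (use S(2,3)[OF U] in simp)
    qed
    then show ?thesis using that xSG by (intro exI[of _ v]) (auto simp: chamber_eq)
  qed
  consider (0) "G = {}" | (1) N where "G = {N}" | (2) N N' where "N \<in> G" "N' \<in> G" "N \<noteq> N'" by blast
  then show ?thesis
  proof cases
    case 0
    have "\<exists>T. totally_singular Q T \<and> (\<forall>U\<in>S. U \<subseteq> T)"
    proof (cases "S = {}")
      case True then show ?thesis by (intro exI[of _ "{0}"]) (simp add: totally_singular_def)
    next
      case False
      have "\<exists>m\<in>S. \<forall>b\<in>S. m \<subseteq> b \<longrightarrow> m = b" using finite_has_maximal[OF finS False] by auto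
      then obtain T where T: "T \<in> S" "\<forall>b\<in>S. T \<subseteq> b \<longrightarrow> T = b" by blast
      have "U \<subseteq> T" if "U \<in> S" for U using chain[OF that T(1)] bspec[OF T(2) that] by auto
      then show ?thesis using S(4)[OF T(1)] by (intro exI[of _ T]) simp
    qed
    then obtain T where T: "totally_singular Q T" "\<forall>U\<in>S. U \<subseteq> T" by (elim exE conjE) (rule that)
    obtain N where N: "N \<in> generators n Q" "T \<subseteq> N" using generator_extension[OF T(1)] by (elim bexE) (rule that)
    have sub: "vec.subspace U \<and> U \<subseteq> N" if "U \<in> S" for U using S(1)[OF that] T(2) N(2) that by auto
    have "\<exists>v. hyperbolic_basis v \<and> seg v n = N \<and> (\<forall>U\<in>S. seg v (vec.dim U) = U)"
      by (rule chain_hyperbolic_basis[OF N(1) finS]) (rule sub chain; assumption)+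
    then obtain v where "hyperbolic_basis v" "\<forall>U\<in>S. seg v (vec.dim U) = U" by (elim exE conjE) (rule that)
    then show ?thesis using fin 0 by blast
  next
    case (1 N)
    have N: "N \<in> generators n Q" using G 1 by simp
    have sub: "vec.subspace U \<and> U \<subseteq> N" if "U \<in> S" for U using S(1)[OF that] SG[OF that] 1 by simp
    have "\<exists>v. hyperbolic_basis v \<and> seg v n = N \<and> (\<forall>U\<in>S. seg v (vec.dim U) = U)"
      by (rule chain_hyperbolic_basis[OF N finS]) (rule sub chain; assumption)+
    then obtain v where "hyperbolic_basis v" "seg v n = N" "\<forall>U\<in>S. seg v (vec.dim U) = U"
      by (elim exE conjE) (rule that)
    then show ?thesis using fin 1 by blast
  next
    case (2 N N')
    let ?H = "N \<inter> N'"
    have N: "N \<in> generators n Q" "N' \<in> generators n Q" using G 2 by blast+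
    have dH: "vec.dim ?H = n - 1" using GG 2 by blast
    have sH: "vec.subspace ?H" using genD(1) N by (intro vec.subspace_inter)
    have SH: "U \<subseteq> ?H" if "U \<in> S" for U using SG that 2 by blast
    have "\<exists>v. hyperbolic_basis v \<and> seg v n = N \<and> (\<forall>U\<in>insert ?H S. seg v (vec.dim U) = U)"
    proof (rule chain_hyperbolic_basis[OF N(1)])
      show "vec.subspace U \<and> U \<subseteq> N" if "U \<in> insert ?H S" for U using that sH S(1) SH by blast
      show "U \<subseteq> U' \<or> U' \<subseteq> U" if "U \<in> insert ?H S" "U' \<in> insert ?H S" for U U'
        using that SH chain by blast
    qed (use finS in simp)
    then obtain v where v: "hyperbolic_basis v" "seg v n = N" "seg v (n - 1) = ?H" "\<forall>U\<in>S. seg v (vec.dim U) = U"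
      using dH by auto
    \<comment> \<open>The basis is adapted to \<open>N\<close> and the hyperplane only;
      \<open>N'\<close> is forced to be the other generator through that hyperplane.\<close>
    have "N' = twin v"
    proof -
      have "?H \<noteq> N'" using dH genD(2)[OF N(2)] n4 by auto
      then obtain z where z: "z \<in> N'" "z \<notin> ?H" by blast
      have "vec.dim N' = vec.dim ?H + 1" using dH genD(2)[OF N(2)] n4 by simp
      then have span: "N' = vec.span (insert z ?H)"
        using hyperplane_span(1)[OF genD(1)[OF N(2)] sH _ _ z] by blast
      have "z \<in> seg v n \<union> twin v"
      proof (rule adjacent_cover[OF seg_gen[OF v(1)] twin_gen[OF v(1)]])
        show "vec.dim (seg v n \<inter> twin v) = n - 1" using seg_Nt_Int[OF v(1)] dim_seg[OF v(1)] by simp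
        show "Q z = 0" using genD(3)[OF N(2) z(1)] .
        show "B z h = 0" if "h \<in> seg v n \<inter> twin v" for h
          using that seg_Nt_Int[OF v(1)] v(3) genD(4)[OF N(2) z(1)] by auto
      qed
      then have "z \<in> twin v" using z v(2) by blast
      moreover have "?H \<subseteq> twin v" using seg_Nt_Int[OF v(1)] v(3) by blast
      ultimately have "vec.span (insert z ?H) \<subseteq> twin v"
        using genD(1)[OF twin_gen[OF v(1)]] by (intro vec.span_minimal) auto
      then have "N' \<subseteq> twin v" by (subst span)
      then show ?thesis
        using genD(1,2)[OF N(2)] genD(1,2)[OF twin_gen[OF v(1)]] by (intro vec.subspace_dim_equal) auto
    qed
    moreover have "U = N \<or> U = N'" if "U \<in> G" for U
    proof (rule ccontr)
      assume "\<not> (U = N \<or> U = N')"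
      then have "\<not> same_class n N U" "\<not> same_class n N' U" "\<not> same_class n N N'" using GG that 2 by blast+
      then show False using same_class_iff[OF N G[OF that]] by blast
    qed
    ultimately show ?thesis using fin[OF v(1) v(4)] v(2) by blast
  qed
qed

lemma oriented_or_tw:
  assumes v: "hyperbolic_basis v" shows "v \<in> oriented \<or> v \<circ> tw \<in> oriented"
  using same_class_iff[OF twin_gen[OF v] seg_gen[OF v] seg_gen[OF hyp0]] seg_Nt_class[OF v] v hyp_tw[OF v]
  by (auto simp: oriented_def seg_tw)

lemma flag_in_chambers: "x \<in> flags n Q \<Longrightarrow> \<exists>v\<in>oriented. x \<subseteq> chamber v"
  using flag_in_chamber oriented_or_tw chamber_tw by metis

lemma chamber_elements:
  assumes v: "hyperbolic_basis v" and U: "U \<in> chamber v" shows "U \<in> elements n Q"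
proof -
  consider i where "i \<in> {1..n - 2}" "U = seg v i" | "U = seg v n" | "U = twin v" using U by (auto simp: chamber_eq)
  then show ?thesis
  proof cases
    case 1
    then have i: "i \<le> n" by auto
    have "totally_singular Q (bspan v {1..int i})"
      by (rule bspan_totally_singular[OF v pos_I[OF i]]) auto
    then have "totally_singular Q (seg v i)" by (simp add: seg_def)
    then show ?thesis using 1 dim_seg[OF v i] by (simp add: elements_def)
  qed (use seg_gen[OF v] twin_gen[OF v] in \<open>auto simp: elements_def\<close>)
qed

lemma chamber_flag:
  assumes v: "hyperbolic_basis v" shows "chamber v \<in> flags n Q"
proof -
  have mono: "seg v i \<subseteq> seg v j" if "i \<le> j" for i j
    unfolding seg_def using that by (intro bspan_mono) auto
  have sN: "seg v i \<subseteq> twin v" if "i \<le> n - 1" for i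
    using mono[OF that] seg_Nt_Int[OF v] by blast
  have adj: "incident n Q (seg v n) (twin v)" "incident n Q (twin v) (seg v n)"
    using seg_gen[OF v] twin_gen[OF v] seg_Nt_Int[OF v] dim_seg[OF v, of "n - 1"] seg_Nt_class[OF v]
    by (auto simp: incident_def same_class_def Int_commute)
  have "incident n Q U U'" if "U \<in> chamber v" "U' \<in> chamber v" for U U'
  proof -
    have c: "(\<exists>i\<in>{1..n - 2}. U = seg v i) \<or> U = seg v n \<or> U = twin v"
      "(\<exists>i\<in>{1..n - 2}. U' = seg v i) \<or> U' = seg v n \<or> U' = twin v" using that by (auto simp: chamber_eq)
    have small: "seg v i \<subseteq> Z \<or> Z \<subseteq> seg v i" if "i \<in> {1..n - 2}" "(\<exists>i\<in>{1..n - 2}. Z = seg v i) \<or> Z = seg v n \<or> Z = twin v" for i Z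
    proof -
      have i: "i \<le> n" "i \<le> n - 1" using that(1) by auto
      from that(2) show ?thesis
      proof (elim disjE bexE)
        show ?thesis if "Z = seg v j" for j using that mono[of i j] mono[of j i] nat_le_linear[of i j] by blast
        show ?thesis if "Z = seg v n" using that mono[OF i(1)] by blast
        show ?thesis if "Z = twin v" using that sN[OF i(2)] by blast
      qed
    qed
    show ?thesis
    proof (cases "(\<exists>i\<in>{1..n - 2}. U = seg v i) \<or> (\<exists>i\<in>{1..n - 2}. U' = seg v i)")
      case True
      then have "U \<subseteq> U' \<or> U' \<subseteq> U" using small c by blast
      then show ?thesis by (auto simp: incident_def)
    next
      case False
      then show ?thesis using c adj by (auto simp: incident_def)
    qed
  qed
  then show ?thesis using chamber_elements[OF v] by (auto simp: flags_def)
qed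

lemma finite_chambers: "finite chambers" by simp

end

locale framed_quadric = hyperbolic_quadric n Q v0
  for n :: nat and Q :: "'a::{field,finite} ^ 'm \<Rightarrow> 'a" and v0 +
  fixes e :: "int \<Rightarrow> ('a ^ 'm) set"
  assumes e: "\<And>i. i \<in> frame_indices n \<Longrightarrow> e i = vec.span {v0 i}"
begin

lemma frame_span_e: "A \<subseteq> I \<Longrightarrow> frame_span e A = bspan v0 A"
proof -
  assume A: "A \<subseteq> I"
  have "(\<Union>i\<in>A. e i) = (\<Union>i\<in>A. vec.span {v0 i})" using A e by (intro SUP_cong) auto
  then show ?thesis by (simp add: frame_span_def bspan_def vec_span_UN_span)
qed

lemma standard_flag_e: "standard_flag n e = chamber v0"
proof -
  have "(\<lambda>i. frame_span e {1..int i}) ` {1..n - 2} = seg v0 ` {1..n - 2}"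
    by (intro image_cong) (auto simp: frame_span_e pos_I seg_def)
  then show ?thesis
    by (simp add: standard_flag_def chamber_eq frame_span_e[OF pos_I[of n]] frame_span_e[OF insert_I] seg_def twin_def)
qed

definition elt_ty :: "('a ^ 'm) set \<Rightarrow> elt_type" where "elt_ty = type_of n e"

lemma elt_ty_seg:
  assumes v: "v \<in> oriented"
  shows "1 \<le> i \<Longrightarrow> i \<le> n - 2 \<Longrightarrow> elt_ty (seg v i) = Dim i" "elt_ty (seg v n) = Gen" "elt_ty (twin v) = Gen'"
proof -
  have h: "hyperbolic_basis v" using oriented_hyp[OF v] .
  have f: "frame_span e {1..int n} = seg v0 n" using frame_span_e[OF pos_I[of n]] by (simp add: seg_def)
  show "elt_ty (seg v i) = Dim i" if "1 \<le> i" "i \<le> n - 2"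
  proof -
    have "i \<le> n" "i \<noteq> n" using that n4 by auto
    then show ?thesis by (simp add: elt_ty_def type_of_def dim_seg[OF h])
  qed
  show "elt_ty (seg v n) = Gen" using v by (simp add: elt_ty_def type_of_def dim_seg[OF h] f oriented_def)
  have "v \<circ> tw \<notin> oriented" using tw_not_oriented[OF v] .
  then have "\<not> same_class n (twin v) (seg v0 n)" using hyp_tw[OF h] by (simp add: oriented_def seg_tw)
  then show "elt_ty (twin v) = Gen'" by (simp add: elt_ty_def type_of_def genD(2)[OF twin_gen[OF h]] f)
qed

lemma elt_ty_image: "v \<in> oriented \<Longrightarrow> elt_ty ` chamber v = elt_types n"
proof -
  assume v: "v \<in> oriented"
  have "elt_ty ` seg v ` {1..n - 2} = Dim ` {1..n - 2}"
    unfolding image_image using elt_ty_seg(1)[OF v] by (intro image_cong) auto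
  then show ?thesis by (simp add: chamber_eq image_Un elt_types_def elt_ty_seg[OF v])
qed

lemma elt_ty_inj:
  assumes v: "v \<in> oriented" shows "inj_on elt_ty (chamber v)"
proof (rule inj_onI)
  fix U U' assume "U \<in> chamber v" "U' \<in> chamber v" "elt_ty U = elt_ty U'"
  then show "U = U'" using elt_ty_seg[OF v] by (auto simp: chamber_eq)
qed

definition face :: "elt_type set \<Rightarrow> ('a ^ 'm) set set \<Rightarrow> ('a ^ 'm) set set" where
  "face J M = {U \<in> M. elt_ty U \<notin> J}"

lemma subset_flag: "M \<in> flags n Q \<Longrightarrow> x \<subseteq> M \<Longrightarrow> x \<in> flags n Q"
  by (auto simp: flags_def)

text \<open>A chamber has exactly one member of each type, so it contains exactly one flag of each
  cotype.\<close>

lemma face_iff: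
  assumes v: "v \<in> oriented" and J: "J \<subseteq> elt_types n"
  shows "x \<subseteq> chamber v \<and> cotype n e x = J \<longleftrightarrow> x = face J (chamber v)"
proof
  assume x: "x \<subseteq> chamber v \<and> cotype n e x = J"
  then have "elt_ty ` x = elt_types n - J"
    using elt_ty_image[OF v] by (auto simp: cotype_def elt_ty_def)
  moreover have "U \<in> x \<longleftrightarrow> elt_ty U \<in> elt_ty ` x" if "U \<in> chamber v" for U
    using inj_on_image_mem_iff[OF elt_ty_inj[OF v] that] x by blast
  ultimately show "x = face J (chamber v)" using x elt_ty_image[OF v] by (auto simp: face_def)
next
  assume x: "x = face J (chamber v)"
  then have "elt_ty ` x = elt_types n - J" using elt_ty_image[OF v] by (auto simp: face_def)
  then show "x \<subseteq> chamber v \<and> cotype n e x = J" using x J by (auto simp: face_def cotype_def elt_ty_def)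
qed

lemma flags_of_cotype_face:
  assumes "J \<subseteq> elt_types n" "v \<in> oriented"
  shows "x \<subseteq> chamber v \<and> x \<in> flags_of_cotype n Q e J \<longleftrightarrow> x = face J (chamber v)"
proof -
  have "x \<in> flags n Q" if "x \<subseteq> chamber v" using subset_flag[OF chamber_flag[OF oriented_hyp[OF assms(2)]] that] .
  then show ?thesis using face_iff[OF assms(2,1), of x] unfolding flags_of_cotype_def by blast
qed

section \<open>Similarities, transitivity and opposition\<close>

lemma isometry_similarity:
  assumes h: "Vector_Spaces.linear (*s) (*s) h" "bij h" "\<And>x. Q (h x) = Q x" and v: "v \<in> oriented" "h \<circ> v \<in> oriented"
  shows "h \<in> similarities n Q"
  unfolding similarities_def
proof (intro CollectI conjI ballI)
  show "\<exists>c. c \<noteq> 0 \<and> (\<forall>x. Q (h x) = c * Q x)" using h(3) by (intro exI[of _ 1]) simp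
  fix N assume N: "N \<in> generators n Q"
  have inj: "inj h" using h(2) by (rule bij_is_inj)
  have dim: "vec.dim (h ` U) = vec.dim U" for U
    using h(1) inj by (intro vec.dim_image_eq) (auto intro: inj_on_subset)
  have hN: "h ` N \<in> generators n Q" using N h dim
    by (auto simp: generators_def totally_singular_def vec.linear_subspace_image)
  let ?N1 = "seg v n"
  have N1: "?N1 \<in> generators n Q" using seg_gen[OF oriented_hyp[OF v(1)]] .
  have im: "h ` ?N1 = seg (h \<circ> v) n"
    unfolding seg_def bspan_def image_comp[symmetric] by (rule vec.linear_span_image[OF h(1), symmetric])
  have hN1: "h ` ?N1 \<in> generators n Q" using seg_gen[OF oriented_hyp[OF v(2)]] by (simp add: im)
  have "same_class n ?N1 (seg v0 n)" "same_class n (h ` ?N1) (seg v0 n)" using v by (simp_all add: oriented_def im)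
  then have 1: "same_class n ?N1 (h ` ?N1)" using same_class_iff[OF N1 hN1 seg_gen[OF hyp0]] by blast
  \<comment> \<open>An injective linear map preserves dimensions of intersections, so keeping the
    class of the single generator \<open>?N1\<close> is enough for all generators.\<close>
  have 2: "same_class n (h ` N) (h ` ?N1) \<longleftrightarrow> same_class n N ?N1"
    by (simp add: same_class_def image_Int[OF inj, symmetric] dim)
  show "same_class n N (h ` N)"
    using same_class_iff[OF N N1 hN1] same_class_iff[OF N hN hN1] 1 2 by blast
qed (use h in auto)

lemma image_chamber:
  assumes h: "Vector_Spaces.linear (*s) (*s) h"
  shows "(`) h ` chamber v = chamber (h \<circ> v)" "h ` seg v j = seg (h \<circ> v) j" "h ` twin v = twin (h \<circ> v)"
proof -
  have bspan: "h ` bspan v A = bspan (h \<circ> v) A" for A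
    unfolding bspan_def image_comp[symmetric] by (rule vec.linear_span_image[OF h, symmetric])
  show U: "h ` seg v j = seg (h \<circ> v) j" for j by (simp add: seg_def bspan)
  show N: "h ` twin v = twin (h \<circ> v)" by (simp add: twin_def bspan)
  show "(`) h ` chamber v = chamber (h \<circ> v)" by (simp add: chamber_eq image_Un image_image U N)
qed

lemma transport:
  assumes v: "v \<in> oriented" "v' \<in> oriented"
  obtains h where "Vector_Spaces.linear (*s) (*s) h" "bij h" "\<And>x. Q (h x) = Q x"
    "\<And>i. i \<in> I \<Longrightarrow> h (v i) = v' i" "h \<in> similarities n Q"
proof -
  obtain h where h: "Vector_Spaces.linear (*s) (*s) h" "bij h" "\<And>x. Q (h x) = Q x"
    "\<And>i. i \<in> I \<Longrightarrow> h (v i) = v' i"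
    using hyp_isometry[OF oriented_hyp[OF v(1)] oriented_hyp[OF v(2)]] by metis
  have "h \<circ> v \<in> oriented" using oriented_cong[of "h \<circ> v" v'] h(4) v(2) by simp
  then show ?thesis using that h isometry_similarity[OF h(1-3) v(1)] by blast
qed

lemma similarity_oriented:
  assumes h: "h \<in> similarities n Q" "\<And>x. Q (h x) = Q x" and v: "v \<in> oriented"
  shows "h \<circ> v \<in> oriented"
proof -
  have lin: "Vector_Spaces.linear (*s) (*s) h" using h(1) by (simp add: similarities_def)
  have hyp: "hyperbolic_basis v" using oriented_hyp[OF v] .
  have Bh: "B (h x) (h y) = B x y" for x y
    by (simp add: polar_form_def vec.linear_add[OF lin, symmetric] h(2))
  have hyp': "hyperbolic_basis (h \<circ> v)"
    unfolding hyperbolic_basis_def using hyp_Q[OF hyp] hyp_B[OF hyp] by (simp add: h(2) Bh)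
  have "same_class n (seg v n) (seg (h \<circ> v) n)"
    using h(1) seg_gen[OF hyp] image_chamber(2)[OF lin, of v n] by (auto simp: similarities_def)
  then have "same_class n (seg (h \<circ> v) n) (seg v0 n)"
    using same_class_iff[OF seg_gen[OF hyp] seg_gen[OF hyp'] seg_gen[OF hyp0]] v by (auto simp: oriented_def)
  then show ?thesis using hyp' by (simp add: oriented_def)
qed

text \<open>A similarity carrying a chamber over \<open>x\<close> to one over \<open>x'\<close>
  respects types, hence carries \<open>x\<close> to \<open>x'\<close> and injects the chambers over
  \<open>x\<close> into those over \<open>x'\<close>. Equality follows by exchanging the two
  flags.\<close>

lemma chambers_over_le:
  assumes J: "J \<subseteq> elt_types n" and x: "x \<in> flags_of_cotype n Q e J" "x' \<in> flags_of_cotype n Q e J"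
  shows "card {M \<in> chambers. x \<subseteq> M} \<le> card {M \<in> chambers. x' \<subseteq> M}"
proof -
  have xfl: "x \<in> flags n Q" "x' \<in> flags n Q" using x by (auto simp: flags_of_cotype_def)
  obtain v where v: "v \<in> oriented" "x \<subseteq> chamber v" using flag_in_chambers[OF xfl(1)] by (elim bexE) (rule that)
  obtain v' where v': "v' \<in> oriented" "x' \<subseteq> chamber v'" using flag_in_chambers[OF xfl(2)] by (elim bexE) (rule that)
  obtain h where h: "Vector_Spaces.linear (*s) (*s) h" "bij h" "\<And>x. Q (h x) = Q x"
    "\<And>i. i \<in> I \<Longrightarrow> h (v i) = v' i" "h \<in> similarities n Q" using transport[OF v(1) v'(1)] by blast
  have hv: "h \<circ> v \<in> oriented" "chamber (h \<circ> v) = chamber v'" using oriented_cong[of "h \<circ> v" v'] chamber_cong'[of "h \<circ> v" v'] h(4) v'(1) by simp_all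
  have elt_ty_h: "elt_ty (h ` U) = elt_ty U" if "U \<in> chamber v" for U
    using that elt_ty_seg[OF v(1)] elt_ty_seg[OF hv(1)] by (auto simp: chamber_eq image_chamber[OF h(1)])
  have xf: "x = face J (chamber v)" "x' = face J (chamber v')"
    using flags_of_cotype_face[OF J v(1)] flags_of_cotype_face[OF J v'(1)] v v' x by blast+
  have hx: "(`) h ` x = x'"
    unfolding xf hv(2)[symmetric] image_chamber(1)[OF h(1), symmetric] face_def using elt_ty_h by auto
  have injh: "inj ((`) h)" by (rule injI) (simp add: inj_image_eq_iff[OF bij_is_inj[OF h(2)]])
  show ?thesis
  proof (rule card_inj_on_le)
    show "inj_on ((`) ((`) h)) {M \<in> chambers. x \<subseteq> M}" by (rule inj_onI) (simp only: inj_image_eq_iff[OF injh])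
    show "(`) ((`) h) ` {M \<in> chambers. x \<subseteq> M} \<subseteq> {M \<in> chambers. x' \<subseteq> M}"
    proof clarify
      fix M assume M: "M \<in> chambers" "x \<subseteq> M"
      then obtain u where u: "u \<in> oriented" "M = chamber u" by (auto simp: chambers_def)
      have "(`) h ` M \<in> chambers" using u similarity_oriented[OF h(5,3) u(1)] by (simp add: image_chamber(1)[OF h(1)] chambers_def)
      moreover have "x' \<subseteq> (`) h ` M" using M(2) hx by blast
      ultimately show "(`) h ` M \<in> chambers \<and> x' \<subseteq> (`) h ` M" by blast
    qed
  qed simp
qed

lemma PGO_of: "h \<in> similarities n Q \<Longrightarrow> (\<lambda>U\<in>elements n Q. h ` U) \<in> carrier (PGO n Q)"
  by (simp add: PGO_def)

lemma PGO_image_chamber: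
  assumes h: "Vector_Spaces.linear (*s) (*s) h" and v: "hyperbolic_basis v"
  shows "(\<lambda>U\<in>elements n Q. h ` U) ` chamber v = chamber (h \<circ> v)"
proof -
  have "(\<lambda>U\<in>elements n Q. h ` U) ` chamber v = (`) h ` chamber v"
    using chamber_elements[OF v] by (intro image_cong) auto
  then show ?thesis by (simp add: image_chamber(1)[OF h])
qed

lemma pos_rel_w0_opposite:
  assumes "(M, M') \<in> pos_rel (w0 n)"
  shows "opposite_maximal n Q e M M'"
proof -
  let ?E = "elements n Q" and ?G = "PGO n Q"
  \<comment> \<open>Starting the basis at \<open>M'\<close> gives \<open>g = h \<circ> w\<close>, so
    that the inverse of \<open>h\<close> times \<open>g\<close> is \<open>w\<close> itself and the
    two double cosets coincide.\<close>
  have "(M', M) \<in> pos_rel (w0 n)" using pos_rel_converse[of "w0 n" "w0 n"] assms by (auto simp: w0_w0 fun_eq_iff)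
  then obtain u where u: "u \<in> oriented" "u \<circ> w0 n \<in> oriented" "M' = chamber u" "M = chamber (u \<circ> w0 n)" by (auto simp: pos_rel_def)
  obtain h where h: "Vector_Spaces.linear (*s) (*s) h" "bij h" "\<And>x. Q (h x) = Q x"
    "\<And>i. i \<in> I \<Longrightarrow> h (v0 i) = u i" "h \<in> similarities n Q" using transport[OF v0_oriented u(1)] by blast
  obtain w where w: "Vector_Spaces.linear (*s) (*s) w" "bij w" "\<And>x. Q (w x) = Q x"
    "\<And>i. i \<in> I \<Longrightarrow> w (v0 i) = (v0 \<circ> w0 n) i" "w \<in> similarities n Q"
    using transport[OF v0_oriented w0_oriented[OF v0_oriented]] by blast
  have lin: "Vector_Spaces.linear (*s) (*s) (h \<circ> w)" by (rule Vector_Spaces.linear_compose[OF w(1) h(1)])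
  have bij: "bij (h \<circ> w)" using w(2) h(2) by (rule bij_comp)
  have hw: "(h \<circ> w \<circ> v0) i = (u \<circ> w0 n) i" if "i \<in> I" for i
    using w(4)[OF that] h(4)[OF signed_permD(1)[OF signed_perm_w0 that]] by simp
  have hwP: "h \<circ> w \<circ> v0 \<in> oriented" using oriented_cong[of "h \<circ> w \<circ> v0" "u \<circ> w0 n"] hw u(2) by blast
  have hws: "h \<circ> w \<in> similarities n Q"
    using isometry_similarity[OF lin bij _ v0_oriented hwP] h(3) w(3) by simp
  let ?h = "\<lambda>U\<in>?E. h ` U" and ?w = "\<lambda>U\<in>?E. w ` U" and ?g = "\<lambda>U\<in>?E. (h \<circ> w) ` U"
  note c = PGO_of[OF h(5)] PGO_of[OF w(5)] PGO_of[OF hws]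
  have M: "M = ?g ` standard_flag n e"
  proof -
    have "chamber (h \<circ> w \<circ> v0) = chamber (u \<circ> w0 n)" using hw by (rule chamber_cong')
    then show ?thesis unfolding standard_flag_e PGO_image_chamber[OF lin hyp0] u(4) by (rule sym)
  qed
  have M': "M' = ?h ` standard_flag n e"
    using PGO_image_chamber[OF h(1) hyp0] chamber_cong'[of "h \<circ> v0" u] h(4) u(3) by (simp add: standard_flag_e)
  have eE: "e i \<in> ?E" if "i \<in> I" for i
  proof -
    have "totally_singular Q (bspan v0 {i})" using that by (intro bspan_totally_singular[OF hyp0]) (auto simp: I_iff)
    moreover have "vec.dim (bspan v0 {i}) = 1" using dim_bspan[OF hyp0, of "{i}"] that by simp
    moreover have "bspan v0 {i} = e i" by (simp add: bspan_def e[OF that])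
    moreover have "1 \<le> n - 2" using n4 by linarith
    ultimately show ?thesis by (simp add: elements_def)
  qed
  have ind: "induces n e ?w (w0 n)"
    unfolding induces_def
  proof
    fix i assume i: "i \<in> I"
    have wi: "w0 n i \<in> I" using signed_permD(1)[OF signed_perm_w0 i] .
    have "w ` vec.span {v0 i} = vec.span (w ` {v0 i})" by (rule vec.linear_span_image[OF w(1), symmetric])
    also have "\<dots> = vec.span {v0 (w0 n i)}" using w(4)[OF i] by simp
    finally show "?w (e i) = e (w0 n i)" using eE[OF i] by (simp add: e[OF i] e[OF wi])
  qed
  interpret Bj: group "BijGroup ?E" by (rule group_BijGroup)
  have mult: "monoid.mult ?G = monoid.mult (BijGroup ?E)" and one: "\<one>\<^bsub>?G\<^esub> = \<one>\<^bsub>BijGroup ?E\<^esub>"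
    by (simp_all add: PGO_def)
  have cB: "g \<in> carrier (BijGroup ?E)" if "g \<in> carrier ?G" for g
    using PGO_Bij[OF that] by (simp add: BijGroup_def)
  have prod: "?h \<otimes>\<^bsub>?G\<^esub> ?w = ?g"
  proof -
    have "w ` U \<in> ?E" if "U \<in> ?E" for U
      using Bij_imp_funcset[OF PGO_Bij[OF c(2)]] that by force
    then have "compose ?E ?h ?w = ?g" by (auto simp: compose_def fun_eq_iff image_comp)
    then show ?thesis using PGO_mult[OF PGO_Bij[OF c(1)] PGO_Bij[OF c(2)]] by simp
  qed
  let ?i = "inv\<^bsub>?G\<^esub> ?h"
  note iv = PGO_inv[OF c(1)]
  have "?h \<otimes>\<^bsub>BijGroup ?E\<^esub> ?i = \<one>\<^bsub>BijGroup ?E\<^esub>"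
    using iv(2) unfolding mult one .
  then have "?i \<otimes>\<^bsub>BijGroup ?E\<^esub> ?h = \<one>\<^bsub>BijGroup ?E\<^esub>"
    by (rule Bj.inv_comm[OF _ cB[OF c(1)] cB[OF iv(1)]])
  then have "?i \<otimes>\<^bsub>BijGroup ?E\<^esub> (?h \<otimes>\<^bsub>BijGroup ?E\<^esub> ?w) = ?w"
    by (simp only: Bj.m_assoc[OF cB[OF iv(1)] cB[OF c(1)] cB[OF c(2)], symmetric] Bj.l_one[OF cB[OF c(2)]])
  then have "?i \<otimes>\<^bsub>?G\<^esub> ?g = ?w"
    unfolding prod[symmetric] mult .
  then have "double_coset n Q e (?i \<otimes>\<^bsub>?G\<^esub> ?g) = double_coset n Q e ?w" by (rule arg_cong)
  then show ?thesis unfolding opposite_maximal_def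
    by (intro bexI[OF _ c(3)] bexI[OF _ c(1)] bexI[OF _ c(2)] conjI M M' ind)
qed

theorem EKR_bound:
  assumes J: "J \<subseteq> elt_types n" "conj_w0 n J = J" and C: "EKR_set n Q e J C"
  shows "real (card C) * (1 + real CARD('a) ^ (n - 1)) \<le> real (card (flags_of_cotype n Q e J))"
proof (cases "C = {}")
  case False
  let ?F = "flags_of_cotype n Q e J"
  have CF: "C \<subseteq> ?F" and nopp: "\<And>x y. x \<in> C \<Longrightarrow> y \<in> C \<Longrightarrow> \<not> opposite n Q e x y"
    using C by (auto simp: EKR_set_def)
  obtain x0 where x0: "x0 \<in> C" "x0 \<in> ?F" using False CF by blast
  define k where "k = card {M \<in> chambers. x0 \<subseteq> M}"
  have k: "card {M \<in> chambers. x \<subseteq> M} = k" if "x \<in> ?F" for x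
    unfolding k_def using chambers_over_le[OF J(1)] that x0(2) by (simp add: le_antisym)
  obtain v where "v \<in> oriented" "x0 \<subseteq> chamber v" using flag_in_chambers x0(2) by (auto simp: flags_of_cotype_def)
  then have "{M \<in> chambers. x0 \<subseteq> M} \<noteq> {}" by (auto simp: chambers_def)
  then have k0: "k > 0" unfolding k_def by (simp add: card_gt_0_iff)
  have count: "card (\<Union>x\<in>D. {M \<in> chambers. x \<subseteq> M}) = card D * k" if D: "D \<subseteq> ?F" for D
  proof -
    have "card (\<Union>x\<in>D. {M \<in> chambers. x \<subseteq> M}) = (\<Sum>x\<in>D. card {M \<in> chambers. x \<subseteq> M})"
    proof (rule card_UN_disjoint)
      \<comment> \<open>A chamber over two flags of cotype \<open>J\<close> would have both as its
        only face of that cotype.\<close>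
      show "\<forall>x\<in>D. \<forall>y\<in>D. x \<noteq> y \<longrightarrow> {M \<in> chambers. x \<subseteq> M} \<inter> {M \<in> chambers. y \<subseteq> M} = {}"
      proof (intro ballI impI)
        fix x y assume xy: "x \<in> D" "y \<in> D" "x \<noteq> y"
        have "x = y" if M: "M \<in> chambers" "x \<subseteq> M" "y \<subseteq> M" for M
        proof -
          obtain u where u: "u \<in> oriented" "M = chamber u" using M(1) by (auto simp: chambers_def)
          have "x = face J (chamber u)" using flags_of_cotype_face[OF J(1) u(1), of x] M u xy D by blast
          moreover have "y = face J (chamber u)" using flags_of_cotype_face[OF J(1) u(1), of y] M u xy D by blast
          ultimately show ?thesis by simp
        qed
        then show "{M \<in> chambers. x \<subseteq> M} \<inter> {M \<in> chambers. y \<subseteq> M} = {}" using xy(3) by blast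
      qed
    qed simp_all
    also have "\<dots> = (\<Sum>x\<in>D. k)" using k D by (intro sum.cong) auto
    finally show ?thesis by simp
  qed
  have "(\<Union>x\<in>?F. {M \<in> chambers. x \<subseteq> M}) = chambers"
  proof (intro equalityI subsetI)
    fix M assume M: "M \<in> chambers"
    then obtain v where "v \<in> oriented" "M = chamber v" by (auto simp: chambers_def)
    then have "face J M \<in> ?F" "face J M \<subseteq> M" using flags_of_cotype_face[OF J(1)] by blast+
    then show "M \<in> (\<Union>x\<in>?F. {M \<in> chambers. x \<subseteq> M})" using M by blast
  qed blast
  then have cX: "card chambers = card ?F * k" using count[of ?F] by simp
  let ?C = "\<Union>x\<in>C. {M \<in> chambers. x \<subseteq> M}"
  have "real (card ?C) * (1 + real CARD('a) ^ (n - 1)) \<le> real (card chambers)"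
  proof (rule chamber_EKR_bound)
    fix M M' assume "M \<in> ?C" "M' \<in> ?C"
    then obtain x y where xy: "x \<in> C" "y \<in> C" "x \<subseteq> M" "y \<subseteq> M'" by blast
    have "cotype n e x = J" "cotype n e y = J" using xy CF by (auto simp: flags_of_cotype_def)
    \<comment> \<open>Position \<open>w0\<close> makes the chambers opposite, and with them the
      flags they contain; \<open>conj_w0 n J = J\<close> supplies the condition on the
      cotypes.\<close>
    then show "(M, M') \<notin> pos_rel (w0 n)"
      using nopp[OF xy(1,2)] xy J(2) pos_rel_w0_opposite unfolding opposite_def by metis
  qed blast
  then have "real k * (real (card C) * (1 + real CARD('a) ^ (n - 1))) \<le> real k * real (card ?F)"
    using count[OF CF] cX by (simp add: mult_ac)
  then show ?thesis using k0 by simp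
qed simp

end

theorem theorem3p25:
  fixes n q :: nat
    and Q :: "'a::{field,finite} ^ 'm \<Rightarrow> 'a"
    and e :: "int \<Rightarrow> ('a ^ 'm) set"
    and J :: "elt_type set"
    and C :: "('a ^ 'm) set set set"
  assumes "n \<ge> 4"
    and "CARD('a) = q"
    and "hyperbolic_quadratic_form n Q"
    and "polar_frame n Q e"
    and "J \<subseteq> elt_types n"
    and "conj_w0 n J = J"
    and "EKR_set n Q e J C"
  shows "real (card C) \<le> real (card (flags_of_cotype n Q e J)) / (1 + real q ^ (n - 1))"
proof -
  have qf: "quadratic_form Q" and dim: "CARD('m) = 2 * n"
    using assms(3) by (auto simp: hyperbolic_quadratic_form_def)
  interpret quadric n Q by unfold_locales (fact qf dim)+
  obtain v where v: "\<And>i. i \<in> I \<Longrightarrow> e i = vec.span {v i}" "\<And>i. i \<in> I \<Longrightarrow> Q (v i) = 0"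
    "\<And>i j. i \<in> I \<Longrightarrow> j \<in> I \<Longrightarrow> B (v i) (v j) = 0 \<longleftrightarrow> j \<noteq> - i"
    using frame_vectors[OF qf assms(4)] by metis
  \<comment> \<open>The frame determines its vectors up to scalars. Rescaling the vector of negative
    index in each pair normalises the pairing of opposite vectors to 1.\<close>
  define c where "c i = (if i > 0 then 1 else inverse (B (v (- i)) (v i)))" for i
  define v0 where "v0 i = c i *s v i" for i
  have c: "c i \<noteq> 0" if "i \<in> I" for i using v(3)[of "- i" i] that by (auto simp: c_def)
  have "hyperbolic_basis v0"
    unfolding hyperbolic_basis_def
  proof (intro conjI ballI)
    fix i j assume i: "i \<in> I" and j: "j \<in> I"
    show "Q (v0 i) = 0" using v(2)[OF i] by (simp add: v0_def Q_scale')
    have b: "B (v0 i) (v0 j) = c i * c j * B (v i) (v j)" by (simp add: v0_def B_lin)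
    show "B (v0 i) (v0 j) = (if j = - i then 1 else 0)"
    proof (cases "j = - i")
      case True
      have "B (v i) (v (- i)) \<noteq> 0" using v(3)[OF i, of "- i"] i by simp
      then show ?thesis using True i b by (cases "i > 0") (auto simp: c_def B_comm[of "v (- i)"])
    next
      case False
      then show ?thesis using v(3)[OF i j] b by simp
    qed
  qed
  moreover have "e i = vec.span {v0 i}" if i: "i \<in> I" for i
  proof -
    have "vec.span {v0 i} = vec.span {v i}"
    proof (rule vec.span_eq[THEN iffD2], intro conjI)
      show "{v0 i} \<subseteq> vec.span {v i}" by (simp add: v0_def vec.span_scale vec.span_base)
      have "v i = inverse (c i) *s v0 i" using c[OF i] by (simp add: v0_def)
      also have "\<dots> \<in> vec.span {v0 i}" by (intro vec.span_scale vec.span_base) simp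
      finally show "{v i} \<subseteq> vec.span {v0 i}" by simp
    qed
    then show ?thesis using v(1)[OF i] by simp
  qed
  ultimately interpret framed_quadric n Q v0 e by unfold_locales (use assms(1) in auto)
  have "1 + real q ^ (n - 1) > 0" by (simp add: add_pos_nonneg)
  then show ?thesis using EKR_bound[OF assms(5,6,7)] assms(2) by (simp add: pos_le_divide_eq)
qed

end
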